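(* Let $f,g:[0,1]\to\mathbb R_{\ge0}$ be piecewise $\mathcal C^1$ with $f(s)>0$, $g(s)\ge0$, let $n,k\to\infty$ with $\lim\frac kn=c$, and let $\lambda$ be a random Young diagram in the $n\times k$ rectangle with law $$\mu_{n,k}(\lambda)=\frac{s_\lambda(x_1,\dots,x_n)\,s_{\lambda'}(y_1,\dots,y_k)}{\prod_{i=1}^n\prod_{j=1}^k(1+x_iy_j)},\qquad x_i=f(i/n),\ y_j=g(j/k).$$ In the critical support case $t_+=c$ and for $\Delta\in\mathbb N$, $$\lim_{n\to\infty}\mathbb P(\lambda_1-nc\le-\Delta)=\det_{0\le i,j\le\Delta-1}\bigl[\delta_{i,j}-K_{\rm crit}(i,j)\bigr],$$ with the matrix $$K_{\rm crit}(i,j)=\sum_{\ell=0}^{\lfloor(\Delta-j-1)/2\rfloor}\begin{cases}\frac1{2\pi}\,\frac1{\ell!}\,\sin\frac{\pi(j-i)}2\;\Gamma\bigl(\ell+\frac{j-i}2\bigr),&\text{if }\ell+\frac{j-i}2\notin\mathbb Z_{\le0},\\[2mm]\frac12\,\frac{(-1)^\ell}{\ell!\,\bigl(\frac{i-j}2-\ell\bigr)!},&\text{if }\ell+\frac{j-i}2\in\mathbb Z_{\le0}.\end{cases}$$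
   Context: $s_\lambda$ is the Schur polynomial and $\lambda'$ the conjugate partition; the diagram has at most $n$ rows, each of length at most $k$, and $\lambda_1$ is the length of its first row. The support interval $(t_-,t_+)\subseteq[-1,c]$ is the interval of $t$ on which the equation in $z$ $$\int_0^1\frac{f(s)z}{1-f(s)z}ds+c\int_0^1\frac{g(s)}{z+g(s)}ds-t=0$$ has exactly two complex conjugate roots. $t_+$ is its right endpoint, and $t_+=c$ means that the limit shape of the rotated diagram, scaled by $1/n$, ends exactly at the right corner of the rectangle.
   Formalization: lim k/n=c alone is not enough: the limit is proved for k=⌊nc⌋ eventually, or, for k−nc=o(√n), with λ_1−k≤−Δ in place of λ_1−nc≤−Δ; piecewise C^1 means C^1 up to the ends of each piece, with no isolated values at break points. *)

theory Defs
  imports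
    "HOL-Analysis.Analysis"
    "HOL-Library.FuncSet"
    "Jordan_Normal_Form.Determinant"
begin

text \<open>
  Jumps are allowed. The pieces are non-degenerate intervals covering \<open>{0..1}\<close>, and \<open>f\<close> is
  \<open>C\<^sup>1\<close> on each of them up to the end points of the piece; in particular the value of \<open>f\<close> at a
  break point is one of its one-sided limits there. The library notion
  \<open>piecewise_C1_differentiable_on\<close> is different: it requires continuity, but it allows the
  derivative to blow up at a break point.
\<close>

definition piecewise_C1 :: "(real \<Rightarrow> real) \<Rightarrow> bool" where
  "piecewise_C1 f \<longleftrightarrow>
     (\<exists>P. finite P \<and> \<Union>P = {0..1} \<and>
        (\<forall>I\<in>P. is_interval I \<and> interior I \<noteq> {} \<and>
           (\<exists>h. h C1_differentiable_on closure I \<and> (\<forall>s\<in>I. f s = h s))))"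

text \<open>
  A Young diagram is the sequence of its row lengths, padded with zeros and indexed from \<open>0\<close>,
  so that the first row has length \<open>lam 0\<close>.
\<close>

definition diagrams_in_box :: "nat \<Rightarrow> nat \<Rightarrow> (nat \<Rightarrow> nat) set" where
  "diagrams_in_box n k = {lam. antimono lam \<and> (\<forall>i. lam i \<le> k) \<and> (\<forall>i\<ge>n. lam i = 0)}"

definition conjugate :: "(nat \<Rightarrow> nat) \<Rightarrow> nat \<Rightarrow> nat" where
  "conjugate lam j = card {i. j < lam i}"

definition cells :: "(nat \<Rightarrow> nat) \<Rightarrow> (nat \<times> nat) set" where
  "cells lam = {(i, j). j < lam i}"

text \<open>
  Semistandard tableaux of shape \<open>lam\<close> with entries in \<open>{1..n}\<close>; they are extensional functions
  on the cells, so that each tableau is counted once.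
\<close>

definition ssyt :: "nat \<Rightarrow> (nat \<Rightarrow> nat) \<Rightarrow> (nat \<times> nat \<Rightarrow> nat) set" where
  "ssyt n lam =
     {T \<in> cells lam \<rightarrow>\<^sub>E {1..n}.
        (\<forall>i j j'. j < j' \<and> (i, j') \<in> cells lam \<longrightarrow> T (i, j) \<le> T (i, j')) \<and>
        (\<forall>i i' j. i < i' \<and> (i', j) \<in> cells lam \<longrightarrow> T (i, j) < T (i', j))}"

definition schur :: "nat \<Rightarrow> (nat \<Rightarrow> nat) \<Rightarrow> (nat \<Rightarrow> real) \<Rightarrow> real" where
  "schur n lam x = (\<Sum>T\<in>ssyt n lam. \<Prod>u\<in>cells lam. x (T u))"

definition mu ::
  "(real \<Rightarrow> real) \<Rightarrow> (real \<Rightarrow> real) \<Rightarrow> nat \<Rightarrow> nat \<Rightarrow> (nat \<Rightarrow> nat) \<Rightarrow> real" where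
  "mu f g n k lam =
     (let x = (\<lambda>i. f (real i / real n)); y = (\<lambda>j. g (real j / real k)) in
        schur n lam x * schur k (conjugate lam) y / (\<Prod>i=1..n. \<Prod>j=1..k. 1 + x i * y j))"

text \<open>
  For \<open>f, g \<ge> 0\<close> on \<open>{0..1}\<close> the weights are nonnegative, and they add up to \<open>1\<close> by the dual
  Cauchy identity.
\<close>

definition diagram_law ::
  "(real \<Rightarrow> real) \<Rightarrow> (real \<Rightarrow> real) \<Rightarrow> nat \<Rightarrow> nat \<Rightarrow> (nat \<Rightarrow> nat) measure" where
  "diagram_law f g n k = point_measure (diagrams_in_box n k) (\<lambda>lam. ennreal (mu f g n k lam))"

definition is_root ::
  "(real \<Rightarrow> real) \<Rightarrow> (real \<Rightarrow> real) \<Rightarrow> real \<Rightarrow> real \<Rightarrow> complex \<Rightarrow> bool" where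
  "is_root f g c t z \<longleftrightarrow>
     integral {0..1} (\<lambda>s. of_real (f s) * z / (1 - of_real (f s) * z))
     + of_real c * integral {0..1} (\<lambda>s. of_real (g s) / (z + of_real (g s)))
     - of_real t = 0"

text \<open>
  Exactly two non-real roots, which are conjugate to each other. Real roots are not counted; the
  equation may have any number of them. For non-real \<open>z\<close> and \<open>f, g\<close> piecewise \<open>C\<^sup>1\<close> both
  integrands are integrable.
\<close>

definition two_conjugate_roots ::
  "(real \<Rightarrow> real) \<Rightarrow> (real \<Rightarrow> real) \<Rightarrow> real \<Rightarrow> real \<Rightarrow> bool" where
  "two_conjugate_roots f g c t \<longleftrightarrow>
     (\<exists>w. Im w \<noteq> 0 \<and> {z. Im z \<noteq> 0 \<and> is_root f g c t z} = {w, cnj w})"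

definition is_support_interval ::
  "(real \<Rightarrow> real) \<Rightarrow> (real \<Rightarrow> real) \<Rightarrow> real \<Rightarrow> real \<Rightarrow> real \<Rightarrow> bool" where
  "is_support_interval f g c t_minus t_plus \<longleftrightarrow>
     t_minus < t_plus \<and> {t_minus<..<t_plus} \<subseteq> {-1..c} \<and>
     {t. two_conjugate_roots f g c t} = {t_minus<..<t_plus}"

text \<open>
  For \<open>i, j < \<Delta>\<close> no subtraction truncates and no division rounds, except in
  \<open>(\<Delta> - j - 1) div 2\<close>, where rounding down is intended. In particular, in the first branch
  \<open>(i - j) / 2 - l\<close> is a natural number.
\<close>

definition K_crit :: "nat \<Rightarrow> nat \<Rightarrow> nat \<Rightarrow> real" where
  "K_crit \<Delta> i j =
     (\<Sum>l = 0..(\<Delta> - j - 1) div 2.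
        if real l + (real j - real i) / 2 \<in> \<int>\<^sub>\<le>\<^sub>0
        then 1 / 2 * ((-1) ^ l / (fact l * fact ((i - j) div 2 - l)))
        else 1 / (2 * pi) * (1 / fact l) * sin (pi * (real j - real i) / 2)
             * Gamma (real l + (real j - real i) / 2))"

text \<open>The determinant of a \<open>0 \<times> 0\<close> matrix is \<open>1\<close>.\<close>

definition crit_det :: "nat \<Rightarrow> real" where
  "crit_det \<Delta> =
     Determinant.det (Matrix.mat \<Delta> \<Delta> (\<lambda>(i, j). (if i = j then 1 else 0) - K_crit \<Delta> i j))"

end

theory Submission
  imports Defs "HOL-Complex_Analysis.Complex_Analysis" "HOL-Probability.Probability"
    "HOL-Real_Asymp.Real_Asymp"
begin

text \<open>
  By the branching rules, the products of Schur polynomials with \<open>lam 0 \<le> k - \<Delta>\<close> add up to an \<open>n \<times> n\<close> determinant of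
  divided differences of truncated monomials times \<open>\<Prod>j. 1 + y\<^sub>j z\<close>. Without the truncation it is
  triangular and equals the denominator of the measure. The truncation removes a part of rank
  \<open>\<Delta>\<close>, since dividing by \<open>\<Prod>j. 1 + y\<^sub>j z\<close> is Newton interpolation at the \<open>x\<^sub>i\<close>; so Sylvester's
  identity leaves a \<open>\<Delta> \<times> \<Delta>\<close> determinant whose entries are contour integrals of
  \<open>z\<^sup>m / (\<Prod>j. 1 + y\<^sub>j z) (\<Prod>i. z - x\<^sub>i)\<close> on a circle through \<open>0\<close>.

  As \<open>t\<close> tends to \<open>c\<close>, the two roots of the equation tend to \<open>0\<close>. This forces \<open>g\<close> to be bounded
  away from \<open>0\<close> and \<open>\<integral> f = c \<integral> 1 / g\<close>, hence \<open>\<Sum>j. 1 / y\<^sub>j - \<Sum>i. x\<^sub>i = o(\<surd>n)\<close>: the linear term of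
  \<open>\<Sum>j. ln (1 + \<eta> / y\<^sub>j) + \<Sum>i. ln (1 - x\<^sub>i \<eta>)\<close> at \<open>\<eta> = 1 / z\<close> is negligible on the scale \<open>1 / \<surd>n\<close>.
  The circle becomes the line \<open>Re \<eta> = 1\<close>, and after \<open>\<eta>\<close> is rescaled by a multiple of \<open>\<surd>n\<close> the
  integrand converges to \<open>\<eta>\<^sup>m exp \<eta>\<^sup>2\<close>. These are Hankel integrals for \<open>1 / \<Gamma>\<close>.
\<close>

subsection \<open>Determinants\<close>

text \<open>Contour and scaling fit together. After the rescaling by S the nodes lie in (0,1),
  inside the circle with diameter [0,1], while the poles -1 / (y_j S) on the negative axis stay
  outside; and inversion maps this circle to a line on which the Gaussian limit is integrable. The
  exponents of z on the circle are nonnegative, so the point 0 on it is harmless. All identities are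
  exact for finite n on one fixed contour, and only a bounded number of coefficients and integrals
  pass to the limit. Exchanging limit and integral requires a lower bound for the product on the
  whole line, uniform in n; it comes from Bernoulli's inequality applied factor by factor. The other
  obstacle is that g may vanish a priori, so that 1 / g need not be integrable. Instead of following
  the roots as t varies, two exact identities, one from the imaginary part of the equation and one
  from a combination of its real and imaginary parts, are combined with Fatou's lemma.\<close>

definition ldet :: "nat \<Rightarrow> (nat \<Rightarrow> nat \<Rightarrow> 'a::comm_ring_1) \<Rightarrow> 'a" where
  "ldet n A = Determinant.det (Matrix.mat n n (\<lambda>(i, j). A i j))"

lemma permutes_lt: fixes n :: nat shows "p permutes {0..<n} \<Longrightarrow> i < n \<Longrightarrow> p i < n"
  using permutes_in_image[of p "{0..<n}" i] by (metis atLeastLessThan_iff le0)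

lemma ldet_leibniz:
  "ldet n A = (\<Sum>p | p permutes {0..<n}. signof p * (\<Prod>i = 0..<n. A i (p i)))"
proof -
  have "ldet n A = (\<Sum>p | p permutes {0..<n}. signof p * (\<Prod>i = 0..<n. Matrix.mat n n (\<lambda>(i, j). A i j) $$ (i, p i)))"
    unfolding ldet_def by (rule det_def') simp
  also have "\<dots> = (\<Sum>p | p permutes {0..<n}. signof p * (\<Prod>i = 0..<n. A i (p i)))"
  proof (rule sum.cong[OF refl])
    fix p assume "p \<in> {p. p permutes {0..<n}}"
    then have "Matrix.mat n n (\<lambda>(i, j). A i j) $$ (i, p i) = A i (p i)" if "i \<in> {0..<n}" for i
      using that permutes_lt[of p n i] by simp
    then show "signof p * (\<Prod>i = 0..<n. Matrix.mat n n (\<lambda>(i, j). A i j) $$ (i, p i))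
        = signof p * (\<Prod>i = 0..<n. A i (p i))"
      by (intro arg_cong[of _ _ "(*) (signof p)"] prod.cong refl)
  qed
  finally show ?thesis .
qed

lemma ldet_cong:
  "(\<And>i j. i < n \<Longrightarrow> j < n \<Longrightarrow> A i j = B i j) \<Longrightarrow> ldet n A = ldet n B"
  unfolding ldet_def by (intro arg_cong[of _ _ Determinant.det] eq_matI) auto

lemma ldet_0 [simp]: "ldet 0 A = 1"
  by (simp add: ldet_def)

lemma ldet_transpose: "ldet n (\<lambda>i j. A j i) = ldet n A"
proof -
  have "Matrix.mat n n (\<lambda>(i, j). A j i) = Matrix.transpose_mat (Matrix.mat n n (\<lambda>(i, j). A i j))"
    by (intro eq_matI) auto
  then show ?thesis
    unfolding ldet_def by (simp add: Determinant.det_transpose[of _ n])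
qed

lemma ldet_mult:
  "ldet n (\<lambda>i j. \<Sum>l<n. A i l * B l j) = ldet n A * ldet n B"
proof -
  have "Matrix.mat n n (\<lambda>(i, j). \<Sum>l<n. A i l * B l j)
      = Matrix.mat n n (\<lambda>(i, j). A i j) * Matrix.mat n n (\<lambda>(i, j). B i j)"
    by (intro eq_matI) (auto simp: scalar_prod_def lessThan_atLeast0 intro!: sum.cong)
  then show ?thesis
    unfolding ldet_def by (simp add: Determinant.det_mult[of _ n])
qed

lemma ldet_upper_triangular:
  assumes "\<And>i j. j < i \<Longrightarrow> i < n \<Longrightarrow> A i j = 0"
  shows "ldet n A = (\<Prod>i<n. A i i)"
proof -
  let ?M = "Matrix.mat n n (\<lambda>(i, j). A i j)"
  have "upper_triangular ?M"
    using assms by (auto simp: upper_triangular_def)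
  then have "Determinant.det ?M = prod_list (diag_mat ?M)"
    by (rule det_upper_triangular[of _ n]) simp
  also have "\<dots> = (\<Prod>i<n. A i i)"
    by (simp add: diag_mat_def prod.list_conv_set_nth lessThan_atLeast0)
  finally show ?thesis
    by (simp only: ldet_def)
qed

lemma ldet_lower_triangular:
  assumes "\<And>i j. i < j \<Longrightarrow> j < n \<Longrightarrow> A i j = 0"
  shows "ldet n A = (\<Prod>i<n. A i i)"
  using ldet_upper_triangular[of n "\<lambda>i j. A j i"] assms ldet_transpose[of n A] by simp

lemma ldet_equal_columns:
  assumes "a < n" "b < n" "a \<noteq> b" "\<And>i. i < n \<Longrightarrow> A i a = A i b"
  shows "ldet n A = 0"
  unfolding ldet_def
  by (rule det_identical_columns[of _ n a b]) (use assms in \<open>auto intro!: eq_vecI\<close>)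

lemma ldet_zero_column:
  assumes "b < n" "\<And>i. i < n \<Longrightarrow> A i b = 0"
  shows "ldet n A = 0"
proof -
  have "signof p * (\<Prod>i = 0..<n. A i (p i)) = 0" if p: "p permutes {0..<n}" for p
  proof -
    obtain i where "i \<in> {0..<n}" "p i = b"
      using permutes_image[OF p] assms(1) by (metis atLeastLessThan_iff imageE zero_le)
    then have "(\<Prod>i = 0..<n. A i (p i)) = 0"
      using assms(2)[of i] by (intro prod_zero bexI[of _ i]) auto
    then show ?thesis by simp
  qed
  then show ?thesis by (simp add: ldet_leibniz)
qed

lemma ldet_first_row:
  fixes A :: "nat \<Rightarrow> nat \<Rightarrow> 'a::idom"
  assumes "\<And>j. 0 < j \<Longrightarrow> j \<le> n \<Longrightarrow> A 0 j = 0"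
  shows "ldet (Suc n) A = A 0 0 * ldet n (\<lambda>i j. A (Suc i) (Suc j))"
proof -
  have eq: "Matrix.mat (Suc n) (Suc n) (\<lambda>(i, j). A i j)
     = four_block_mat (Matrix.mat 1 1 (\<lambda>(i, j). A 0 0)) (0\<^sub>m 1 n)
         (Matrix.mat n 1 (\<lambda>(i, j). A (Suc i) 0)) (Matrix.mat n n (\<lambda>(i, j). A (Suc i) (Suc j)))"
    by (intro eq_matI) (auto simp: assms four_block_mat_def Let_def)
  show ?thesis
    unfolding ldet_def eq
    by (subst det_four_block_mat_upper_right_zero[of _ 1 _ n]) (auto simp: det_single)
qed

text \<open>Multilinearity in the columns: expanding every column over its own index set leaves one
  determinant for each choice function \<open>h\<close>.\<close>

lemma ldet_column_sums:
  fixes u a :: "nat \<Rightarrow> nat \<Rightarrow> 'a::comm_ring_1"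
  assumes "\<And>j. j < n \<Longrightarrow> finite (B j)"
  shows "ldet n (\<lambda>i j. \<Sum>p\<in>B j. a j p * u i p)
    = (\<Sum>h\<in>PiE {..<n} B. (\<Prod>j<n. a j (h j)) * ldet n (\<lambda>i j. u i (h j)))"
proof -
  \<comment> \<open>The product of sums has to be expanded column by column; reading a Leibniz
    product by columns costs an inverse permutation.\<close>
  have swap: "(\<Prod>i = 0..<n. F i (p i)) = (\<Prod>j<n. F (inv_into UNIV p j) j)" if p: "p permutes {0..<n}"
    for F :: "nat \<Rightarrow> nat \<Rightarrow> 'a" and p
    by (rule prod.reindex_bij_witness[of _ "inv_into UNIV p" p])
       (use p permutes_inv[OF p] in \<open>auto simp: permutes_inverses permutes_lt\<close>)
  have "ldet n (\<lambda>i j. \<Sum>p\<in>B j. a j p * u i p)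
     = (\<Sum>p | p permutes {0..<n}. signof p * (\<Prod>j<n. \<Sum>q\<in>B j. a j q * u (inv_into UNIV p j) q))"
    unfolding ldet_leibniz
    by (intro sum.cong refl) (simp add: swap[of _ "\<lambda>i j. \<Sum>q\<in>B j. a j q * u i q"])
  also have "\<dots> = (\<Sum>p | p permutes {0..<n}. signof p *
      (\<Sum>h\<in>PiE {..<n} B. (\<Prod>j<n. a j (h j)) * (\<Prod>j<n. u (inv_into UNIV p j) (h j))))"
    using assms by (subst prod_sum_PiE) (auto simp: prod.distrib)
  also have "\<dots> = (\<Sum>h\<in>PiE {..<n} B. (\<Prod>j<n. a j (h j)) *
      (\<Sum>p | p permutes {0..<n}. signof p * (\<Prod>j<n. u (inv_into UNIV p j) (h j))))"
    unfolding sum_distrib_left by (subst sum.swap) (simp only: mult_ac)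
  also have "\<dots> = (\<Sum>h\<in>PiE {..<n} B. (\<Prod>j<n. a j (h j)) * ldet n (\<lambda>i j. u i (h j)))"
    unfolding ldet_leibniz
    by (intro sum.cong arg_cong2[of _ _ _ _ "(*)"] refl swap[symmetric]) simp
  finally show ?thesis .
qed

text \<open>Both sides are the determinant of the block matrix with blocks I, C, B, I. Right
  multiplication by a unipotent block matrix clears either B or C and leaves one of the two Schur
  complements.\<close>

lemma ldet_sylvester:
  fixes C B :: "nat \<Rightarrow> nat \<Rightarrow> 'a::idom"
  shows "ldet n (\<lambda>i j. (if i = j then 1 else 0) - (\<Sum>r<d. C i r * B r j))
     = ldet d (\<lambda>r s. (if r = s then 1 else 0) - (\<Sum>j<n. B r j * C j s))"
proof -
  let ?C = "Matrix.mat n d (\<lambda>(i, r). C i r)" and ?B = "Matrix.mat d n (\<lambda>(r, j). B r j)"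
  let ?I = "1\<^sub>m n :: 'a mat" and ?J = "1\<^sub>m d :: 'a mat"
  let ?X = "Matrix.mat n n (\<lambda>(i, j). (if i = j then 1 else 0) - (\<Sum>r<d. C i r * B r j))"
  let ?Y = "Matrix.mat d d (\<lambda>(r, s). (if r = s then 1 else 0) - (\<Sum>j<n. B r j * C j s))"
  have X: "?X = ?I + ?C * (- ?B)"
    by (intro eq_matI) (auto simp: scalar_prod_def lessThan_atLeast0 sum_negf)
  have Y: "?Y = ?B * (- ?C) + ?J"
    by (intro eq_matI) (auto simp: scalar_prod_def lessThan_atLeast0 sum_negf)
  let ?M = "four_block_mat ?I ?C ?B ?J"
  have c: "?M \<in> carrier_mat (n + d) (n + d)"
    by auto
  have z1: "?B + - ?B = 0\<^sub>m d n" and z2: "- ?C + ?C = 0\<^sub>m n d"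
    by (auto intro: eq_matI)
  have 1: "?M * four_block_mat ?I (0\<^sub>m n d) (- ?B) ?J = four_block_mat ?X ?C (0\<^sub>m d n) ?J"
    by (subst mult_four_block_mat[of ?I n n ?C d ?B d ?J ?I n "0\<^sub>m n d" d "- ?B" ?J]) (simp_all add: X z1)
  have 2: "?M * four_block_mat ?I (- ?C) (0\<^sub>m d n) ?J = four_block_mat ?I (0\<^sub>m n d) ?B ?Y"
    by (subst mult_four_block_mat[of ?I n n ?C d ?B d ?J ?I n "- ?C" d "0\<^sub>m d n" ?J]) (simp_all add: Y z2)
  have "Determinant.det ?M = Determinant.det ?X"
    using arg_cong[OF 1, of Determinant.det] Determinant.det_mult[OF c, of "four_block_mat ?I (0\<^sub>m n d) (- ?B) ?J"]
      det_four_block_mat_upper_right_zero[of ?I n "0\<^sub>m n d" d "- ?B" ?J]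
      det_four_block_mat_lower_left_zero[of ?X n ?C d "0\<^sub>m d n" ?J] by simp
  moreover have "Determinant.det ?M = Determinant.det ?Y"
    using arg_cong[OF 2, of Determinant.det] Determinant.det_mult[OF c, of "four_block_mat ?I (- ?C) (0\<^sub>m d n) ?J"]
      det_four_block_mat_upper_right_zero[of ?I n "0\<^sub>m n d" d ?B ?Y]
      det_four_block_mat_lower_left_zero[of ?I n "- ?C" d "0\<^sub>m d n" ?J] by simp
  ultimately show ?thesis by (simp add: ldet_def)
qed

subsection \<open>Divided differences and Schur polynomials\<close>

text \<open>\<open>divdiff X i p\<close> is the divided difference of \<open>z\<^sup>p\<close> at the nodes \<open>X 0, \<dots>, X i\<close>.\<close>

fun divdiff :: "(nat \<Rightarrow> 'a::comm_ring_1) \<Rightarrow> nat \<Rightarrow> nat \<Rightarrow> 'a" where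
  "divdiff X 0 p = X 0 ^ p"
| "divdiff X (Suc i) 0 = 0"
| "divdiff X (Suc i) (Suc p) = X (Suc i) * divdiff X (Suc i) p + divdiff X i p"

text \<open>As a polynomial in the nodes, \<open>divdiff X i p\<close> is the complete homogeneous
  symmetric polynomial of degree p - i in \<open>X 0\<close>, ..., \<open>X i\<close>.\<close>

lemma divdiff_less: "p < i \<Longrightarrow> divdiff X i p = 0"
  by (induction X i p rule: divdiff.induct) auto

lemma divdiff_same: "divdiff X i i = 1"
  by (induction i) (simp_all add: divdiff_less)

text \<open>Divided differences are symmetric in the nodes. The recursion peels off the last node;
  this peels off the first, since (z - \<open>X 0\<close>) z^p no longer sees
  \<open>X 0\<close>.\<close>

lemma divdiff_shift:
  "divdiff X (Suc i) (Suc p) - X 0 * divdiff X (Suc i) p = divdiff (\<lambda>i. X (Suc i)) i p"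
proof (induction p arbitrary: i)
  case 0
  then show ?case by (cases i) auto
next
  case (Suc p)
  show ?case
  proof (cases i)
    case 0
    have "divdiff X (Suc 0) (Suc (Suc p)) - X 0 * divdiff X (Suc 0) (Suc p)
      = X (Suc 0) * (divdiff X (Suc 0) (Suc p) - X 0 * divdiff X (Suc 0) p)"
      by (simp add: algebra_simps)
    also have "\<dots> = X (Suc 0) * divdiff (\<lambda>i. X (Suc i)) 0 p"
      by (simp only: Suc.IH)
    finally show ?thesis
      using 0 by simp
  next
    case (Suc j)
    have "divdiff X (Suc i) (Suc (Suc p)) - X 0 * divdiff X (Suc i) (Suc p)
      = X (Suc i) * (divdiff X (Suc i) (Suc p) - X 0 * divdiff X (Suc i) p)
        + (divdiff X i (Suc p) - X 0 * divdiff X i p)"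
      by (simp add: algebra_simps)
    also have "\<dots> = X (Suc i) * divdiff (\<lambda>i. X (Suc i)) i p + divdiff (\<lambda>i. X (Suc i)) j p"
      using Suc by (simp only: Suc.IH \<open>i = Suc j\<close>)
    finally show ?thesis
      using Suc by simp
  qed
qed

text \<open>\<open>divdiff_shift\<close> summed with powers of \<open>X 0\<close> as
  weights.\<close>

lemma divdiff_telescope:
  assumes "l \<le> l'"
  shows "divdiff X (Suc i) l' - X 0 ^ (l' - l) * divdiff X (Suc i) l
    = (\<Sum>p\<in>{l..<l'}. X 0 ^ (l' - 1 - p) * divdiff (\<lambda>i. X (Suc i)) i p)"
  using assms
proof (induction l' rule: dec_induct)
  case base
  then show ?case by simp
next
  case (step m)
  have "(\<Sum>p\<in>{l..<Suc m}. X 0 ^ (Suc m - 1 - p) * divdiff (\<lambda>i. X (Suc i)) i p)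
     = divdiff (\<lambda>i. X (Suc i)) i m + (\<Sum>p\<in>{l..<m}. X 0 * (X 0 ^ (m - 1 - p) * divdiff (\<lambda>i. X (Suc i)) i p))"
  proof -
    have "X 0 ^ (m - p) = X 0 * X 0 ^ (m - 1 - p)" if "p < m" for p
      using that by (metis Suc_diff_1 Suc_diff_Suc diff_commute power_Suc zero_less_diff)
    then have "(\<Sum>p\<in>{l..<m}. X 0 ^ (m - p) * divdiff (\<lambda>i. X (Suc i)) i p)
        = (\<Sum>p\<in>{l..<m}. X 0 * (X 0 ^ (m - 1 - p) * divdiff (\<lambda>i. X (Suc i)) i p))"
      by (intro sum.cong refl) (simp add: mult.assoc)
    then show ?thesis
      using step.hyps(1) by (simp add: atLeastLessThanSuc)
  qed
  also have "\<dots> = divdiff (\<lambda>i. X (Suc i)) i m + X 0 * (divdiff X (Suc i) m - X 0 ^ (m - l) * divdiff X (Suc i) l)"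
    by (simp only: step.IH sum_distrib_left)
  also have "\<dots> = divdiff X (Suc i) (Suc m) - X 0 ^ (Suc m - l) * divdiff X (Suc i) l"
    using step.hyps(1) by (simp add: divdiff_shift[symmetric] Suc_diff_le algebra_simps)
  finally show ?case by simp
qed

text \<open>Column operations clear the first row, and by \<open>divdiff_telescope\<close> every
  remaining entry becomes a sum over exponents between two neighbouring \<open>l j\<close>.
  Expanding these sums gives the interlacing sequences of the branching rule.\<close>

lemma ldet_divdiff_Suc:
  fixes X :: "nat \<Rightarrow> 'a::idom"
  assumes "\<And>j. j < n \<Longrightarrow> l j \<le> l (Suc j)"
  shows "ldet (Suc n) (\<lambda>i j. divdiff X i (l j)) = X 0 ^ l 0 *
    (\<Sum>h\<in>PiE {..<n} (\<lambda>j. {l j..<l (Suc j)}).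
      (\<Prod>j<n. X 0 ^ (l (Suc j) - 1 - h j)) * ldet n (\<lambda>i j. divdiff (\<lambda>i. X (Suc i)) i (h j)))"
proof -
  \<comment> \<open>Right multiplication by \<open>U\<close> subtracts from each column the multiple
    of its left neighbour that cancels the entry in row 0.\<close>
  define U :: "nat \<Rightarrow> nat \<Rightarrow> 'a" where
    "U = (\<lambda>a j. if a = j then 1 else if Suc a = j then - (X 0 ^ (l j - l a)) else 0)"
  define A where "A = (\<lambda>i j. \<Sum>a<Suc n. divdiff X i (l a) * U a j)"
  have "ldet (Suc n) U = (\<Prod>i<Suc n. U i i)"
    by (rule ldet_upper_triangular) (auto simp: U_def)
  then have U: "ldet (Suc n) U = 1"
    by (simp add: U_def)
  have A0: "A i 0 = divdiff X i (l 0)" for i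
  proof -
    have "A i 0 = (\<Sum>a<Suc n. if a = 0 then divdiff X i (l 0) else 0)"
      unfolding A_def by (intro sum.cong) (auto simp: U_def)
    then show ?thesis by simp
  qed
  have AS: "A i (Suc j) = divdiff X i (l (Suc j)) - X 0 ^ (l (Suc j) - l j) * divdiff X i (l j)"
    if "j < n" for i j
  proof -
    have "A i (Suc j) = (\<Sum>a<Suc n. (if a = Suc j then divdiff X i (l (Suc j)) else 0)
        + (if a = j then - (X 0 ^ (l (Suc j) - l j) * divdiff X i (l j)) else 0))"
      unfolding A_def by (intro sum.cong) (auto simp: U_def)
    then show ?thesis
      using that by (simp add: sum.distrib)
  qed
  have "ldet (Suc n) (\<lambda>i j. divdiff X i (l j)) = ldet (Suc n) A"
    unfolding A_def by (subst ldet_mult) (simp add: U)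
  also have "\<dots> = A 0 0 * ldet n (\<lambda>i j. A (Suc i) (Suc j))"
  proof (rule ldet_first_row)
    fix j assume "0 < j" "j \<le> n"
    then obtain j' where j': "j = Suc j'" "j' < n"
      by (cases j) auto
    then show "A 0 j = 0"
      using assms[of j'] by (simp add: AS power_add[symmetric])
  qed
  also have "ldet n (\<lambda>i j. A (Suc i) (Suc j)) = ldet n (\<lambda>i j. \<Sum>p\<in>{l j..<l (Suc j)}.
      X 0 ^ (l (Suc j) - 1 - p) * divdiff (\<lambda>i. X (Suc i)) i p)"
    by (rule ldet_cong) (simp only: AS divdiff_telescope[OF assms])
  also have "\<dots> = (\<Sum>h\<in>PiE {..<n} (\<lambda>j. {l j..<l (Suc j)}).
      (\<Prod>j<n. X 0 ^ (l (Suc j) - 1 - h j)) * ldet n (\<lambda>i j. divdiff (\<lambda>i. X (Suc i)) i (h j)))"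
    by (rule ldet_column_sums) simp
  finally show ?thesis
    by (simp add: A0)
qed

section \<open>Partitions, conjugation and cells\<close>

definition partitions :: "nat \<Rightarrow> (nat \<Rightarrow> nat) set" where
  "partitions n = {lam. antimono lam \<and> (\<forall>i\<ge>n. lam i = 0)}"

lemma down_closed_eq_lessThan:
  fixes D :: "nat set"
  assumes "finite D" "\<And>i j. i < j \<Longrightarrow> j \<in> D \<Longrightarrow> i \<in> D"
  shows "D = {..<card D}"
proof (cases "D = {}")
  case False
  define m where "m = Max D"
  have "D = {..m}"
    using assms(2)[of _ m] Max_in[OF assms(1) False] Max_ge[OF assms(1)]
    by (auto simp: m_def le_less)
  then have "D = {..<Suc m}" by auto
  then show ?thesis by (metis card_lessThan)
qed auto

text \<open>The rows longer than j form an initial segment, so their number is the first row that is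
  not. Later arguments on conjugates use this equivalence in place of the cardinality.\<close>

lemma less_conjugate_iff:
  assumes "lam \<in> partitions n"
  shows "i < conjugate lam j \<longleftrightarrow> j < lam i"
proof -
  have "{i. j < lam i} = {..<card {i. j < lam i}}"
  proof (rule down_closed_eq_lessThan)
    have "{i. j < lam i} \<subseteq> {..<n}"
      using assms by (auto simp: partitions_def) (metis not_le not_less_zero)
    then show "finite {i. j < lam i}"
      by (rule finite_subset) simp
    show "i \<in> {i. j < lam i}" if "i < i'" "i' \<in> {i. j < lam i}" for i i'
      using assms that antimonoD[of lam i i'] by (auto simp: partitions_def)
  qed
  then show ?thesis by (auto simp: conjugate_def)
qed

text \<open>Numbers are compared through the sets below them, so that
  \<open>less_conjugate_iff\<close> can rewrite equations and inequalities between
  conjugates.\<close>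

lemma nat_eq_iff_less: "(a::nat) = b \<longleftrightarrow> (\<forall>i. i < a \<longleftrightarrow> i < b)"
  by (metis less_irrefl linorder_neqE_nat)

lemma nat_le_iff_less: "(a::nat) \<le> b \<longleftrightarrow> (\<forall>i. i < a \<longrightarrow> i < b)"
  by (meson less_irrefl not_le order_less_le_trans)

lemma conjugate_in_partitions:
  assumes "lam \<in> partitions n" "lam 0 \<le> k"
  shows "conjugate lam \<in> partitions k"
proof -
  have "conjugate lam j' \<le> conjugate lam j" if "j \<le> j'" for j j'
    unfolding nat_le_iff_less less_conjugate_iff[OF assms(1)] using that by auto
  moreover have "conjugate lam j = 0" if "j \<ge> k" for j
    using less_conjugate_iff[OF assms(1), of 0 j] assms(2) that by simp
  ultimately show ?thesis by (auto simp: partitions_def intro: antimonoI)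
qed

lemma conjugate_conjugate:
  assumes "lam \<in> partitions n"
  shows "conjugate (conjugate lam) = lam"
  using less_conjugate_iff[OF conjugate_in_partitions[OF assms order_refl]] less_conjugate_iff[OF assms]
  by (auto simp: fun_eq_iff nat_eq_iff_less)

lemma cells_subset: "lam \<in> partitions n \<Longrightarrow> cells lam \<subseteq> {..<n} \<times> {..<lam 0}"
  by (auto simp: cells_def partitions_def antimono_def intro: less_le_trans) (metis not_le not_less_zero)

lemma finite_cells: "lam \<in> partitions n \<Longrightarrow> finite (cells lam)"
  by (rule finite_subset[OF cells_subset]) auto

lemma cells_conjugate: "lam \<in> partitions n \<Longrightarrow> cells (conjugate lam) = prod.swap ` cells lam"
  by (auto simp: cells_def less_conjugate_iff image_iff)

lemma card_cells_diff:
  assumes "lam \<in> partitions n"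
  shows "card (cells lam - cells nu) = (\<Sum>i<n. lam i - nu i)"
proof -
  have "cells lam - cells nu = (SIGMA i:{..<n}. {nu i..<lam i})"
    using cells_subset[OF assms] by (auto simp: cells_def)
  then show ?thesis by simp
qed

section \<open>Semistandard tableaux and the branching rules\<close>

lemma finite_ssyt: "lam \<in> partitions m \<Longrightarrow> finite (ssyt n lam)"
  by (rule finite_subset[of _ "cells lam \<rightarrow>\<^sub>E {1..n}"])
     (auto simp: ssyt_def intro!: finite_PiE finite_cells)

lemma ssyt_column_ge:
  assumes "T \<in> ssyt n lam" "antimono lam" "(i, j) \<in> cells lam"
  shows "Suc i \<le> T (i, j)"
  using assms(3)
proof (induction i)
  case 0
  then show ?case using assms(1) by (fastforce simp: ssyt_def PiE_def)
next
  case (Suc i)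
  have c: "(i, j) \<in> cells lam"
    using Suc.prems antimonoD[OF assms(2), of i "Suc i"] by (auto simp: cells_def)
  moreover have "T (i, j) < T (Suc i, j)"
    using assms(1) Suc.prems by (simp add: ssyt_def)
  ultimately show ?case using Suc.IH by simp
qed

text \<open>Columns increase strictly from at least 1, so the cell in row n would need an entry
  above n.\<close>

lemma schur_eq_0:
  assumes "antimono lam" "0 < lam n"
  shows "schur n lam x = 0"
proof -
  have "(n, 0) \<in> cells lam"
    using assms by (simp add: cells_def)
  then have "Suc n \<le> T (n, 0) \<and> T (n, 0) \<in> {1..n}" if "T \<in> ssyt n lam" for T
    using ssyt_column_ge[OF that assms(1)] that by (auto simp: ssyt_def PiE_def)
  then have "ssyt n lam = {}"
    by force
  then show ?thesis by (simp add: schur_def)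
qed

lemma cells_zero [simp]: "cells (\<lambda>_. 0) = {}"
  by (simp add: cells_def)

lemma schur_zero: "schur n (\<lambda>_. 0) x = 1"
proof -
  have "ssyt n (\<lambda>_. 0) = {\<lambda>_. undefined}"
    by (auto simp: ssyt_def)
  then show ?thesis by (simp add: schur_def)
qed

lemma conjugate_zero [simp]: "conjugate (\<lambda>_. 0) = (\<lambda>_. 0)"
  by (simp add: conjugate_def fun_eq_iff)

text \<open>Interlacing shapes: the removed cells form a horizontal strip, with at most one cell in
  each column.\<close>

definition hstrips :: "(nat \<Rightarrow> nat) \<Rightarrow> (nat \<Rightarrow> nat) set" where
  "hstrips lam = {nu. \<forall>i. lam (Suc i) \<le> nu i \<and> nu i \<le> lam i}"

lemma hstrips_partitions:
  assumes "lam \<in> partitions n" "nu \<in> hstrips lam"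
  shows "nu \<in> partitions n"
proof -
  have "nu (Suc i) \<le> nu i" for i
    using assms(2) by (auto simp: hstrips_def intro: order_trans)
  then have "antimono nu"
    by (simp add: antimono_iff_le_Suc)
  moreover have "nu i = 0" if "i \<ge> n" for i
    using assms that by (auto simp: hstrips_def partitions_def) (metis le_zero_eq)
  ultimately show ?thesis
    by (simp add: partitions_def)
qed

lemma finite_hstrips:
  assumes "lam \<in> partitions n"
  shows "finite (hstrips lam)"
proof (rule finite_subset)
  show "hstrips lam \<subseteq> {nu. \<forall>i. (i \<in> {..<n} \<longrightarrow> nu i \<in> {..lam 0}) \<and> (i \<notin> {..<n} \<longrightarrow> nu i = 0)}"
  proof (intro subsetI CollectI allI conjI impI)
    fix nu i assume nu: "nu \<in> hstrips lam"
    show "nu i \<in> {..lam 0}"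
      using nu assms antimonoD[of lam 0 i] by (auto simp: hstrips_def partitions_def intro: order_trans)
    show "i \<notin> {..<n} \<Longrightarrow> nu i = 0"
      using hstrips_partitions[OF assms nu] by (simp add: partitions_def)
  qed
  show "finite {nu. \<forall>i. (i \<in> {..<n} \<longrightarrow> nu i \<in> {..lam 0}) \<and> (i \<notin> {..<n} \<longrightarrow> nu i = (0::nat))}"
    by (rule finite_set_of_finite_funs) auto
qed

text \<open>For a tableau with entries up to \<open>Suc n\<close>, this is the shape left after
  deletion of the largest entry.\<close>

definition inner_shape :: "nat \<Rightarrow> (nat \<Rightarrow> nat) \<Rightarrow> (nat \<times> nat \<Rightarrow> nat) \<Rightarrow> nat \<Rightarrow> nat" where
  "inner_shape n lam T i = card {j. j < lam i \<and> T (i, j) \<le> n}"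

lemma less_inner_shape_iff:
  assumes "T \<in> ssyt m lam"
  shows "j < inner_shape n lam T i \<longleftrightarrow> j < lam i \<and> T (i, j) \<le> n"
proof -
  have "{j. j < lam i \<and> T (i, j) \<le> n} = {..<card {j. j < lam i \<and> T (i, j) \<le> n}}"
  proof (rule down_closed_eq_lessThan)
    show "a \<in> {j. j < lam i \<and> T (i, j) \<le> n}" if "a < b" "b \<in> {j. j < lam i \<and> T (i, j) \<le> n}" for a b
    proof -
      have "T (i, a) \<le> T (i, b)"
        using assms that by (auto simp: ssyt_def cells_def)
      then show ?thesis using that by auto
    qed
  qed auto
  then show ?thesis by (auto simp: inner_shape_def)
qed

lemma cells_inner_shape:
  "T \<in> ssyt m lam \<Longrightarrow> cells (inner_shape n lam T) = {u \<in> cells lam. T u \<le> n}"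
  by (auto simp: cells_def less_inner_shape_iff)

text \<open>Columns increase strictly, so only the lowest cell of a column can carry the largest
  entry \<open>Suc n\<close>.\<close>

lemma inner_shape_hstrips:
  assumes T: "T \<in> ssyt (Suc n) lam" and lam: "lam \<in> partitions m"
  shows "inner_shape n lam T \<in> hstrips lam"
proof -
  have "lam (Suc i) \<le> inner_shape n lam T i" for i
    unfolding nat_le_iff_less[of "lam (Suc i)"] less_inner_shape_iff[OF T]
  proof (intro allI impI conjI)
    fix j assume j: "j < lam (Suc i)"
    then show "j < lam i"
      using lam antimonoD[of lam i "Suc i"] by (auto simp: partitions_def)
    have "T (i, j) < T (Suc i, j)" and "T (Suc i, j) \<in> {1..Suc n}"
      using T j by (auto simp: ssyt_def cells_def PiE_def)
    then show "T (i, j) \<le> n" by simp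
  qed
  moreover have "inner_shape n lam T i \<le> lam i" for i
    unfolding nat_le_iff_less less_inner_shape_iff[OF T] by simp
  ultimately show ?thesis by (simp add: hstrips_def)
qed

lemma restrict_ssyt:
  assumes T: "T \<in> ssyt (Suc n) lam" and lam: "lam \<in> partitions m"
  shows "restrict T (cells (inner_shape n lam T)) \<in> ssyt n (inner_shape n lam T)"
proof -
  have part: "inner_shape n lam T \<in> partitions m"
    by (rule hstrips_partitions[OF lam inner_shape_hstrips[OF T lam]])
  have row: "(i, j) \<in> cells (inner_shape n lam T)" if "j < j'" "(i, j') \<in> cells (inner_shape n lam T)" for i j j'
    using that by (simp add: cells_def)
  have col: "(i, j) \<in> cells (inner_shape n lam T)" if "i < i'" "(i', j) \<in> cells (inner_shape n lam T)" for i i' j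
    using that part antimonoD[of "inner_shape n lam T" i i'] by (auto simp: cells_def partitions_def)
  have "restrict T (cells (inner_shape n lam T)) \<in> cells (inner_shape n lam T) \<rightarrow>\<^sub>E {1..n}"
  unfolding restrict_PiE_iff
  proof (rule ballI)
    fix u assume "u \<in> cells (inner_shape n lam T)"
    then have "u \<in> cells lam" "T u \<le> n"
      by (auto simp: cells_inner_shape[OF T])
    moreover have "T u \<in> {1..Suc n}"
      using T \<open>u \<in> cells lam\<close> by (auto simp: ssyt_def PiE_def)
    ultimately show "T u \<in> {1..n}" by simp
  qed
  moreover have "restrict T (cells (inner_shape n lam T)) (i, j) \<le> restrict T (cells (inner_shape n lam T)) (i, j')"
    if "j < j'" "(i, j') \<in> cells (inner_shape n lam T)" for i j j'
    using row[OF that] that T by (auto simp: cells_inner_shape[OF T] ssyt_def)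
  moreover have "restrict T (cells (inner_shape n lam T)) (i, j) < restrict T (cells (inner_shape n lam T)) (i', j)"
    if "i < i'" "(i', j) \<in> cells (inner_shape n lam T)" for i i' j
    using col[OF that] that T by (auto simp: cells_inner_shape[OF T] ssyt_def)
  ultimately show ?thesis by (simp add: ssyt_def)
qed

text \<open>The inverse of deleting the largest entry: the strip is filled with
  \<open>Suc n\<close>, and the restriction keeps the result extensional.\<close>

definition extend_ssyt :: "nat \<Rightarrow> (nat \<Rightarrow> nat) \<Rightarrow> (nat \<Rightarrow> nat) \<Rightarrow> (nat \<times> nat \<Rightarrow> nat) \<Rightarrow> nat \<times> nat \<Rightarrow> nat" where
  "extend_ssyt n lam nu T = (\<lambda>u\<in>cells lam. if u \<in> cells nu then T u else Suc n)"

lemma cells_hstrips: "nu \<in> hstrips lam \<Longrightarrow> cells nu \<subseteq> cells lam"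
  by (auto simp: hstrips_def cells_def intro: less_le_trans)

lemma extend_ssyt_in:
  assumes T: "T \<in> ssyt n nu" and nu: "nu \<in> hstrips lam" and lam: "lam \<in> partitions m"
  shows "extend_ssyt n lam nu T \<in> ssyt (Suc n) lam"
proof -
  have rng: "u \<in> cells nu \<Longrightarrow> T u \<in> {1..n}" for u
    using T by (auto simp: ssyt_def PiE_def)
  have "extend_ssyt n lam nu T \<in> cells lam \<rightarrow>\<^sub>E {1..Suc n}"
    using rng by (fastforce simp: extend_ssyt_def)
  moreover have "extend_ssyt n lam nu T (i, j) \<le> extend_ssyt n lam nu T (i, j')"
    if "j < j'" "(i, j') \<in> cells lam" for i j j'
  proof -
    have "(i, j) \<in> cells lam" using that by (simp add: cells_def)
    moreover have "(i, j) \<in> cells nu" "T (i, j) \<le> T (i, j')" if "(i, j') \<in> cells nu"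
      using that \<open>j < j'\<close> T by (auto simp: cells_def ssyt_def)
    ultimately show ?thesis
      using that rng[of "(i, j)"] by (auto simp: extend_ssyt_def)
  qed
  moreover have "extend_ssyt n lam nu T (i, j) < extend_ssyt n lam nu T (i', j)"
    if "i < i'" "(i', j) \<in> cells lam" for i i' j
  proof -
    have "j < lam (Suc i)"
      using that lam antimonoD[of lam "Suc i" i'] by (auto simp: cells_def partitions_def)
    moreover have "lam (Suc i) \<le> nu i" "nu i \<le> lam i"
      using nu by (auto simp: hstrips_def)
    ultimately have "(i, j) \<in> cells nu" "(i, j) \<in> cells lam"
      by (auto simp: cells_def)
    moreover have "T (i, j) < T (i', j)" if "(i', j) \<in> cells nu"
      using that \<open>i < i'\<close> T by (auto simp: ssyt_def)
    ultimately show ?thesis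
      using that rng[of "(i, j)"] by (auto simp: extend_ssyt_def)
  qed
  ultimately show ?thesis by (simp add: ssyt_def)
qed

lemma inner_shape_extend:
  assumes T: "T \<in> ssyt n nu" and nu: "nu \<in> hstrips lam" and lam: "lam \<in> partitions m"
  shows "inner_shape n lam (extend_ssyt n lam nu T) = nu"
proof -
  have "j < lam i \<and> extend_ssyt n lam nu T (i, j) \<le> n \<longleftrightarrow> j < nu i" for i j
    using T cells_hstrips[OF nu] by (force simp: extend_ssyt_def cells_def ssyt_def PiE_def Pi_def)
  then show ?thesis
    by (simp add: fun_eq_iff nat_eq_iff_less less_inner_shape_iff[OF extend_ssyt_in[OF assms]])
qed

text \<open>A tableau corresponds to the shape of its entries up to n together with the tableau on
  that shape; each cell of the remaining strip contributes a factor
  \<open>x (Suc n)\<close>.\<close>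

lemma schur_Suc:
  assumes lam: "lam \<in> partitions m"
  shows "schur (Suc n) lam x
    = (\<Sum>nu\<in>hstrips lam. x (Suc n) ^ card (cells lam - cells nu) * schur n nu x)"
proof -
  have w: "(\<Prod>u\<in>cells lam. x (extend_ssyt n lam nu T u))
      = x (Suc n) ^ card (cells lam - cells nu) * (\<Prod>u\<in>cells nu. x (T u))"
    if nu: "nu \<in> hstrips lam" for nu T
  proof -
    have "(\<Prod>u\<in>cells lam. x (extend_ssyt n lam nu T u))
      = (\<Prod>u\<in>cells lam - cells nu. x (extend_ssyt n lam nu T u)) * (\<Prod>u\<in>cells nu. x (extend_ssyt n lam nu T u))"
      by (rule prod.subset_diff[OF cells_hstrips[OF nu] finite_cells[OF lam]])
    also have "(\<Prod>u\<in>cells lam - cells nu. x (extend_ssyt n lam nu T u)) = x (Suc n) ^ card (cells lam - cells nu)"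
      by (simp add: extend_ssyt_def)
    also have "(\<Prod>u\<in>cells nu. x (extend_ssyt n lam nu T u)) = (\<Prod>u\<in>cells nu. x (T u))"
      using cells_hstrips[OF nu] by (intro prod.cong) (auto simp: extend_ssyt_def)
    finally show ?thesis .
  qed
  have "schur (Suc n) lam x = (\<Sum>(nu, T)\<in>Sigma (hstrips lam) (ssyt n). \<Prod>u\<in>cells lam. x (extend_ssyt n lam nu T u))"
    unfolding schur_def
  proof (rule sum.reindex_bij_witness[where i = "\<lambda>(nu, T). extend_ssyt n lam nu T"
      and j = "\<lambda>T. (inner_shape n lam T, restrict T (cells (inner_shape n lam T)))"])
    fix T assume T: "T \<in> ssyt (Suc n) lam"
    show e: "(case (inner_shape n lam T, restrict T (cells (inner_shape n lam T))) of (nu, T) \<Rightarrow> extend_ssyt n lam nu T) = T"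
    proof (rule ext)
      fix u
      have "u \<in> cells lam \<Longrightarrow> T u \<in> {1..Suc n}" "u \<notin> cells lam \<Longrightarrow> T u = undefined"
        using T by (auto simp: ssyt_def dest: PiE_mem PiE_arb)
      then show "(case (inner_shape n lam T, restrict T (cells (inner_shape n lam T))) of (nu, T) \<Rightarrow> extend_ssyt n lam nu T) u = T u"
        by (auto simp: extend_ssyt_def cells_inner_shape[OF T])
    qed
    show "(inner_shape n lam T, restrict T (cells (inner_shape n lam T))) \<in> Sigma (hstrips lam) (ssyt n)"
      using inner_shape_hstrips[OF T lam] restrict_ssyt[OF T lam] by simp
    show "(case (inner_shape n lam T, restrict T (cells (inner_shape n lam T))) of (nu, T) \<Rightarrow>
        \<Prod>u\<in>cells lam. x (extend_ssyt n lam nu T u)) = (\<Prod>u\<in>cells lam. x (T u))"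
      using e by simp
  next
    fix b assume "b \<in> Sigma (hstrips lam) (ssyt n)"
    then obtain nu T where b: "b = (nu, T)" "nu \<in> hstrips lam" "T \<in> ssyt n nu"
      by auto
    have "restrict (extend_ssyt n lam nu T) (cells nu) = T"
    proof (rule ext)
      fix u
      have "u \<notin> cells nu \<Longrightarrow> T u = undefined"
        using b(3) by (auto simp: ssyt_def dest: PiE_arb)
      then show "restrict (extend_ssyt n lam nu T) (cells nu) u = T u"
        using subsetD[OF cells_hstrips[OF b(2)], of u] by (cases "u \<in> cells nu") (auto simp: extend_ssyt_def)
    qed
    then show "(inner_shape n lam (case b of (nu, T) \<Rightarrow> extend_ssyt n lam nu T),
        restrict (case b of (nu, T) \<Rightarrow> extend_ssyt n lam nu T)
          (cells (inner_shape n lam (case b of (nu, T) \<Rightarrow> extend_ssyt n lam nu T)))) = b"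
      by (simp add: b inner_shape_extend[OF b(3,2) lam])
    show "(case b of (nu, T) \<Rightarrow> extend_ssyt n lam nu T) \<in> ssyt (Suc n) lam"
      using extend_ssyt_in[OF b(3,2) lam] b by simp
  qed
  also have "\<dots> = (\<Sum>nu\<in>hstrips lam. \<Sum>T\<in>ssyt n nu. \<Prod>u\<in>cells lam. x (extend_ssyt n lam nu T u))"
    using finite_hstrips[OF lam] finite_ssyt[OF hstrips_partitions[OF lam]] by (subst sum.Sigma) auto
  also have "\<dots> = (\<Sum>nu\<in>hstrips lam. x (Suc n) ^ card (cells lam - cells nu) * schur n nu x)"
    by (intro sum.cong refl) (simp add: w schur_def sum_distrib_left)
  finally show ?thesis .
qed

text \<open>Vertical strips. Unlike the interlacing condition of \<open>hstrips\<close>, the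
  row-wise bounds do not force \<open>nu\<close> to be decreasing, so this is demanded.\<close>

definition vstrips :: "(nat \<Rightarrow> nat) \<Rightarrow> (nat \<Rightarrow> nat) set" where
  "vstrips lam = {nu. antimono nu \<and> (\<forall>i. nu i \<le> lam i \<and> lam i \<le> Suc (nu i))}"

lemma vstrips_partitions: "lam \<in> partitions n \<Longrightarrow> nu \<in> vstrips lam \<Longrightarrow> nu \<in> partitions n"
  by (auto simp: vstrips_def partitions_def) (metis le_zero_eq)

text \<open>Transposition turns one cell per column into one cell per row; both conditions become
  pointwise statements about j < \<open>lam i\<close>.\<close>

lemma conjugate_hstrips_iff:
  assumes "lam \<in> partitions n" "nu \<in> partitions m"
  shows "conjugate nu \<in> hstrips (conjugate lam) \<longleftrightarrow> nu \<in> vstrips lam"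
proof -
  have "(\<forall>i. lam i \<le> Suc (nu i)) \<longleftrightarrow> (\<forall>i j. Suc j < lam i \<longrightarrow> j < nu i)"
    by (metis Suc_less_eq Suc_lessD lessI less_Suc_eq_0_disj nat_le_iff_less not_le not_less_eq)
  moreover have "(\<forall>i. nu i \<le> lam i) \<longleftrightarrow> (\<forall>i j. j < nu i \<longrightarrow> j < lam i)"
    by (simp add: nat_le_iff_less)
  moreover have "antimono nu"
    using assms by (simp add: partitions_def)
  ultimately show ?thesis
    unfolding hstrips_def vstrips_def mem_Collect_eq nat_le_iff_less[of "conjugate _ _"]
      less_conjugate_iff[OF assms(1)] less_conjugate_iff[OF assms(2)] by blast
qed

text \<open>The branching rule for the conjugate, transported back along the involution, so that the
  induction on k can keep \<open>lam\<close> itself as its index.\<close>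

lemma schur_conjugate_Suc:
  assumes lam: "lam \<in> partitions n"
  shows "schur (Suc k) (conjugate lam) y
    = (\<Sum>nu\<in>vstrips lam. y (Suc k) ^ card (cells lam - cells nu) * schur k (conjugate nu) y)"
proof -
  have lam': "conjugate lam \<in> partitions (lam 0)"
    by (rule conjugate_in_partitions[OF lam order_refl])
  have "schur (Suc k) (conjugate lam) y = (\<Sum>nu\<in>hstrips (conjugate lam).
      y (Suc k) ^ card (cells (conjugate lam) - cells nu) * schur k nu y)"
    by (rule schur_Suc[OF lam'])
  also have "\<dots> = (\<Sum>nu\<in>vstrips lam. y (Suc k) ^ card (cells lam - cells nu) * schur k (conjugate nu) y)"
  proof (rule sum.reindex_bij_witness[where i = conjugate and j = conjugate])
    fix nu assume nu: "nu \<in> hstrips (conjugate lam)"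
    then have p: "nu \<in> partitions (lam 0)"
      by (rule hstrips_partitions[OF lam'])
    show "conjugate (conjugate nu) = nu"
      by (rule conjugate_conjugate[OF p])
    have "conjugate nu \<in> partitions (nu 0)"
      by (rule conjugate_in_partitions[OF p order_refl])
    from conjugate_hstrips_iff[OF lam this] show "conjugate nu \<in> vstrips lam"
      using nu by (simp add: conjugate_conjugate[OF p])
    have "cells (conjugate lam) - cells nu = prod.swap ` (cells lam - cells (conjugate nu))"
      using cells_conjugate[OF lam] cells_conjugate[OF p]
      by (auto simp: image_set_diff cells_def less_conjugate_iff[OF p] less_conjugate_iff[OF lam] image_iff)
    then have "card (cells (conjugate lam) - cells nu) = card (cells lam - cells (conjugate nu))"
      by (simp add: card_image)
    then show "y (Suc k) ^ card (cells lam - cells (conjugate nu)) * schur k (conjugate (conjugate nu)) y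
        = y (Suc k) ^ card (cells (conjugate lam) - cells nu) * schur k nu y"
      by (simp add: conjugate_conjugate[OF p])
  next
    fix nu assume nu: "nu \<in> vstrips lam"
    have p: "nu \<in> partitions n"
      by (rule vstrips_partitions[OF lam nu])
    show "conjugate (conjugate nu) = nu"
      by (rule conjugate_conjugate[OF p])
    show "conjugate nu \<in> hstrips (conjugate lam)"
      using conjugate_hstrips_iff[OF lam p] nu by simp
  qed
  finally show ?thesis .
qed

text \<open>The beta-numbers of \<open>lam\<close> in increasing order: they turn partitions into
  strictly increasing sequences. The function is extensional in order to be one of the choice
  functions of \<open>ldet_column_sums\<close>.\<close>

definition beta_set :: "nat \<Rightarrow> (nat \<Rightarrow> nat) \<Rightarrow> nat \<Rightarrow> nat" where
  "beta_set n lam = (\<lambda>j\<in>{..<n}. lam (n - 1 - j) + j)"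

definition of_beta_set :: "nat \<Rightarrow> (nat \<Rightarrow> nat) \<Rightarrow> nat \<Rightarrow> nat" where
  "of_beta_set n h = (\<lambda>i. if i < n then h (n - 1 - i) - (n - 1 - i) else 0)"

lemma of_beta_set_beta_set: "lam \<in> partitions n \<Longrightarrow> of_beta_set n (beta_set n lam) = lam"
  by (auto simp: of_beta_set_def beta_set_def partitions_def fun_eq_iff)

lemma strict_inc_ge:
  fixes h :: "nat \<Rightarrow> nat"
  assumes "\<And>j. Suc j < n \<Longrightarrow> h j < h (Suc j)" "i \<le> j" "j < n"
  shows "h i + (j - i) \<le> h j"
  using assms(2,3)
proof (induction j rule: dec_induct)
  case (step m)
  then show ?case using assms(1)[of m] by simp
qed simp

lemma beta_set_of_beta_set:
  assumes "h \<in> extensional {..<n}" "\<And>j. Suc j < n \<Longrightarrow> h j < h (Suc j)"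
  shows "beta_set n (of_beta_set n h) = h"
proof
  fix j
  show "beta_set n (of_beta_set n h) j = h j"
    using strict_inc_ge[of n h 0 j, OF assms(2)] assms(1)
    by (auto simp: beta_set_def of_beta_set_def extensional_def)
qed

lemma of_beta_set_partitions:
  assumes "\<And>j. Suc j < n \<Longrightarrow> h j < h (Suc j)"
  shows "of_beta_set n h \<in> partitions n"
proof -
  have "of_beta_set n h (Suc i) \<le> of_beta_set n h i" for i
  proof (cases "Suc i < n")
    case True
    have "h (n - 1 - Suc i) < h (Suc (n - 1 - Suc i))"
      using True by (intro assms) simp
    moreover have "Suc (n - 1 - Suc i) = n - 1 - i"
      using True by simp
    ultimately show ?thesis
      using True by (simp add: of_beta_set_def)
  qed (simp add: of_beta_set_def)
  then show ?thesis
    by (auto simp: partitions_def antimono_iff_le_Suc of_beta_set_def)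
qed

lemma beta_set_strict:
  assumes "lam \<in> partitions n" "Suc j < n"
  shows "beta_set n lam j < beta_set n lam (Suc j)"
proof -
  have "lam (n - 1 - j) \<le> lam (n - 1 - Suc j)"
    using assms(1) by (intro antimonoD[of lam]) (auto simp: partitions_def)
  then show ?thesis using assms(2) by (simp add: beta_set_def)
qed

lemma beta_set_PiE_iff:
  "beta_set n lam \<in> PiE {..<n} B \<longleftrightarrow> (\<forall>j<n. lam (n - 1 - j) + j \<in> B j)"
  by (auto simp: beta_set_def)

text \<open>Translates sums over strictly increasing choice functions, which determinant expansions
  produce, into sums over partitions.\<close>

lemma sum_partitions_beta_set:
  assumes "\<And>h j. h \<in> H \<Longrightarrow> Suc j < n \<Longrightarrow> h j < h (Suc j)" "H \<subseteq> extensional {..<n}"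
  shows "(\<Sum>h\<in>H. F h) = (\<Sum>lam\<in>{lam \<in> partitions n. beta_set n lam \<in> H}. F (beta_set n lam))"
  by (rule sum.reindex_bij_witness[where i = "beta_set n" and j = "of_beta_set n"])
     (use assms of_beta_set_partitions beta_set_of_beta_set of_beta_set_beta_set in \<open>auto simp: subset_iff\<close>)

lemma all_less_reflect: "(\<forall>j<n. P (n - 1 - j)) \<longleftrightarrow> (\<forall>i<n::nat. P i)"
proof
  assume r: "\<forall>j<n. P (n - 1 - j)"
  show "\<forall>i<n. P i"
  proof (intro allI impI)
    fix i assume "i < n"
    with r[rule_format, of "n - 1 - i"] show "P i" by simp
  qed
qed simp

lemma prod_less_reflect:
  fixes P :: "nat \<Rightarrow> 'a::comm_monoid_mult"
  shows "(\<Prod>j<n. P (n - 1 - j)) = (\<Prod>i<n. P i)"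
  by (rule prod.reindex_bij_witness[where i = "\<lambda>i. n - 1 - i" and j = "\<lambda>i. n - 1 - i"]) auto

text \<open>A variant of the Jacobi-Trudi formula in which each row admits one more variable. Both
  sides satisfy the same branching recursion. The variables are listed in reverse because
  \<open>ldet_divdiff_Suc\<close> peels off the first node, whereas the branching rule removes the
  last variable.\<close>

lemma schur_eq_ldet:
  assumes "lam \<in> partitions n"
  shows "schur n lam x = ldet n (\<lambda>i j. divdiff (\<lambda>i. x (n - i)) i (lam (n - 1 - j) + j))"
  using assms
proof (induction n arbitrary: lam)
  case 0
  then have "lam = (\<lambda>_. 0)"
    by (auto simp: partitions_def)
  then show ?case by (simp add: schur_zero)
next
  case (Suc n)
  let ?X = "\<lambda>i. x (Suc n - i)"
  define l where "l = (\<lambda>j. lam (n - j) + j)"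
  let ?H = "PiE {..<n} (\<lambda>j. {l j..<l (Suc j)})"
  have anti: "antimono lam" and lam0: "\<And>i. i > n \<Longrightarrow> lam i = 0"
    using Suc.prems by (auto simp: partitions_def)
  have l: "l j \<le> l (Suc j)" if "j < n" for j
    using antimonoD[OF anti, of "n - Suc j" "n - j"] that by (simp add: l_def diff_le_mono2 le_SucI)
  have H: "beta_set n nu \<in> ?H \<longleftrightarrow> (\<forall>i<n. lam (Suc i) \<le> nu i \<and> nu i \<le> lam i)" for nu
  proof -
    have "nu (n - 1 - j) + j \<in> {l j..<l (Suc j)} \<longleftrightarrow>
        lam (Suc (n - 1 - j)) \<le> nu (n - 1 - j) \<and> nu (n - 1 - j) \<le> lam (n - 1 - j)" if "j < n" for j
      using that by (auto simp: l_def Suc_diff_Suc)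
    then have "beta_set n nu \<in> ?H \<longleftrightarrow>
        (\<forall>j<n. lam (Suc (n - 1 - j)) \<le> nu (n - 1 - j) \<and> nu (n - 1 - j) \<le> lam (n - 1 - j))"
      unfolding beta_set_PiE_iff by auto
    then show ?thesis
      by (simp only: all_less_reflect[of n "\<lambda>i. lam (Suc i) \<le> nu i \<and> nu i \<le> lam i"])
  qed
  have strips: "{nu \<in> partitions n. beta_set n nu \<in> ?H} = {nu \<in> hstrips lam. nu n = 0}"
  proof (rule Set.set_eqI, rule iffI)
    fix nu assume "nu \<in> {nu \<in> partitions n. beta_set n nu \<in> ?H}"
    then have *: "nu \<in> partitions n" "\<forall>i<n. lam (Suc i) \<le> nu i \<and> nu i \<le> lam i"
      unfolding mem_Collect_eq H by blast+
    then have "nu i = 0" "lam (Suc i) = 0" if "i \<ge> n" for i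
      using that lam0 by (auto simp: partitions_def)
    then have "lam (Suc i) \<le> nu i \<and> nu i \<le> lam i" for i
      using *(2) by (cases "i < n") auto
    then show "nu \<in> {nu \<in> hstrips lam. nu n = 0}"
      using *(1) by (simp add: hstrips_def partitions_def)
  next
    fix nu assume "nu \<in> {nu \<in> hstrips lam. nu n = 0}"
    then have *: "nu \<in> hstrips lam" "nu n = 0" by simp_all
    then have "nu \<in> partitions (Suc n)"
      using hstrips_partitions[OF Suc.prems] by simp
    then have "nu \<in> partitions n"
      using *(2) by (auto simp: partitions_def) (metis le_antisym not_less_eq_eq)
    moreover have "\<forall>i<n. lam (Suc i) \<le> nu i \<and> nu i \<le> lam i"
      using *(1) by (simp add: hstrips_def)
    ultimately show "nu \<in> {nu \<in> partitions n. beta_set n nu \<in> ?H}"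
      unfolding mem_Collect_eq H by blast
  qed
  have "ldet (Suc n) (\<lambda>i j. divdiff ?X i (lam (Suc n - 1 - j) + j)) = ldet (Suc n) (\<lambda>i j. divdiff ?X i (l j))"
    by (simp add: l_def)
  also have "\<dots> = ?X 0 ^ l 0 * (\<Sum>h\<in>?H. (\<Prod>j<n. ?X 0 ^ (l (Suc j) - 1 - h j)) *
      ldet n (\<lambda>i j. divdiff (\<lambda>i. ?X (Suc i)) i (h j)))"
    using l by (rule ldet_divdiff_Suc)
  also have "\<dots> = ?X 0 ^ l 0 * (\<Sum>h\<in>?H. (\<Prod>j<n. ?X 0 ^ (l (Suc j) - 1 - h j)) *
      ldet n (\<lambda>i j. divdiff (\<lambda>i. x (n - i)) i (h j)))"
    by simp
  also have "\<dots> = ?X 0 ^ l 0 * (\<Sum>nu\<in>{nu \<in> partitions n. beta_set n nu \<in> ?H}.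
      (\<Prod>j<n. ?X 0 ^ (l (Suc j) - 1 - beta_set n nu j)) *
      ldet n (\<lambda>i j. divdiff (\<lambda>i. x (n - i)) i (beta_set n nu j)))"
  proof (subst sum_partitions_beta_set)
    fix h j assume h: "h \<in> ?H" "Suc j < n"
    then have "h j \<in> {l j..<l (Suc j)}" "h (Suc j) \<in> {l (Suc j)..<l (Suc (Suc j))}"
      by (auto simp: PiE_def Pi_def)
    then show "h j < h (Suc j)" by auto
  qed (auto simp: PiE_def)
  also have "\<dots> = (\<Sum>nu\<in>{nu \<in> hstrips lam. nu n = 0}. x (Suc n) ^ card (cells lam - cells nu) * schur n nu x)"
    unfolding strips sum_distrib_left
  proof (intro sum.cong refl)
    fix nu assume nu: "nu \<in> {nu \<in> hstrips lam. nu n = 0}"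
    then have p: "nu \<in> partitions n"
      using strips by auto
    have "l (Suc j) - 1 - beta_set n nu j = lam (n - 1 - j) - nu (n - 1 - j)" if "j < n" for j
      using that by (simp add: l_def beta_set_def)
    then have "(\<Prod>j<n. ?X 0 ^ (l (Suc j) - 1 - beta_set n nu j)) = (\<Prod>j<n. x (Suc n) ^ (lam (n - 1 - j) - nu (n - 1 - j)))"
      by simp
    also have "\<dots> = x (Suc n) ^ (\<Sum>i<n. lam i - nu i)"
      by (simp only: prod_less_reflect[of "\<lambda>i. x (Suc n) ^ (lam i - nu i)"] power_sum)
    finally have 1: "?X 0 ^ l 0 * (\<Prod>j<n. ?X 0 ^ (l (Suc j) - 1 - beta_set n nu j))
        = x (Suc n) ^ card (cells lam - cells nu)"
      using nu by (simp add: card_cells_diff[OF Suc.prems] power_add l_def mult.commute)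
    have 2: "ldet n (\<lambda>i j. divdiff (\<lambda>i. x (n - i)) i (beta_set n nu j)) = schur n nu x"
      unfolding Suc.IH[OF p] by (rule ldet_cong) (simp add: beta_set_def)
    show "?X 0 ^ l 0 * ((\<Prod>j<n. ?X 0 ^ (l (Suc j) - 1 - beta_set n nu j)) *
        ldet n (\<lambda>i j. divdiff (\<lambda>i. x (n - i)) i (beta_set n nu j)))
        = x (Suc n) ^ card (cells lam - cells nu) * schur n nu x"
      by (simp only: 1[symmetric] 2 mult.assoc)
  qed
  \<comment> \<open>Interlacing shapes with a nonempty row n do not occur in the determinant, but
    their Schur polynomials in n variables vanish.\<close>
  also have "\<dots> = (\<Sum>nu\<in>hstrips lam. x (Suc n) ^ card (cells lam - cells nu) * schur n nu x)"
  proof (rule sum.mono_neutral_left)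
    show "\<forall>nu\<in>hstrips lam - {nu \<in> hstrips lam. nu n = 0}. x (Suc n) ^ card (cells lam - cells nu) * schur n nu x = 0"
      using hstrips_partitions[OF Suc.prems] schur_eq_0[of _ n x] by (auto simp: partitions_def)
  qed (auto intro: finite_hstrips[OF Suc.prems])
  also have "\<dots> = schur (Suc n) lam x"
    by (rule schur_Suc[OF Suc.prems, symmetric])
  finally show ?case by (rule sym)
qed

subsection \<open>Sums over diagrams with a bounded first row\<close>

lemma diagrams_in_box_eq: "diagrams_in_box n k = {lam \<in> partitions n. \<forall>i. lam i \<le> k}"
  by (auto simp: diagrams_in_box_def partitions_def)

lemma finite_diagrams_in_box: "finite (diagrams_in_box n k)"
proof (rule finite_subset)
  show "diagrams_in_box n k \<subseteq> {lam. \<forall>i. (i \<in> {..<n} \<longrightarrow> lam i \<in> {..k}) \<and> (i \<notin> {..<n} \<longrightarrow> lam i = 0)}"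
    by (auto simp: diagrams_in_box_def)
  show "finite {lam. \<forall>i. (i \<in> {..<n} \<longrightarrow> lam i \<in> {..k}) \<and> (i \<notin> {..<n} \<longrightarrow> lam i = (0::nat))}"
    by (rule finite_set_of_finite_funs) auto
qed

text \<open>If \<open>u p\<close> is the value of a linear functional at \<open>z\<^sup>p\<close>, then \<open>shift_factors y k u j\<close> is its
  value at \<open>z\<^sup>j (1 + y\<^sub>1 z) \<dots> (1 + y\<^sub>k z)\<close>.\<close>

fun shift_factors :: "(nat \<Rightarrow> 'a::comm_ring_1) \<Rightarrow> nat \<Rightarrow> (nat \<Rightarrow> 'a) \<Rightarrow> nat \<Rightarrow> 'a" where
  "shift_factors y 0 u = u"
| "shift_factors y (Suc k) u = shift_factors y k (\<lambda>p. u p + y (Suc k) * u (Suc p))"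

text \<open>Each column chooses between the exponents \<open>p j\<close> and
  \<open>Suc (p j)\<close>. As \<open>p\<close> is strictly increasing, a choice that is not
  strictly increasing repeats an exponent in adjacent columns and its determinant vanishes; the
  others are exactly the shapes that exceed \<open>nu\<close> by a vertical strip.\<close>

lemma ldet_vertical_strips:
  fixes u :: "nat \<Rightarrow> nat \<Rightarrow> 'a::comm_ring_1"
  assumes nu: "nu \<in> partitions n"
  shows "(\<Sum>lam\<in>{lam \<in> partitions n. nu \<in> vstrips lam}.
      t ^ card (cells lam - cells nu) * ldet n (\<lambda>i j. u i (lam (n - 1 - j) + j)))
    = ldet n (\<lambda>i j. u i (nu (n - 1 - j) + j) + t * u i (Suc (nu (n - 1 - j) + j)))"
proof -
  define p where "p = (\<lambda>j. nu (n - 1 - j) + j)"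
  define H where "H = PiE {..<n} (\<lambda>j. {p j, Suc (p j)})"
  define H' where "H' = {h \<in> H. \<forall>j. Suc j < n \<longrightarrow> h j < h (Suc j)}"
  have p: "p j < p (Suc j)" if "Suc j < n" for j
    using beta_set_strict[OF nu that] that by (simp add: p_def beta_set_def)
  have finH: "finite H" unfolding H_def by (intro finite_PiE) auto
  have mem: "{lam \<in> partitions n. beta_set n lam \<in> H'} = {lam \<in> partitions n. nu \<in> vstrips lam}"
  proof (intro Collect_cong conj_cong refl)
    fix lam assume lam: "lam \<in> partitions n"
    have "beta_set n lam \<in> H' \<longleftrightarrow> beta_set n lam \<in> H"
      using beta_set_strict[OF lam] by (auto simp: H'_def)
    also have "\<dots> \<longleftrightarrow> (\<forall>j<n. nu (n - 1 - j) \<le> lam (n - 1 - j) \<and> lam (n - 1 - j) \<le> Suc (nu (n - 1 - j)))"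
      unfolding H_def beta_set_PiE_iff p_def by (intro all_cong) auto
    also have "\<dots> \<longleftrightarrow> (\<forall>i<n. nu i \<le> lam i \<and> lam i \<le> Suc (nu i))"
      by (rule all_less_reflect)
    also have "\<dots> \<longleftrightarrow> nu \<in> vstrips lam"
      using lam nu unfolding vstrips_def partitions_def by (auto) (metis le0 le_refl not_less)+
    finally show "beta_set n lam \<in> H' \<longleftrightarrow> nu \<in> vstrips lam" .
  qed
  have "ldet n (\<lambda>i j. u i (nu (n - 1 - j) + j) + t * u i (Suc (nu (n - 1 - j) + j)))
     = ldet n (\<lambda>i j. \<Sum>q\<in>{p j, Suc (p j)}. t ^ (q - p j) * u i q)"
    by (simp add: p_def)
  also have "\<dots> = (\<Sum>h\<in>H. (\<Prod>j<n. t ^ (h j - p j)) * ldet n (\<lambda>i j. u i (h j)))"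
    unfolding H_def by (rule ldet_column_sums) simp
  also have "\<dots> = (\<Sum>h\<in>H'. (\<Prod>j<n. t ^ (h j - p j)) * ldet n (\<lambda>i j. u i (h j)))"
  proof (rule sum.mono_neutral_right[OF finH])
    show "\<forall>h\<in>H - H'. (\<Prod>j<n. t ^ (h j - p j)) * ldet n (\<lambda>i j. u i (h j)) = 0"
    proof
      fix h assume h: "h \<in> H - H'"
      then obtain j where j: "Suc j < n" "\<not> h j < h (Suc j)"
        by (auto simp: H'_def)
      moreover have "h j \<in> {p j, Suc (p j)}" "h (Suc j) \<in> {p (Suc j), Suc (p (Suc j))}"
        using h j(1) PiE_mem[of h "{..<n}" "\<lambda>j. {p j, Suc (p j)}"] by (simp_all add: H_def)
      ultimately have "h j = h (Suc j)"
        using p[OF j(1)] by auto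
      then have "ldet n (\<lambda>i j. u i (h j)) = 0"
        using j(1) by (intro ldet_equal_columns[of j n "Suc j"]) auto
      then show "(\<Prod>j<n. t ^ (h j - p j)) * ldet n (\<lambda>i j. u i (h j)) = 0" by simp
    qed
  qed (auto simp: H'_def)
  also have "\<dots> = (\<Sum>lam\<in>{lam \<in> partitions n. beta_set n lam \<in> H'}.
      (\<Prod>j<n. t ^ (beta_set n lam j - p j)) * ldet n (\<lambda>i j. u i (beta_set n lam j)))"
    by (rule sum_partitions_beta_set) (auto simp: H'_def H_def PiE_def)
  also have "\<dots> = (\<Sum>lam\<in>{lam \<in> partitions n. nu \<in> vstrips lam}.
      t ^ card (cells lam - cells nu) * ldet n (\<lambda>i j. u i (lam (n - 1 - j) + j)))"
    unfolding mem
  proof (intro sum.cong refl arg_cong2[of _ _ _ _ "(*)"] ldet_cong)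
    fix lam assume "lam \<in> {lam \<in> partitions n. nu \<in> vstrips lam}"
    then have lam: "lam \<in> partitions n" by simp
    have "(\<Prod>j<n. t ^ (beta_set n lam j - p j)) = (\<Prod>j<n. t ^ (lam (n - 1 - j) - nu (n - 1 - j)))"
      by (simp add: p_def beta_set_def)
    also have "\<dots> = t ^ (\<Sum>i<n. lam i - nu i)"
      by (simp only: prod_less_reflect[of "\<lambda>i. t ^ (lam i - nu i)"] power_sum)
    finally show "(\<Prod>j<n. t ^ (beta_set n lam j - p j)) = t ^ card (cells lam - cells nu)"
      by (simp add: card_cells_diff[OF lam])
  qed (simp add: beta_set_def)
  finally show ?thesis by simp
qed

text \<open>Induction on k: the branching rule removes the last variable, the two sums are
  exchanged, and \<open>ldet_vertical_strips\<close> absorbs the inner one into the functionals.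
  This is why \<open>u\<close> is arbitrary.\<close>

lemma sum_schur_conjugate_ldet:
  fixes u :: "nat \<Rightarrow> nat \<Rightarrow> real"
  shows "(\<Sum>lam\<in>diagrams_in_box n k. schur k (conjugate lam) y *
      ldet n (\<lambda>i j. u i (lam (n - 1 - j) + j)))
    = ldet n (\<lambda>i j. shift_factors y k (u i) j)"
proof (induction k arbitrary: u)
  case 0
  have "diagrams_in_box n 0 = {\<lambda>_. 0}"
    by (auto simp: diagrams_in_box_def antimono_def)
  then show ?case by (simp add: schur_zero)
next
  case (Suc k)
  let ?D = "\<lambda>lam. ldet n (\<lambda>i j. u i (lam (n - 1 - j) + j))"
  have "(\<Sum>lam\<in>diagrams_in_box n (Suc k). schur (Suc k) (conjugate lam) y * ?D lam)
    = (\<Sum>lam\<in>diagrams_in_box n (Suc k). \<Sum>nu\<in>diagrams_in_box n k. if nu \<in> vstrips lam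
        then y (Suc k) ^ card (cells lam - cells nu) * schur k (conjugate nu) y * ?D lam else 0)"
  proof (intro sum.cong refl)
    fix lam assume lam: "lam \<in> diagrams_in_box n (Suc k)"
    then have p: "lam \<in> partitions n" by (simp add: diagrams_in_box_eq)
    have fin: "finite (vstrips lam)"
    proof (rule finite_subset)
      show "vstrips lam \<subseteq> diagrams_in_box n (Suc k)"
        using lam vstrips_partitions[OF p] by (auto simp: diagrams_in_box_eq vstrips_def intro: order_trans)
    qed (rule finite_diagrams_in_box)
    have "schur (Suc k) (conjugate lam) y * ?D lam
       = (\<Sum>nu\<in>vstrips lam. y (Suc k) ^ card (cells lam - cells nu) * schur k (conjugate nu) y * ?D lam)"
      by (simp add: schur_conjugate_Suc[OF p] sum_distrib_right)
    also have "\<dots> = (\<Sum>nu\<in>diagrams_in_box n k \<inter> vstrips lam.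
        y (Suc k) ^ card (cells lam - cells nu) * schur k (conjugate nu) y * ?D lam)"
    \<comment> \<open>A shape whose first row is longer than k has a conjugate with more than k
      rows, so its term is zero.\<close>
    proof (rule sum.mono_neutral_right[OF fin])
      show "\<forall>nu\<in>vstrips lam - diagrams_in_box n k \<inter> vstrips lam.
          y (Suc k) ^ card (cells lam - cells nu) * schur k (conjugate nu) y * ?D lam = 0"
      proof
        fix nu assume nu: "nu \<in> vstrips lam - diagrams_in_box n k \<inter> vstrips lam"
        then have q: "nu \<in> partitions n"
          using vstrips_partitions[OF p] by auto
        then obtain i where "k < nu i"
          using nu by (auto simp: diagrams_in_box_eq not_le)
        then have "k < nu 0"
          using q antimonoD[of nu 0 i] by (auto simp: partitions_def)
        then have "0 < conjugate nu k"
          by (simp add: less_conjugate_iff[OF q])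
        moreover have "antimono (conjugate nu)"
          using conjugate_in_partitions[OF q order_refl] by (simp add: partitions_def)
        ultimately show "y (Suc k) ^ card (cells lam - cells nu) * schur k (conjugate nu) y * ?D lam = 0"
          by (simp add: schur_eq_0)
      qed
    qed auto
    also have "\<dots> = (\<Sum>nu\<in>diagrams_in_box n k. if nu \<in> vstrips lam
        then y (Suc k) ^ card (cells lam - cells nu) * schur k (conjugate nu) y * ?D lam else 0)"
      by (rule sum.inter_restrict[OF finite_diagrams_in_box])
    finally show "schur (Suc k) (conjugate lam) y * ?D lam = \<dots>" .
  qed
  also have "\<dots> = (\<Sum>nu\<in>diagrams_in_box n k. schur k (conjugate nu) y *
      (\<Sum>lam\<in>diagrams_in_box n (Suc k). if nu \<in> vstrips lam
        then y (Suc k) ^ card (cells lam - cells nu) * ?D lam else 0))"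
    by (subst sum.swap) (auto intro!: sum.cong simp: sum_distrib_left mult_ac)
  also have "\<dots> = (\<Sum>nu\<in>diagrams_in_box n k. schur k (conjugate nu) y *
      ldet n (\<lambda>i j. u i (nu (n - 1 - j) + j) + y (Suc k) * u i (Suc (nu (n - 1 - j) + j))))"
  proof (intro sum.cong refl arg_cong2[of _ _ _ _ "(*)"])
    fix nu assume nu: "nu \<in> diagrams_in_box n k"
    then have q: "nu \<in> partitions n" by (simp add: diagrams_in_box_eq)
    \<comment> \<open>The box imposes no restriction here: a vertical strip adds at most one cell to
      each row of a diagram of width k.\<close>
    have "diagrams_in_box n (Suc k) \<inter> {lam. nu \<in> vstrips lam} = {lam \<in> partitions n. nu \<in> vstrips lam}"
    proof -
      have "lam i \<le> Suc k" if "nu \<in> vstrips lam" for lam i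
      proof -
        have "lam i \<le> Suc (nu i)" using that by (simp add: vstrips_def)
        also have "\<dots> \<le> Suc k" using nu by (simp add: diagrams_in_box_eq)
        finally show ?thesis .
      qed
      then show ?thesis by (auto simp: diagrams_in_box_eq)
    qed
    then show "(\<Sum>lam\<in>diagrams_in_box n (Suc k). if nu \<in> vstrips lam
        then y (Suc k) ^ card (cells lam - cells nu) * ?D lam else 0)
      = ldet n (\<lambda>i j. u i (nu (n - 1 - j) + j) + y (Suc k) * u i (Suc (nu (n - 1 - j) + j)))"
      using ldet_vertical_strips[OF q, of "y (Suc k)" u]
        sum.inter_restrict[OF finite_diagrams_in_box[of n "Suc k"], of
          "\<lambda>lam. y (Suc k) ^ card (cells lam - cells nu) * ?D lam" "{lam. nu \<in> vstrips lam}"]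
      by simp
  qed
  also have "\<dots> = ldet n (\<lambda>i j. shift_factors y (Suc k) (u i) j)"
    using Suc.IH[of "\<lambda>i p. u i p + y (Suc k) * u i (Suc p)"] by simp
  finally show ?case .
qed

text \<open>The largest beta-number of \<open>lam\<close> is \<open>lam 0\<close> + n - 1. Cutting
  the functionals off at degree n + m therefore annihilates the last column exactly when
  \<open>lam 0\<close> exceeds m, and changes no other determinant.\<close>

lemma sum_schur_schur:
  assumes "0 < n"
  shows "(\<Sum>lam\<in>{lam \<in> diagrams_in_box n k. lam 0 \<le> m}. schur n lam x * schur k (conjugate lam) y)
    = ldet n (\<lambda>i j. shift_factors y k (\<lambda>p. if p < n + m then divdiff (\<lambda>i. x (n - i)) i p else 0) j)"
proof -
  let ?u = "\<lambda>i p. if p < n + m then divdiff (\<lambda>i. x (n - i)) i p else 0"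
  have "ldet n (\<lambda>i j. ?u i (lam (n - 1 - j) + j)) = (if lam 0 \<le> m then schur n lam x else 0)"
    if "lam \<in> diagrams_in_box n k" for lam
  proof -
    have p: "lam \<in> partitions n" using that by (simp add: diagrams_in_box_eq)
    show ?thesis
    proof (cases "lam 0 \<le> m")
      case True
      have "lam (n - 1 - j) + j < n + m" if "j < n" for j
        using that True p antimonoD[of lam 0 "n - 1 - j"] by (auto simp: partitions_def)
      then have "ldet n (\<lambda>i j. ?u i (lam (n - 1 - j) + j)) = schur n lam x"
        unfolding schur_eq_ldet[OF p] by (intro ldet_cong) simp
      then show ?thesis using True by simp
    next
      case False
      then have "ldet n (\<lambda>i j. ?u i (lam (n - 1 - j) + j)) = 0"
        using assms by (intro ldet_zero_column[of "n - 1"]) auto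
      then show ?thesis using False by simp
    qed
  qed
  then have "ldet n (\<lambda>i j. shift_factors y k (?u i) j)
      = (\<Sum>lam\<in>diagrams_in_box n k. if lam 0 \<le> m then schur n lam x * schur k (conjugate lam) y else 0)"
    by (subst sum_schur_conjugate_ldet[symmetric]) (auto intro!: sum.cong)
  then show ?thesis
    by (simp add: sum.inter_filter[OF finite_diagrams_in_box])
qed

subsection \<open>Newton interpolation and the finite determinant\<close>

text \<open>Centre and radius 1/2: inversion takes this circle, with 0 removed, to the line of
  complex numbers with real part 1.\<close>

definition circ_int :: "(complex \<Rightarrow> complex) \<Rightarrow> complex" where
  "circ_int f = contour_integral (circlepath (1/2) (1/2)) f / (2 * of_real pi * \<i>)"

abbreviation "half_circle \<equiv> sphere (1/2 :: complex) (1/2)"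
abbreviation "half_disc \<equiv> cball (1/2 :: complex) (1/2)"

lemma integrable_half_circle:
  "continuous_on half_circle f \<Longrightarrow> f contour_integrable_on circlepath (1/2) (1/2)"
  by (rule contour_integrable_continuous_circlepath) simp

lemma circ_int_cong: "(\<And>w. w \<in> half_circle \<Longrightarrow> f w = g w) \<Longrightarrow> circ_int f = circ_int g"
  unfolding circ_int_def by (intro arg_cong2[of _ _ _ _ "(/)"] contour_integral_eq refl) simp

lemma circ_int_add:
  "continuous_on half_circle f \<Longrightarrow> continuous_on half_circle g \<Longrightarrow>
    circ_int (\<lambda>w. f w + g w) = circ_int f + circ_int g"
  by (simp add: circ_int_def contour_integral_add integrable_half_circle add_divide_distrib)

lemma circ_int_mult: "continuous_on half_circle f \<Longrightarrow> circ_int (\<lambda>w. c * f w) = c * circ_int f"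
  by (simp add: circ_int_def contour_integral_lmul integrable_half_circle)

lemma circ_int_linear:
  assumes "continuous_on half_circle f" "continuous_on half_circle g"
  shows "circ_int (\<lambda>w. a * f w + b * g w) = a * circ_int f + b * circ_int g"
  using assms by (subst circ_int_add) (auto intro: continuous_on_mult_left simp: circ_int_mult)

lemma circ_int_sum:
  "(\<And>a. a \<in> A \<Longrightarrow> continuous_on half_circle (f a)) \<Longrightarrow> finite A \<Longrightarrow>
    circ_int (\<lambda>w. \<Sum>a\<in>A. f a w) = (\<Sum>a\<in>A. circ_int (f a))"
  by (simp add: circ_int_def contour_integral_sum integrable_half_circle sum_divide_distrib)

lemma circ_int_lincomb:
  assumes "\<And>a. a \<in> A \<Longrightarrow> continuous_on half_circle (f a)" "finite A"
  shows "circ_int (\<lambda>w. \<Sum>a\<in>A. c a * f a w) = (\<Sum>a\<in>A. c a * circ_int (f a))"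
proof -
  have "circ_int (\<lambda>w. \<Sum>a\<in>A. c a * f a w) = (\<Sum>a\<in>A. circ_int (\<lambda>w. c a * f a w))"
    using assms by (intro circ_int_sum continuous_on_mult_left) auto
  then show ?thesis
    using assms by (simp only: circ_int_mult cong: sum.cong)
qed

lemma holomorphic_half_disc_continuous:
  "f holomorphic_on half_disc \<Longrightarrow> continuous_on half_circle f"
  by (rule continuous_on_subset[OF holomorphic_on_imp_continuous_on]) (auto simp: sphere_cball)

lemma circ_int_holomorphic: "f holomorphic_on half_disc \<Longrightarrow> circ_int f = 0"
  unfolding circ_int_def
  by (subst contour_integral_unique[OF Cauchy_theorem_convex_simple[of _ half_disc]])
     (auto simp: sphere_cball)

lemma circ_int_Cauchy:
  assumes "f holomorphic_on half_disc" "x \<in> ball (1/2) (1/2)"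
  shows "circ_int (\<lambda>w. f w / (w - x)) = f x"
proof -
  have "((\<lambda>u. f u / (u - x)) has_contour_integral (2 * of_real pi * \<i>) * f x) (circlepath (1/2) (1/2))"
    using assms
    by (intro Cauchy_integral_circlepath holomorphic_on_imp_continuous_on)
       (auto intro: holomorphic_on_subset simp: dist_norm norm_minus_commute)
  then show ?thesis
    unfolding circ_int_def by (simp add: contour_integral_unique)
qed

lemma half_circle_neq: "x \<in> ball (1/2) (1/2) \<Longrightarrow> w \<in> half_circle \<Longrightarrow> w - x \<noteq> 0"
  by auto

lemma partial_fraction:
  fixes p q r :: complex
  assumes "p \<noteq> 0" "q \<noteq> 0" "r \<noteq> 0"
  shows "(q - p) * (1 / (p * (q * r))) = 1 / (p * r) + (-1) * (1 / (q * r))"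
  using assms by (simp add: field_simps)

lemma weighted_fraction:
  fixes r w x :: complex
  assumes "r \<noteq> 0" "w - x \<noteq> 0"
  shows "(b + c * w) * f / (r * (w - x)) = (b + c * x) * (f / (r * (w - x))) + c * (f / r)"
proof -
  have "c * (f / r) = c * f * (w - x) / (r * (w - x))"
    using assms by simp
  then show ?thesis
    by (simp add: add_divide_distrib[symmetric] algebra_simps)
qed

text \<open>With at least two factors the integrand has no residue at infinity. The proof is by
  induction on the number of factors: partial fractions if two roots differ, Cauchy's formula for a
  derivative of the constant 1 if all coincide.\<close>

lemma circ_int_inverse_prod:
  assumes "finite A" "X ` A \<subseteq> ball (1/2) (1/2)" "2 \<le> card A"
  shows "circ_int (\<lambda>w. 1 / (\<Prod>a\<in>A. w - X a)) = 0"
  using assms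
proof (induction "card A" arbitrary: A rule: less_induct)
  case less
  have nz: "w - X a \<noteq> 0" if "a \<in> A" "w \<in> half_circle" for a w
    using less.prems(2) that half_circle_neq by blast
  show ?case
  proof (cases "\<exists>a\<in>A. \<exists>b\<in>A. X a \<noteq> X b")
    case True
    then obtain a b where ab: "a \<in> A" "b \<in> A" "X a \<noteq> X b" by auto
    have ne: "a \<noteq> b" using ab by auto
    have cont: "continuous_on half_circle (\<lambda>w. 1 / (\<Prod>a\<in>B. w - X a))" if B: "B \<subseteq> A" for B
    proof -
      have "(\<Prod>a\<in>B. w - X a) \<noteq> 0" if "w \<in> half_circle" for w
        using nz[OF subsetD[OF B] that] finite_subset[OF B less.prems(1)] by (simp add: prod_zero_iff)
      then show ?thesis by (intro continuous_intros ballI)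
    qed
    have split: "(X a - X b) * (1 / (\<Prod>a\<in>A. w - X a))
        = 1 / (\<Prod>a\<in>A - {b}. w - X a) + (-1) * (1 / (\<Prod>a\<in>A - {a}. w - X a))"
      if w: "w \<in> half_circle" for w
    proof -
      have 1: "(\<Prod>a\<in>A. w - X a) = (w - X a) * ((w - X b) * (\<Prod>a\<in>A - {a} - {b}. w - X a))"
        using less.prems(1) ab ne by (simp add: prod.remove[of _ a] prod.remove[of _ b])
      have 2: "(\<Prod>a\<in>A - {b}. w - X a) = (w - X a) * (\<Prod>a\<in>A - {a} - {b}. w - X a)"
        using less.prems(1) ab ne by (subst prod.remove[of _ a]) (auto intro!: prod.cong)
      have 3: "(\<Prod>a\<in>A - {a}. w - X a) = (w - X b) * (\<Prod>a\<in>A - {a} - {b}. w - X a)"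
        using less.prems(1) ab ne by (subst prod.remove[of _ b]) auto
      have "(\<Prod>a\<in>A - {a} - {b}. w - X a) \<noteq> 0"
        using nz[OF _ w] less.prems(1) by (auto simp: prod_zero_iff)
      then show ?thesis
        unfolding 1 2 3 using nz[OF ab(1) w] nz[OF ab(2) w]
          partial_fraction[of "w - X a" "w - X b" "\<Prod>a\<in>A - {a} - {b}. w - X a"] by simp
    qed
    \<comment> \<open>With two factors in all, both integrals are 1; with more, both are 0 by
      induction. In either case the partial fractions cancel.\<close>
    have eq: "circ_int (\<lambda>w. 1 / (\<Prod>a\<in>A - {b}. w - X a)) = circ_int (\<lambda>w. 1 / (\<Prod>a\<in>A - {a}. w - X a))"
    proof (cases "card A = 2")
      case True
      have "A = {a, b}"
        using True ab ne less.prems(1) card_seteq[of A "{a, b}"] by auto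
      then have "A - {b} = {a}" "A - {a} = {b}"
        using ne by auto
      moreover have "circ_int (\<lambda>w. 1 / (\<Prod>a\<in>{c}. w - X a)) = 1" if "c \<in> A" for c
      proof -
        have "X c \<in> ball (1/2) (1/2)"
          using that less.prems(2) by blast
        then show ?thesis
          using circ_int_Cauchy[of "\<lambda>_. 1" "X c"] by (simp del: mem_ball)
      qed
      ultimately show ?thesis
        using ab by (simp only:)
    next
      case False
      have "circ_int (\<lambda>w. 1 / (\<Prod>a\<in>A - {c}. w - X a)) = 0" if "c \<in> A" for c
        using that less.prems False by (intro less.hyps) (auto simp: card_Diff_singleton)
      then show ?thesis using ab by simp
    qed
    have "(X a - X b) * circ_int (\<lambda>w. 1 / (\<Prod>a\<in>A. w - X a))
       = circ_int (\<lambda>w. (X a - X b) * (1 / (\<Prod>a\<in>A. w - X a)))"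
      by (rule circ_int_mult[symmetric]) (rule cont, simp)
    also have "\<dots> = circ_int (\<lambda>w. 1 / (\<Prod>a\<in>A - {b}. w - X a) + (-1) * (1 / (\<Prod>a\<in>A - {a}. w - X a)))"
      by (rule circ_int_cong) (rule split)
    also have "\<dots> = circ_int (\<lambda>w. 1 / (\<Prod>a\<in>A - {b}. w - X a))
        + (-1) * circ_int (\<lambda>w. 1 / (\<Prod>a\<in>A - {a}. w - X a))"
      using cont[of "A - {a}"] cont[of "A - {b}"] circ_int_linear[of _ _ 1 "-1"] by simp
    finally show ?thesis
      using eq ab(3) by simp
  next
    case False
    have "A \<noteq> {}"
      using less.prems(3) by (intro notI) simp
    then obtain a where a: "a \<in> A" by blast
    have "circ_int (\<lambda>w. 1 / (\<Prod>a\<in>A. w - X a)) = circ_int (\<lambda>w. 1 / (w - X a) ^ Suc (card A - 1))"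
    proof (rule circ_int_cong)
      fix w
      have "X b = X a" if "b \<in> A" for b
        using False a that by blast
      then have "(\<Prod>a\<in>A. w - X a) = (\<Prod>b\<in>A. w - X a)"
        by (intro prod.cong refl) (simp only:)
      moreover have "Suc (card A - 1) = card A"
        using less.prems(3) by linarith
      ultimately show "1 / (\<Prod>a\<in>A. w - X a) = 1 / (w - X a) ^ Suc (card A - 1)"
        by (simp only: prod_constant)
    qed
    also have "\<dots> = 0"
    proof -
      have "contour_integral (circlepath (1/2) (1/2)) (\<lambda>w. 1 / (w - X a) ^ Suc (card A - 1))
        = 2 * pi * \<i> * (deriv ^^ (card A - 1)) (\<lambda>_. 1) (X a) / fact (card A - 1)"
        using a less.prems(2) by (intro Cauchy_contour_integral_circlepath) auto
      moreover have "(deriv ^^ (card A - 1)) (\<lambda>_. 1) (X a) = (0::complex)"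
        using less.prems(3) by (simp add: higher_deriv_const)
      ultimately show ?thesis by (simp add: circ_int_def)
    qed
    finally show ?thesis .
  qed
qed

text \<open>The contour integral formula for the divided difference of f at \<open>X 0\<close>, ...,
  \<open>X i\<close>; repeated nodes are covered as well.\<close>

definition newton_coeff :: "(nat \<Rightarrow> complex) \<Rightarrow> nat \<Rightarrow> (complex \<Rightarrow> complex) \<Rightarrow> complex" where
  "newton_coeff X i f = circ_int (\<lambda>w. f w / (\<Prod>a\<le>i. w - X a))"

context
  fixes X :: "nat \<Rightarrow> complex" and n :: nat
  assumes X: "\<And>i. i < n \<Longrightarrow> X i \<in> ball (1/2) (1/2)"
begin

lemma node_neq: "i < n \<Longrightarrow> w \<in> half_circle \<Longrightarrow> w - X i \<noteq> 0"
  using X half_circle_neq by blast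

lemma continuous_newton:
  "i < n \<Longrightarrow> continuous_on half_circle f \<Longrightarrow> continuous_on half_circle (\<lambda>w. f w / (\<Prod>a\<le>i. w - X a))"
  using node_neq by (intro continuous_intros) auto

text \<open>Write b + c w as (b + c \<open>X i\<close>) + c (w - \<open>X i\<close>). The second
  part cancels the last denominator factor; for i = 0 it leaves a holomorphic integrand.\<close>

lemma newton_coeff_linear:
  assumes i: "i < n" and f: "f holomorphic_on half_disc"
  shows "newton_coeff X i (\<lambda>w. (b + c * w) * f w)
    = (b + c * X i) * newton_coeff X i f + (if i = 0 then 0 else c * newton_coeff X (i - 1) f)"
proof -
  have c: "continuous_on half_circle f"
    by (rule holomorphic_half_disc_continuous[OF f])
  show ?thesis
  proof (cases i)
    case 0
    have "newton_coeff X i (\<lambda>w. (b + c * w) * f w)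
      = circ_int (\<lambda>w. (b + c * X i) * (f w / (\<Prod>a\<le>i. w - X a)) + c * f w)"
      unfolding newton_coeff_def using node_neq[OF i] 0
      by (intro circ_int_cong) (simp add: field_simps)
    also have "\<dots> = (b + c * X i) * newton_coeff X i f + c * circ_int f"
      unfolding newton_coeff_def by (rule circ_int_linear[OF continuous_newton[OF i c] c])
    finally show ?thesis
      using 0 circ_int_holomorphic[OF f] by simp
  next
    case (Suc i')
    then have i': "i' < n" using i by simp
    have "newton_coeff X i (\<lambda>w. (b + c * w) * f w)
      = circ_int (\<lambda>w. (b + c * X i) * (f w / (\<Prod>a\<le>i. w - X a)) + c * (f w / (\<Prod>a\<le>i'. w - X a)))"
      unfolding newton_coeff_def
    proof (rule circ_int_cong)
      fix w :: complex assume w: "w \<in> half_circle"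
      have "(\<Prod>a\<le>i. w - X a) = (\<Prod>a\<le>i'. w - X a) * (w - X i)"
        using Suc by simp
      then show "(b + c * w) * f w / (\<Prod>a\<le>i. w - X a)
          = (b + c * X i) * (f w / (\<Prod>a\<le>i. w - X a)) + c * (f w / (\<Prod>a\<le>i'. w - X a))"
        using node_neq[OF i w] node_neq[OF _ w] i'
          weighted_fraction[of "\<Prod>a\<le>i'. w - X a" w "X i"] by (simp add: prod_zero_iff)
    qed
    also have "\<dots> = (b + c * X i) * newton_coeff X i f + c * newton_coeff X i' f"
      unfolding newton_coeff_def
      by (rule circ_int_linear[OF continuous_newton[OF i c] continuous_newton[OF i' c]])
    finally show ?thesis
      using Suc by simp
  qed
qed

lemma newton_coeff_one: "i < n \<Longrightarrow> newton_coeff X i (\<lambda>w. 1) = (if i = 0 then 1 else 0)"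
proof -
  assume i: "i < n"
  show ?thesis
  proof (cases "i = 0")
    case True
    then show ?thesis
      using circ_int_Cauchy[of "\<lambda>_. 1" "X 0"] X[OF i] by (simp add: newton_coeff_def)
  next
    case False
    have "X ` {..i} \<subseteq> ball (1/2) (1/2)"
      by (intro image_subsetI X) (use i in auto)
    with False show ?thesis
      using circ_int_inverse_prod[of "{..i}" X] by (simp add: newton_coeff_def)
  qed
qed

lemma newton_coeff_power: "i < n \<Longrightarrow> newton_coeff X i (\<lambda>w. w ^ p) = divdiff X i p"
proof (induction p arbitrary: i)
  case 0
  then show ?case by (cases i) (simp_all add: newton_coeff_one)
next
  case (Suc p)
  have "newton_coeff X i (\<lambda>w. w ^ Suc p) = newton_coeff X i (\<lambda>w. (0 + 1 * w) * w ^ p)"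
    by simp
  also have "\<dots> = X i * newton_coeff X i (\<lambda>w. w ^ p)
      + (if i = 0 then 0 else newton_coeff X (i - 1) (\<lambda>w. w ^ p))"
    by (subst newton_coeff_linear[OF Suc.prems]) (auto intro!: holomorphic_intros)
  finally show ?case
    using Suc by (cases i) simp_all
qed

lemma newton_coeff_cong:
  "(\<And>w. w \<in> half_circle \<Longrightarrow> f w = g w) \<Longrightarrow> newton_coeff X i f = newton_coeff X i g"
  unfolding newton_coeff_def by (rule circ_int_cong) simp

lemma newton_coeff_sum:
  assumes "i < n" "finite A" "\<And>a. a \<in> A \<Longrightarrow> continuous_on half_circle (f a)"
  shows "newton_coeff X i (\<lambda>w. \<Sum>a\<in>A. c a * f a w) = (\<Sum>a\<in>A. c a * newton_coeff X i (f a))"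
proof -
  have "newton_coeff X i (\<lambda>w. \<Sum>a\<in>A. c a * f a w)
      = circ_int (\<lambda>w. \<Sum>a\<in>A. c a * (f a w / (\<Prod>a\<le>i. w - X a)))"
    unfolding newton_coeff_def by (simp add: sum_divide_distrib)
  also have "\<dots> = (\<Sum>a\<in>A. circ_int (\<lambda>w. c a * (f a w / (\<Prod>a\<le>i. w - X a))))"
    using assms by (intro circ_int_sum continuous_intros continuous_newton) auto
  also have "\<dots> = (\<Sum>a\<in>A. c a * newton_coeff X i (f a))"
    unfolding newton_coeff_def using assms
    by (intro sum.cong refl circ_int_mult continuous_newton) auto
  finally show ?thesis .
qed

text \<open>The Newton coefficients are dual to the Newton basis: common factors cancel and leave a
  polynomial, a single simple pole, or a reciprocal product that integrates to 0.\<close>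

lemma newton_coeff_basis:
  assumes i: "i < n" and j: "j < n"
  shows "newton_coeff X i (\<lambda>w. \<Prod>a<j. w - X a) = (if i = j then 1 else 0)"
proof (cases "j \<le> i")
  case True
  have "newton_coeff X i (\<lambda>w. \<Prod>a<j. w - X a) = circ_int (\<lambda>w. 1 / (\<Prod>a\<in>{j..i}. w - X a))"
    unfolding newton_coeff_def
  proof (rule circ_int_cong)
    fix w :: complex assume w: "w \<in> half_circle"
    have "{..i} = {..<j} \<union> {j..i}"
      using True by auto
    then have "(\<Prod>a\<le>i. w - X a) = (\<Prod>a<j. w - X a) * (\<Prod>a\<in>{j..i}. w - X a)"
      by (simp add: prod.union_disjoint ivl_disj_int)
    moreover have "(\<Prod>a<j. w - X a) \<noteq> 0"
      using node_neq[OF _ w] j by (auto simp: prod_zero_iff)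
    ultimately show "(\<Prod>a<j. w - X a) / (\<Prod>a\<le>i. w - X a) = 1 / (\<Prod>a\<in>{j..i}. w - X a)"
      by simp
  qed
  also have "\<dots> = (if i = j then 1 else 0)"
  proof (cases "i = j")
    case True
    then show ?thesis
      using circ_int_Cauchy[of "\<lambda>_. 1" "X j"] X[OF j] by simp
  next
    case False
    have "X ` {j..i} \<subseteq> ball (1/2) (1/2)"
      by (intro image_subsetI X) (use i in auto)
    with False show ?thesis
      using circ_int_inverse_prod[of "{j..i}" X] True by simp
  qed
  finally show ?thesis .
next
  case False
  have "newton_coeff X i (\<lambda>w. \<Prod>a<j. w - X a) = circ_int (\<lambda>w. \<Prod>a\<in>{Suc i..<j}. w - X a)"
    unfolding newton_coeff_def
  proof (rule circ_int_cong)
    fix w :: complex assume w: "w \<in> half_circle"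
    have un: "{..<j} = {..i} \<union> {Suc i..<j}"
      using False by auto
    have "(\<Prod>a<j. w - X a) = (\<Prod>a\<le>i. w - X a) * (\<Prod>a\<in>{Suc i..<j}. w - X a)"
      unfolding un by (rule prod.union_disjoint) auto
    moreover have "(\<Prod>a\<le>i. w - X a) \<noteq> 0"
      using node_neq[OF _ w] i by (auto simp: prod_zero_iff)
    ultimately show "(\<Prod>a<j. w - X a) / (\<Prod>a\<le>i. w - X a) = (\<Prod>a\<in>{Suc i..<j}. w - X a)"
      by simp
  qed
  also have "\<dots> = 0"
    by (intro circ_int_holomorphic holomorphic_intros)
  finally show ?thesis
    using False by simp
qed

text \<open>Multiplication by 1 + y w mixes coefficient i only with coefficient i - 1, so agreement
  of the first n coefficients survives every factor.\<close>

lemma newton_coeff_poly_cong: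
  fixes y :: "nat \<Rightarrow> complex"
  assumes f: "f holomorphic_on half_disc" and g: "g holomorphic_on half_disc"
    and eq: "\<And>i. i < n \<Longrightarrow> newton_coeff X i f = newton_coeff X i g" and "i < n"
  shows "newton_coeff X i (\<lambda>w. (\<Prod>j=1..k. 1 + y j * w) * f w)
    = newton_coeff X i (\<lambda>w. (\<Prod>j=1..k. 1 + y j * w) * g w)"
  using \<open>i < n\<close>
proof (induction k arbitrary: i)
  case 0
  then show ?case using eq by simp
next
  case (Suc k)
  have "newton_coeff X i (\<lambda>w. (\<Prod>j=1..Suc k. 1 + y j * w) * h w) =
      (1 + y (Suc k) * X i) * newton_coeff X i (\<lambda>w. (\<Prod>j=1..k. 1 + y j * w) * h w) +
      (if i = 0 then 0 else y (Suc k) * newton_coeff X (i - 1) (\<lambda>w. (\<Prod>j=1..k. 1 + y j * w) * h w))"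
    if "h holomorphic_on half_disc" for h
  proof -
    have "(\<lambda>w. (\<Prod>j=1..Suc k. 1 + y j * w) * h w) = (\<lambda>w. (1 + y (Suc k) * w) * ((\<Prod>j=1..k. 1 + y j * w) * h w))"
      by (simp add: mult_ac)
    moreover have "(\<lambda>w. (\<Prod>j=1..k. 1 + y j * w) * h w) holomorphic_on half_disc"
      by (intro holomorphic_intros that)
    ultimately show ?thesis
      using newton_coeff_linear[OF Suc.prems, of "\<lambda>w. (\<Prod>j=1..k. 1 + y j * w) * h w" 1 "y (Suc k)"]
      by simp
  qed
  note step = this
  show ?case
    unfolding step[OF f] step[OF g]
    using Suc.IH[OF Suc.prems] Suc.IH[of "i - 1"] Suc.prems by simp
qed

end

section \<open>Generating polynomials, synthetic division and the Cauchy kernel\<close>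

abbreviation factor_poly :: "(nat \<Rightarrow> 'a::comm_ring_1) \<Rightarrow> nat \<Rightarrow> 'a poly" where
  "factor_poly y k \<equiv> \<Prod>j=1..k. [:1, y j:]"

abbreviation node_poly :: "(nat \<Rightarrow> 'a::comm_ring_1) \<Rightarrow> nat \<Rightarrow> 'a poly" where
  "node_poly X n \<equiv> \<Prod>a<n. [:- X a, 1:]"

lemma degree_factor_poly: "degree (factor_poly y k) \<le> k"
proof -
  have "degree (factor_poly y k) \<le> sum (degree \<circ> (\<lambda>j. [:1, y j:])) {1..k}"
    by (rule degree_prod_sum_le) simp
  also have "\<dots> \<le> (\<Sum>j=1..k. 1)"
    by (intro sum_mono) simp
  finally show ?thesis by simp
qed

lemma degree_node_poly: "degree (node_poly X n) \<le> n"
proof -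
  have "degree (node_poly X n) \<le> sum (degree \<circ> (\<lambda>a. [:- X a, 1:])) {..<n}"
    by (rule degree_prod_sum_le) simp
  also have "\<dots> \<le> (\<Sum>a<n. 1)"
    by (intro sum_mono) simp
  finally show ?thesis by simp
qed

lemma shift_factors_eq:
  "shift_factors y k u j = (\<Sum>q\<le>k. coeff (factor_poly y k) q * u (j + q))"
proof (induction k arbitrary: u)
  case 0
  then show ?case by simp
next
  case (Suc k)
  let ?P = "factor_poly y k" and ?c = "y (Suc k)"
  have P: "factor_poly y (Suc k) = ?P + Polynomial.smult ?c (pCons 0 ?P)"
    by (simp add: mult.commute)
  have z: "coeff ?P (Suc k) = 0"
    using degree_factor_poly[of y k] by (intro coeff_eq_0) simp
  have "(\<Sum>q\<le>Suc k. coeff (factor_poly y (Suc k)) q * u (j + q))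
     = (\<Sum>q\<le>Suc k. coeff ?P q * u (j + q)) + (\<Sum>q\<le>Suc k. ?c * (coeff (pCons 0 ?P) q * u (j + q)))"
    unfolding P by (simp only: coeff_add coeff_smult distrib_right sum.distrib mult.assoc)
  also have "(\<Sum>q\<le>Suc k. coeff ?P q * u (j + q)) = (\<Sum>q\<le>k. coeff ?P q * u (j + q))"
    using z by (simp del: prod.cl_ivl_Suc)
  also have "(\<Sum>q\<le>Suc k. ?c * (coeff (pCons 0 ?P) q * u (j + q))) = (\<Sum>q\<le>k. ?c * (coeff ?P q * u (Suc (j + q))))"
    by (subst sum.atMost_Suc_shift) simp
  finally have E: "(\<Sum>q\<le>Suc k. coeff (factor_poly y (Suc k)) q * u (j + q))
     = (\<Sum>q\<le>k. coeff ?P q * u (j + q)) + (\<Sum>q\<le>k. ?c * (coeff ?P q * u (Suc (j + q))))" .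
  show ?case
    unfolding shift_factors.simps Suc.IH E by (simp add: distrib_left distrib_right sum.distrib mult_ac)
qed

lemma of_real_divdiff: "of_real (divdiff X i p) = divdiff (\<lambda>i. of_real (X i)) i p"
  by (induction X i p rule: divdiff.induct) auto

lemma of_real_shift_factors:
  "of_real (shift_factors y k u j) = shift_factors (\<lambda>i. of_real (y i)) k (\<lambda>p. of_real (u p)) j"
  by (induction k arbitrary: u) auto

lemma of_real_ldet: "of_real (ldet n A) = ldet n (\<lambda>i j. of_real (A i j))"
  by (simp add: ldet_leibniz)

text \<open>Horner's scheme unrolled m times. With m past the degree, the remainder term disappears
  and the quotient depends on the leading coefficients alone.\<close>

lemma coeff_synthetic_div:
  fixes p :: "'a::comm_ring_1 poly"
  shows "coeff (synthetic_div p c) e = (\<Sum>t<m. coeff p (Suc (e + t)) * c ^ t) + c ^ m * coeff (synthetic_div p c) (e + m)"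
proof (induction m)
  case (Suc m)
  have s: "coeff (synthetic_div p c) (e + m) = coeff p (Suc (e + m)) + c * coeff (synthetic_div p c) (Suc (e + m))"
    using arg_cong[OF synthetic_div_correct[of p c], of "\<lambda>q. coeff q (Suc (e + m))"] by simp
  show ?case
    by (subst Suc, subst s) (simp add: distrib_left mult_ac)
qed simp

lemma coeff_synthetic_div_eq:
  fixes p :: "'a::comm_ring_1 poly"
  assumes "degree p \<le> e + m"
  shows "coeff (synthetic_div p c) e = (\<Sum>t<m. coeff p (Suc (e + t)) * c ^ t)"
proof (cases "degree p = 0")
  case True
  then have "synthetic_div p c = 0" by (simp add: synthetic_div_eq_0_iff)
  moreover have "coeff p (Suc i) = 0" for i
    using True by (intro coeff_eq_0) simp
  ultimately show ?thesis by simp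
next
  case False
  then have "coeff (synthetic_div p c) (e + m) = 0"
    using assms by (intro coeff_eq_0) (simp add: degree_synthetic_div)
  then show ?thesis
    by (subst coeff_synthetic_div[of _ _ _ m]) simp
qed

text \<open>The quotient of r(z) - r(w) by z - w obeys a product rule: insert p(z) q(w) between p(z)
  q(z) and p(w) q(w).\<close>

lemma synthetic_div_mult:
  fixes p q :: "'a::idom poly"
  shows "synthetic_div (p * q) w = p * synthetic_div q w + Polynomial.smult (poly q w) (synthetic_div p w)"
proof -
  have c: "[:- w, 1:] * synthetic_div r w = r - [:poly r w:]" for r :: "'a poly"
    using synthetic_div_correct'[of w r] by (simp add: algebra_simps)
  have "[:- w, 1:] * synthetic_div (p * q) w
     = [:- w, 1:] * (p * synthetic_div q w + Polynomial.smult (poly q w) (synthetic_div p w))"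
  proof -
    have "[:- w, 1:] * (p * synthetic_div q w + Polynomial.smult (poly q w) (synthetic_div p w))
      = p * ([:- w, 1:] * synthetic_div q w) + Polynomial.smult (poly q w) ([:- w, 1:] * synthetic_div p w)"
      by (simp only: distrib_left mult_smult_right mult.left_commute)
    also have "\<dots> = [:- w, 1:] * synthetic_div (p * q) w"
      unfolding c by (simp add: algebra_simps smult_diff_right)
    finally show ?thesis by simp
  qed
  then show ?thesis by (subst (asm) mult_cancel_left) auto
qed

text \<open>The first n terms of the Newton expansion of 1 / (w - z) in z. Multiplied by z - w they
  telescope, and what remains is (Q(z) - Q(w)) / Q(w) for the node polynomial Q.\<close>

lemma newton_telescope:
  fixes X :: "nat \<Rightarrow> 'a::field"
  assumes "\<And>a. a < n \<Longrightarrow> w \<noteq> X a"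
  shows "(\<Sum>i<n. Polynomial.smult (1 / (\<Prod>a\<le>i. w - X a)) (node_poly X i))
    = Polynomial.smult (1 / poly (node_poly X n) w) (synthetic_div (node_poly X n) w)"
proof -
  have ev: "poly (node_poly X i) w = (\<Prod>a<i. w - X a)" for i
    by (simp add: poly_prod)
  have nz: "(\<Prod>a<i. w - X a) \<noteq> 0" if "i \<le> n" for i
    using assms that by (auto simp: prod_zero_iff)
  have tel: "m \<le> n \<Longrightarrow> [:- w, 1:] * (\<Sum>i<m. Polynomial.smult (1 / (\<Prod>a\<le>i. w - X a)) (node_poly X i))
      = Polynomial.smult (1 / (\<Prod>a<m. w - X a)) (node_poly X m) - 1" for m
  proof (induction m)
    case (Suc m)
    have m: "(\<Prod>a<m. w - X a) \<noteq> 0" "w - X m \<noteq> 0" and le: "(\<Prod>a\<le>m. w - X a) = (\<Prod>a<m. w - X a) * (w - X m)"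
      using nz[of m] assms[of m] Suc.prems by (simp_all add: lessThan_Suc_atMost[symmetric])
    have s: "[:- w, 1:] = [:- X m, 1:] - [:w - X m:]" by simp
    have st: "[:- w, 1:] * Polynomial.smult (1 / (\<Prod>a\<le>m. w - X a)) (node_poly X m)
      = Polynomial.smult (1 / (\<Prod>a\<le>m. w - X a)) (node_poly X (Suc m)) - Polynomial.smult (1 / (\<Prod>a<m. w - X a)) (node_poly X m)"
    proof -
      have v: "[:v:] * Polynomial.smult c q = Polynomial.smult (v * c) q" for v c :: 'a and q
        by (simp add: mult.commute)
      have "(w - X m) * (1 / ((\<Prod>a<m. w - X a) * (w - X m))) = 1 / (\<Prod>a<m. w - X a)"
        using m(2) by simp
      then show ?thesis
        unfolding s le left_diff_distrib v by (simp add: mult.commute)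
    qed
    have IH: "[:- w, 1:] * (\<Sum>i<m. Polynomial.smult (1 / (\<Prod>a\<le>i. w - X a)) (node_poly X i))
        = Polynomial.smult (1 / (\<Prod>a<m. w - X a)) (node_poly X m) - 1"
      by (rule Suc.IH) (use Suc.prems in simp)
    show ?case
      by (simp only: sum.lessThan_Suc distrib_left IH st) (simp add: lessThan_Suc_atMost del: prod.lessThan_Suc)
  qed simp
  have "[:- w, 1:] * (Polynomial.smult (1 / poly (node_poly X n) w) (synthetic_div (node_poly X n) w))
     = Polynomial.smult (1 / (\<Prod>a<n. w - X a)) (node_poly X n) - 1"
  proof -
    have "[:- w, 1:] * synthetic_div (node_poly X n) w = node_poly X n - [:poly (node_poly X n) w:]"
      using synthetic_div_correct'[of w "node_poly X n"] by (simp add: algebra_simps)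
    then have "[:- w, 1:] * (Polynomial.smult (1 / poly (node_poly X n) w) (synthetic_div (node_poly X n) w))
      = Polynomial.smult (1 / poly (node_poly X n) w) (node_poly X n - [:poly (node_poly X n) w:])"
      by (simp only: mult_smult_right)
    also have "\<dots> = Polynomial.smult (1 / (\<Prod>a<n. w - X a)) (node_poly X n) - 1"
      using nz[of n] unfolding ev by (simp add: smult_diff_right one_pCons)
    finally show ?thesis .
  qed
  then have "[:- w, 1:] * (\<Sum>i<n. Polynomial.smult (1 / (\<Prod>a\<le>i. w - X a)) (node_poly X i))
     = [:- w, 1:] * (Polynomial.smult (1 / poly (node_poly X n) w) (synthetic_div (node_poly X n) w))"
    using tel[of n] by simp
  then show ?thesis by (subst (asm) mult_cancel_left) auto
qed

lemma shift_factors_linear: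
  "shift_factors y k (\<lambda>p. \<Sum>l<n. a l * u l p) j = (\<Sum>l<n. a l * shift_factors y k (u l) j)"
proof -
  have "shift_factors y k (\<lambda>p. \<Sum>l<n. a l * u l p) j
    = (\<Sum>q\<le>k. \<Sum>l<n. a l * (coeff (factor_poly y k) q * u l (j + q)))"
    unfolding shift_factors_eq by (simp add: sum_distrib_left sum_distrib_right mult_ac)
  also have "\<dots> = (\<Sum>l<n. a l * shift_factors y k (u l) j)"
    unfolding shift_factors_eq sum_distrib_left by (rule sum.swap)
  finally show ?thesis .
qed

text \<open>Multiplication by 1 + y z acts on the divided differences by a lower bidiagonal matrix
  \<open>L\<close> with diagonal 1 + y \<open>X i\<close>. Its determinant is one factor of the
  normalizing product; together with \<open>sum_schur_schur\<close> this is the dual Cauchy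
  identity.\<close>

lemma ldet_shift_factors_divdiff:
  fixes X :: "nat \<Rightarrow> 'a::comm_ring_1"
  shows "ldet n (\<lambda>i j. shift_factors y k (divdiff X i) j) = (\<Prod>i<n. \<Prod>j=1..k. 1 + y j * X i)"
proof (induction k)
  case 0
  have "ldet n (\<lambda>i j. divdiff X i j) = (\<Prod>i<n. divdiff X i i)"
    by (rule ldet_upper_triangular) (simp add: divdiff_less)
  then show ?case by (simp add: divdiff_same)
next
  case (Suc k)
  define L where "L = (\<lambda>i l. if i = l then 1 + y (Suc k) * X i else if i = Suc l then y (Suc k) else 0)"
  have step: "(\<lambda>p. divdiff X i p + y (Suc k) * divdiff X i (Suc p)) = (\<lambda>p. \<Sum>l<n. L i l * divdiff X l p)"
    if i: "i < n" for i
  proof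
    fix p
    have "(\<Sum>l<n. L i l * divdiff X l p) = (\<Sum>l<n. (if l = i then (1 + y (Suc k) * X i) * divdiff X i p else 0)
        + (if Suc l = i then y (Suc k) * divdiff X l p else 0))"
      by (intro sum.cong) (auto simp: L_def)
    also have "\<dots> = divdiff X i p + y (Suc k) * divdiff X i (Suc p)"
    proof (cases i)
      case 0
      then show ?thesis using i by (simp add: sum.distrib algebra_simps)
    next
      case (Suc i')
      then show ?thesis using i by (simp add: sum.distrib algebra_simps)
    qed
    finally show "divdiff X i p + y (Suc k) * divdiff X i (Suc p) = (\<Sum>l<n. L i l * divdiff X l p)" ..
  qed
  have "ldet n (\<lambda>i j. shift_factors y (Suc k) (divdiff X i) j)
      = ldet n (\<lambda>i j. \<Sum>l<n. L i l * shift_factors y k (divdiff X l) j)"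
    by (rule ldet_cong) (simp add: step shift_factors_linear)
  also have "\<dots> = ldet n L * (\<Prod>i<n. \<Prod>j=1..k. 1 + y j * X i)"
    by (simp add: ldet_mult Suc.IH)
  also have "ldet n L = (\<Prod>i<n. 1 + y (Suc k) * X i)"
    by (subst ldet_lower_triangular) (auto simp: L_def)
  finally show ?case
    by (simp add: prod.distrib mult.commute)
qed

lemma poly_factor_poly: "poly (factor_poly y k) w = (\<Prod>j=1..k. 1 + y j * w)"
  by (simp add: poly_prod mult.commute)

lemma poly_node_poly: "poly (node_poly X n) w = (\<Prod>a<n. w - X a)"
  by (simp add: poly_prod)

section \<open>Reduction to a determinant of fixed size\<close>

context
  fixes X Y :: "nat \<Rightarrow> complex" and n k d :: nat
  assumes X: "\<And>i. i < n \<Longrightarrow> X i \<in> ball (1/2) (1/2)"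
    and Y: "\<And>j w. j \<in> {1..k} \<Longrightarrow> w \<in> half_disc \<Longrightarrow> 1 + Y j * w \<noteq> 0"
    and d: "d \<le> n" "d \<le> k"
begin

lemma factor_poly_neq_0: "w \<in> half_disc \<Longrightarrow> poly (factor_poly Y k) w \<noteq> 0"
  unfolding poly_factor_poly using Y by (auto simp: prod_zero_iff)

lemma node_neq': "i < n \<Longrightarrow> w \<in> half_circle \<Longrightarrow> w - X i \<noteq> 0"
  using X half_circle_neq by blast

lemma node_poly_neq_0: "w \<in> half_circle \<Longrightarrow> poly (node_poly X n) w \<noteq> 0"
  unfolding poly_node_poly using node_neq' by (auto simp: prod_zero_iff)

lemma half_circle_disc: "w \<in> half_circle \<Longrightarrow> w \<in> half_disc"
  by simp

text \<open>The Newton interpolation polynomial of z^q / (\<open>factor_poly Y k\<close>) at the n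
  nodes, with multiplicities.\<close>

definition interp_poly :: "nat \<Rightarrow> complex poly" where
  "interp_poly q = (\<Sum>i<n. Polynomial.smult (newton_coeff X i (\<lambda>w. w ^ q / poly (factor_poly Y k) w)) (node_poly X i))"

lemma degree_interp_poly: "n \<le> j \<Longrightarrow> coeff (interp_poly q) j = 0"
proof -
  assume "n \<le> j"
  then have "coeff (node_poly X i) j = 0" if "i < n" for i
    using that degree_node_poly[of X i] by (intro coeff_eq_0) linarith
  then show ?thesis by (simp add: interp_poly_def coeff_sum)
qed

text \<open>\<open>factor_poly Y k\<close> times the interpolant has the same Newton coefficients as
  z^q. Expanded in powers of z, this says that the coefficients of the interpolant express column q
  through the columns of the untruncated matrix, that is, they invert that matrix on it.\<close>

lemma divdiff_interp_poly:
  assumes "i < n"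
  shows "(\<Sum>j<n. shift_factors Y k (divdiff X i) j * coeff (interp_poly q) j) = divdiff X i q"
proof -
  let ?P = "factor_poly Y k"
  let ?f = "\<lambda>w. w ^ q / poly ?P w" and ?g = "\<lambda>w. \<Sum>j<n. coeff (interp_poly q) j * w ^ j"
  have f: "?f holomorphic_on half_disc"
    using factor_poly_neq_0 by (intro holomorphic_intros) auto
  have g: "?g holomorphic_on half_disc"
    by (intro holomorphic_intros)
  have g_eq: "?g = poly (interp_poly q)"
  proof
    fix w
    have "poly (interp_poly q) w = (\<Sum>j\<le>degree (interp_poly q). coeff (interp_poly q) j * w ^ j)"
      by (rule poly_altdef)
    also have "\<dots> = ?g w"
      by (rule sum.mono_neutral_cong)
         (auto simp: coeff_eq_0 intro: degree_interp_poly)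
    finally show "?g w = poly (interp_poly q) w" ..
  qed
  have "newton_coeff X l ?g = newton_coeff X l ?f" if l: "l < n" for l
  proof -
    have "poly (interp_poly q) = (\<lambda>w. \<Sum>i<n. newton_coeff X i ?f * (\<Prod>a<i. w - X a))"
      unfolding interp_poly_def by (simp add: fun_eq_iff poly_sum poly_prod)
    then have "?g = (\<lambda>w. \<Sum>i<n. newton_coeff X i ?f * (\<Prod>a<i. w - X a))"
      using g_eq by (rule trans[rotated])
    then have "newton_coeff X l ?g = (\<Sum>i<n. newton_coeff X i ?f * newton_coeff X l (\<lambda>w. \<Prod>a<i. w - X a))"
      by (simp only:) (rule newton_coeff_sum[OF X l], auto intro!: continuous_intros)
    also have "\<dots> = (\<Sum>i<n. if i = l then newton_coeff X i ?f else 0)"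
      using newton_coeff_basis[OF X l] by (intro sum.cong) auto
    finally show ?thesis using l by simp
  qed
  from newton_coeff_poly_cong[OF X g f this assms, where y = Y and k = k]
  have "newton_coeff X i (\<lambda>w. poly ?P w * ?g w) = newton_coeff X i (\<lambda>w. poly ?P w * ?f w)"
    unfolding poly_factor_poly by simp
  also have "\<dots> = newton_coeff X i (\<lambda>w. w ^ q)"
  proof (rule newton_coeff_cong[OF X])
    fix w :: complex assume "w \<in> half_circle"
    then have "poly ?P w \<noteq> 0"
      by (intro factor_poly_neq_0 half_circle_disc)
    then show "poly ?P w * ?f w = w ^ q" by simp
  qed
  also have "\<dots> = divdiff X i q"
    by (rule newton_coeff_power[OF X assms])
  finally have 1: "newton_coeff X i (\<lambda>w. poly ?P w * ?g w) = divdiff X i q" .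
  have Pw: "poly ?P w = (\<Sum>a\<le>k. coeff ?P a * w ^ a)" for w
  proof -
    have "poly ?P w = (\<Sum>a\<le>degree ?P. coeff ?P a * w ^ a)"
      by (rule poly_altdef)
    also have "\<dots> = (\<Sum>a\<le>k. coeff ?P a * w ^ a)"
      using degree_factor_poly[of Y k] by (intro sum.mono_neutral_left) (auto simp: coeff_eq_0)
    finally show ?thesis .
  qed
  have "newton_coeff X i (\<lambda>w. poly ?P w * ?g w)
      = newton_coeff X i (\<lambda>w. \<Sum>(a, j)\<in>{..k} \<times> {..<n}. coeff ?P a * coeff (interp_poly q) j * w ^ (j + a))"
    unfolding Pw sum_product sum.cartesian_product by (simp add: power_add mult_ac case_prod_unfold)
  also have "\<dots> = (\<Sum>u\<in>{..k} \<times> {..<n}. (coeff ?P (fst u) * coeff (interp_poly q) (snd u)) *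
        newton_coeff X i (\<lambda>w. w ^ (snd u + fst u)))"
    unfolding case_prod_unfold by (rule newton_coeff_sum[OF X assms]) (auto intro!: continuous_intros)
  also have "\<dots> = (\<Sum>u\<in>{..k} \<times> {..<n}. (coeff ?P (fst u) * coeff (interp_poly q) (snd u)) *
        divdiff X i (snd u + fst u))"
    by (simp only: newton_coeff_power[OF X assms])
  also have "\<dots> = (\<Sum>a\<le>k. \<Sum>j<n. (coeff ?P a * coeff (interp_poly q) j) * divdiff X i (j + a))"
    by (simp add: sum.cartesian_product case_prod_unfold)
  also have "\<dots> = (\<Sum>j<n. \<Sum>a\<le>k. (coeff ?P a * coeff (interp_poly q) j) * divdiff X i (j + a))"
    by (rule sum.swap)
  also have "\<dots> = (\<Sum>j<n. shift_factors Y k (divdiff X i) j * coeff (interp_poly q) j)"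
    unfolding shift_factors_eq sum_distrib_right by (simp only: mult_ac)
  finally show ?thesis using 1 by simp
qed

text \<open>For j < n the degrees j + q reach at most n + k - 1, so the cut at n + (k - d) loses
  only the d degrees n + (k - d) + r. This is the part of rank d.\<close>

lemma shift_factors_truncated:
  assumes "j < n"
  shows "shift_factors Y k (\<lambda>p. if p < n + (k - d) then u p else 0) j
    = shift_factors Y k u j - (\<Sum>r<d. u (n + (k - d) + r) * coeff (factor_poly Y k) (n + (k - d) + r - j))"
proof -
  let ?P = "factor_poly Y k" and ?e = "n + (k - d)"
  have "shift_factors Y k u j = (\<Sum>q\<le>k. coeff ?P q * (if j + q < ?e then u (j + q) else 0)
      + (if j + q < ?e then 0 else coeff ?P q * u (j + q)))"
    unfolding shift_factors_eq by (intro sum.cong) auto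
  also have "\<dots> = shift_factors Y k (\<lambda>p. if p < ?e then u p else 0) j
      + (\<Sum>q\<le>k. if j + q < ?e then 0 else coeff ?P q * u (j + q))"
    unfolding shift_factors_eq by (rule sum.distrib)
  also have "(\<Sum>q\<le>k. if j + q < ?e then 0 else coeff ?P q * u (j + q))
      = (\<Sum>q\<in>{q. q \<le> k \<and> ?e \<le> j + q}. u (j + q) * coeff ?P q)"
    by (rule sum.mono_neutral_cong_right) auto
  also have "\<dots> = (\<Sum>r\<in>{r. r < d \<and> ?e + r - j \<le> k}. u (?e + r) * coeff ?P (?e + r - j))"
    using assms d
    by (intro sum.reindex_bij_witness[where i = "\<lambda>r. ?e + r - j" and j = "\<lambda>q. j + q - ?e"]) auto
  also have "\<dots> = (\<Sum>r<d. u (?e + r) * coeff ?P (?e + r - j))"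
    using degree_factor_poly[of Y k]
    by (intro sum.mono_neutral_left) (auto simp: not_le intro!: coeff_eq_0)
  finally show ?thesis by simp
qed

text \<open>The product of the two rank-d factors in the order of Sylvester's identity, evaluated in
  closed form. Only the top coefficients of a polynomial of degree at most n + k occur, so the
  number of terms does not grow with n.\<close>

definition gap_kernel :: "nat \<Rightarrow> nat \<Rightarrow> complex" where
  "gap_kernel r s = (\<Sum>t<d - r. coeff (factor_poly Y k * node_poly X n) (Suc (n + (k - d) + r + t)) *
     circ_int (\<lambda>w. w ^ (n + (k - d) + s + t) / poly (factor_poly Y k * node_poly X n) w))"

text \<open>The sum over j is one coefficient of \<open>interp_poly\<close> times
  \<open>factor_poly\<close>. Moving it under the contour integral lets
  \<open>newton_telescope\<close> sum the interpolation formula, and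
  \<open>coeff_synthetic_div_eq\<close> reduces the coefficient to at most d terms.\<close>

lemma gap_kernel_eq:
  assumes "r < d"
  shows "(\<Sum>j<n. coeff (factor_poly Y k) (n + (k - d) + r - j) * coeff (interp_poly (n + (k - d) + s)) j)
    = gap_kernel r s"
proof -
  let ?P = "factor_poly Y k" and ?Q = "node_poly X n" and ?e = "n + (k - d) + r" and ?q = "n + (k - d) + s"
  let ?f = "\<lambda>w. w ^ ?q / poly ?P w"
  have cont: "continuous_on half_circle ?f"
    using factor_poly_neq_0[OF half_circle_disc] by (intro continuous_intros) auto
  have contV: "continuous_on half_circle (\<lambda>w. w ^ a / poly (?P * ?Q) w)" for a
    using factor_poly_neq_0[OF half_circle_disc] node_poly_neq_0
    by (intro continuous_intros) auto
  have "(\<Sum>j<n. coeff ?P (?e - j) * coeff (interp_poly ?q) j)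
      = (\<Sum>j\<le>?e. coeff (interp_poly ?q) j * coeff ?P (?e - j))"
    by (rule sum.mono_neutral_cong_left) (auto simp: degree_interp_poly mult.commute)
  also have "\<dots> = coeff (interp_poly ?q * ?P) ?e"
    by (simp add: coeff_mult)
  also have "\<dots> = (\<Sum>i<n. coeff (?P * node_poly X i) ?e * newton_coeff X i ?f)"
    by (simp only: interp_poly_def sum_distrib_right coeff_sum mult_smult_left coeff_smult)
       (simp only: mult.commute)
  also have "\<dots> = circ_int (\<lambda>w. \<Sum>i<n. coeff (?P * node_poly X i) ?e * (?f w / (\<Prod>a\<le>i. w - X a)))"
    unfolding newton_coeff_def
    by (rule circ_int_lincomb[symmetric]) (rule continuous_newton[OF X _ cont], simp_all)
  also have "\<dots> = circ_int (\<lambda>w. \<Sum>t<d - r. coeff (?P * ?Q) (Suc (?e + t)) * (w ^ (?q + t) / poly (?P * ?Q) w))"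
  proof (rule circ_int_cong)
    fix w :: complex assume w: "w \<in> half_circle"
    have nP: "poly ?P w \<noteq> 0" and nQ: "poly ?Q w \<noteq> 0"
      using factor_poly_neq_0[OF half_circle_disc] node_poly_neq_0 w by auto
    have "(\<Sum>i<n. coeff (?P * node_poly X i) ?e * (?f w / (\<Prod>a\<le>i. w - X a)))
      = ?f w * coeff (?P * (\<Sum>i<n. Polynomial.smult (1 / (\<Prod>a\<le>i. w - X a)) (node_poly X i))) ?e"
      by (simp add: sum_distrib_left coeff_sum mult_ac)
    also have "\<dots> = ?f w / poly ?Q w * coeff (?P * synthetic_div ?Q w) ?e"
      using node_neq'[OF _ w] by (subst newton_telescope) auto
    \<comment> \<open>By the product rule the two sides differ by a multiple of the quotient of
      \<open>?P\<close>, whose coefficients at and above index k vanish; \<open>?e\<close> is at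
      least k because d is at most n.\<close>
    also have "coeff (?P * synthetic_div ?Q w) ?e = coeff (synthetic_div (?P * ?Q) w) ?e"
    proof -
      have "coeff (synthetic_div ?P w) ?e = 0"
        using d degree_factor_poly[of Y k] by (subst coeff_synthetic_div_eq[of _ _ 0]) auto
      then show ?thesis by (simp add: synthetic_div_mult)
    qed
    also have "\<dots> = (\<Sum>t<d - r. coeff (?P * ?Q) (Suc (?e + t)) * w ^ t)"
    proof (rule coeff_synthetic_div_eq)
      have "degree (?P * ?Q) \<le> k + n"
        using degree_mult_le[of ?P ?Q] degree_factor_poly[of Y k] degree_node_poly[of X n] by linarith
      then show "degree (?P * ?Q) \<le> ?e + (d - r)"
        using assms d by linarith
    qed
    also have "?f w / poly ?Q w * \<dots> = (\<Sum>t<d - r. coeff (?P * ?Q) (Suc (?e + t)) * (w ^ (?q + t) / poly (?P * ?Q) w))"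
      using nP nQ unfolding sum_distrib_left by (intro sum.cong refl) (simp add: power_add field_simps)
    finally show "(\<Sum>i<n. coeff (?P * node_poly X i) ?e * (?f w / (\<Prod>a\<le>i. w - X a)))
      = (\<Sum>t<d - r. coeff (?P * ?Q) (Suc (?e + t)) * (w ^ (?q + t) / poly (?P * ?Q) w))" .
  qed
  also have "\<dots> = gap_kernel r s"
    unfolding gap_kernel_def by (rule circ_int_lincomb) (rule contV, simp)
  finally show ?thesis .
qed

text \<open>The truncated matrix is D (I - C B), with D the untruncated one: D turns the columns of
  C into the divided differences lost by the truncation.\<close>

lemma ldet_gap:
  "ldet n (\<lambda>i j. shift_factors Y k (\<lambda>p. if p < n + (k - d) then divdiff X i p else 0) j)
    = (\<Prod>i<n. \<Prod>j=1..k. 1 + Y j * X i) * ldet d (\<lambda>r s. (if r = s then 1 else 0) - gap_kernel r s)"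
proof -
  let ?e = "n + (k - d)"
  let ?D = "\<lambda>i j. shift_factors Y k (divdiff X i) j"
  let ?B = "\<lambda>r j. coeff (factor_poly Y k) (?e + r - j)" and ?C = "\<lambda>j s. coeff (interp_poly (?e + s)) j"
  have "ldet n (\<lambda>i j. shift_factors Y k (\<lambda>p. if p < ?e then divdiff X i p else 0) j)
      = ldet n (\<lambda>i j. \<Sum>l<n. ?D i l * ((if l = j then 1 else 0) - (\<Sum>r<d. ?C l r * ?B r j)))"
  proof (rule ldet_cong)
    fix i j assume ij: "i < n" "j < n"
    have "(\<Sum>l<n. ?D i l * ((if l = j then 1 else 0) - (\<Sum>r<d. ?C l r * ?B r j)))
      = (\<Sum>l<n. if l = j then ?D i j else 0) - (\<Sum>l<n. \<Sum>r<d. ?D i l * ?C l r * ?B r j)"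
    proof -
      have "?D i l * ((if l = j then 1 else 0) - (\<Sum>r<d. ?C l r * ?B r j))
          = (if l = j then ?D i j else 0) - (\<Sum>r<d. ?D i l * ?C l r * ?B r j)" for l
        by (simp add: right_diff_distrib sum_distrib_left mult.assoc)
      then show ?thesis by (simp only: sum_subtractf)
    qed
    also have "(\<Sum>l<n. \<Sum>r<d. ?D i l * ?C l r * ?B r j) = (\<Sum>r<d. (\<Sum>l<n. ?D i l * ?C l r) * ?B r j)"
      unfolding sum_distrib_right by (rule sum.swap)
    also have "\<dots> = (\<Sum>r<d. divdiff X i (?e + r) * ?B r j)"
      by (simp only: divdiff_interp_poly[OF ij(1)])
    finally show "shift_factors Y k (\<lambda>p. if p < ?e then divdiff X i p else 0) j
        = (\<Sum>l<n. ?D i l * ((if l = j then 1 else 0) - (\<Sum>r<d. ?C l r * ?B r j)))"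
      using ij by (simp add: shift_factors_truncated)
  qed
  also have "\<dots> = (\<Prod>i<n. \<Prod>j=1..k. 1 + Y j * X i) *
      ldet d (\<lambda>r s. (if r = s then 1 else 0) - (\<Sum>j<n. ?B r j * ?C j s))"
    by (simp only: ldet_mult ldet_shift_factors_divdiff ldet_sylvester)
  also have "ldet d (\<lambda>r s. (if r = s then 1 else 0) - (\<Sum>j<n. ?B r j * ?C j s))
      = ldet d (\<lambda>r s. (if r = s then 1 else 0) - gap_kernel r s)"
    by (rule ldet_cong) (simp only: gap_kernel_eq)
  finally show ?thesis .
qed

end

subsection \<open>From the circle to the line\<close>

text \<open>The line is traversed downwards, so that \<open>1 / eta t\<close> runs counterclockwise
  around the circle.\<close>

definition eta :: "real \<Rightarrow> complex" where
  "eta t = 1 - \<i> * of_real t"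

lemma Re_eta [simp]: "Re (eta t) = 1" and Im_eta [simp]: "Im (eta t) = - t"
  by (simp_all add: eta_def)

lemma eta_neq_0 [simp]: "eta t \<noteq> 0"
  by (metis Re_eta zero_complex.sel(1) zero_neq_one)

lemma norm_eta_squared: "(norm (eta t))\<^sup>2 = 1 + t\<^sup>2"
  by (simp add: cmod_power2)

text \<open>The half-angle substitution: \<open>arctan t\<close> is the argument of 1 + \<i> t, the
  conjugate of \<open>eta t\<close>.\<close>

lemma exp_arctan: "exp (2 * of_real pi * \<i> * of_real (arctan t / pi)) = cnj (eta t) / eta t"
proof -
  have "exp (2 * of_real pi * \<i> * of_real (arctan t / pi)) = exp (\<i> * of_real (arctan t)) ^ 2"
    by (simp add: exp_double[symmetric] mult_ac)
  also have "exp (\<i> * of_real (arctan t)) = cnj (eta t) / of_real (sqrt (1 + t\<^sup>2))"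
    by (simp add: complex_eq_iff exp_Euler cos_arctan sin_arctan eta_def cos_of_real sin_of_real
        Re_divide_of_real Im_divide_of_real)
  also have "(cnj (eta t) / of_real (sqrt (1 + t\<^sup>2)))\<^sup>2 = (cnj (eta t))\<^sup>2 / of_real (1 + t\<^sup>2)"
    by (simp add: power_divide of_real_power[symmetric] del: of_real_power)
  also have "of_real (1 + t\<^sup>2) = cnj (eta t) * eta t"
    by (simp add: complex_eq_iff eta_def power2_eq_square)
  also have "(cnj (eta t))\<^sup>2 / (cnj (eta t) * eta t) = cnj (eta t) / eta t"
    by (simp add: power2_eq_square)
  finally show ?thesis .
qed

lemma integrable_Cauchy_density: "integrable lborel (\<lambda>t::real. inverse (1 + t\<^sup>2))"
  using integrable_inverse_1_plus_square by (simp add: set_integrable_def einterval_def)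

lemma integrable_Cauchy_bound:
  fixes f :: "real \<Rightarrow> 'b::euclidean_space"
  assumes "f \<in> borel_measurable borel" "\<And>t. norm (f t) \<le> C * inverse (1 + t\<^sup>2)"
  shows "integrable lborel f"
proof (rule Bochner_Integration.integrable_bound)
  show "integrable lborel (\<lambda>t. C * inverse (1 + t\<^sup>2))"
    by (intro integrable_mult_right integrable_Cauchy_density)
  show "AE t in lborel. norm (f t) \<le> norm (C * inverse (1 + t\<^sup>2))"
    using assms(2) by (intro AE_I2) (rule order_trans, assumption, simp)
qed (use assms(1) in simp)

text \<open>The substitution is \<open>arctan t / pi\<close> for the circle parameter. Boundedness
  of f on the circle and the density of \<open>arctan\<close> give integrability on the whole
  line.\<close>

lemma circ_int_eq_line:
  assumes f: "continuous_on half_circle f"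
  shows "circ_int f = (LINT t|lborel. f (1 / eta t) / (eta t)\<^sup>2) / (2 * of_real pi)"
proof -
  define \<gamma> where "\<gamma> = circlepath (1/2 :: complex) (1/2)"
  define F where "F = (\<lambda>t. f (\<gamma> t) * (of_real pi * \<i> * exp (2 * of_real pi * \<i> * of_real t)))"
  have g_circle: "\<gamma> t \<in> half_circle" for t
    by (simp add: \<gamma>_def circlepath dist_norm norm_mult)
  have contF: "continuous_on A F" for A
    unfolding F_def
  proof (intro continuous_intros continuous_on_compose2[OF f])
    show "continuous_on A \<gamma>"
      unfolding \<gamma>_def circlepath by (intro continuous_intros)
    show "\<gamma> ` A \<subseteq> half_circle"
      using g_circle by auto
  qed
  \<comment> \<open>Periodicity moves the parameter interval from [0,1] to [-1/2,1/2]; its end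
    points are then the parameters of the point 0, which corresponds to infinity on the
    line.\<close>
  have per: "F (t + 1) = F t" for t
  proof -
    have "exp (2 * of_real pi * \<i> * of_real (t + 1)) = exp (2 * of_real pi * \<i> * of_real t)"
      by (simp add: distrib_left exp_add)
    then show ?thesis
      by (simp only: F_def \<gamma>_def circlepath)
  qed
  have intF: "F integrable_on {a..b}" for a b
    by (rule integrable_continuous_real[OF contF])
  have "contour_integral \<gamma> f = integral {0..1} F"
    unfolding contour_integral_integral F_def \<gamma>_def vector_derivative_circlepath by simp
  also have "\<dots> = integral {0..1/2} F + integral {1/2..1} F"
    by (rule Henstock_Kurzweil_Integration.integral_combine[symmetric]) (use intF in auto)
  also have "integral {1/2..1} F = integral {-1/2..0} (\<lambda>t. F (t + 1))"
    using integral_shift_Icc_real[of "-1/2" 0 F 1] by (simp add: o_def add.commute)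
  also have "integral {0..1/2} F + integral {-1/2..0} (\<lambda>t. F (t + 1)) = integral {-1/2..1/2} F"
    unfolding per by (subst add.commute, rule Henstock_Kurzweil_Integration.integral_combine) (use intF in auto)
  also have "\<dots> = (LBINT t=ereal (-1/2)..ereal (1/2). F t)"
    by (subst interval_integral_eq_integral) (auto intro!: borel_integrable_atLeastAtMost' contF)
  also have "\<dots> = (LBINT t=-\<infinity>..\<infinity>. (inverse (1 + t\<^sup>2) / pi) *\<^sub>R F (arctan t / pi))"
  proof (rule interval_integral_substitution_integrable)
    show "DERIV (\<lambda>t. arctan t / pi) x :> inverse (1 + x\<^sup>2) / pi" for x
      by (auto intro!: derivative_eq_intros simp: divide_inverse)
    show "isCont F (arctan x / pi)" for x
      using contF[of UNIV] by (simp add: continuous_on_eq_continuous_at)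
    show "isCont (\<lambda>t. inverse (1 + t\<^sup>2) / pi) x" for x :: real
      by (intro continuous_intros) (auto simp: add_nonneg_eq_0_iff)
    show "((ereal \<circ> (\<lambda>t. arctan t / pi) \<circ> real_of_ereal) \<longlongrightarrow> ereal (-1/2)) (at_right (-\<infinity>))"
      unfolding ereal_tendsto_simps
      by (rule tendsto_eq_intros tendsto_arctan_at_bot refl | simp)+
    show "((ereal \<circ> (\<lambda>t. arctan t / pi) \<circ> real_of_ereal) \<longlongrightarrow> ereal (1/2)) (at_left \<infinity>)"
      unfolding ereal_tendsto_simps
      by (rule tendsto_eq_intros tendsto_arctan_at_top refl | simp)+
    show "set_integrable lborel (einterval (ereal (- 1 / 2)) (ereal (1 / 2))) F"
      by (rule set_integrable_subset[OF borel_integrable_atLeastAtMost'[OF contF[of "{-1/2..1/2}"]]])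
         (auto simp: einterval_def)
    have "compact (F ` {-1/2..1/2})"
      by (rule compact_continuous_image[OF contF]) simp
    then obtain C where C: "norm (F t) \<le> C" if "t \<in> {-1/2..1/2}" for t
      using compact_imp_bounded bounded_iff by (metis imageI)
    have "integrable lborel (\<lambda>t. (inverse (1 + t\<^sup>2) / pi) *\<^sub>R F (arctan t / pi))"
    proof (rule integrable_Cauchy_bound)
      have "continuous_on UNIV (\<lambda>t. (inverse (1 + t\<^sup>2) / pi) *\<^sub>R F (arctan t / pi))"
        by (intro continuous_intros continuous_on_compose2[OF contF[of UNIV]])
           (auto simp: add_nonneg_eq_0_iff)
      then show "(\<lambda>t. (inverse (1 + t\<^sup>2) / pi) *\<^sub>R F (arctan t / pi)) \<in> borel_measurable borel"
        by (rule borel_measurable_continuous_onI)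
      fix t
      have "arctan t / pi \<in> {-1/2..1/2}"
        using arctan_bounded[of t] by (auto simp: field_simps)
      then have "norm (F (arctan t / pi)) \<le> C" by (rule C)
      then have "inverse (1 + t\<^sup>2) / pi * norm (F (arctan t / pi)) \<le> inverse (1 + t\<^sup>2) / pi * C"
        by (intro mult_left_mono) auto
      then show "norm ((inverse (1 + t\<^sup>2) / pi) *\<^sub>R F (arctan t / pi)) \<le> C / pi * inverse (1 + t\<^sup>2)"
        by (simp add: mult_ac)
    qed
    then show "set_integrable lborel (einterval (-\<infinity>) \<infinity>) (\<lambda>t. (inverse (1 + t\<^sup>2) / pi) *\<^sub>R F (arctan t / pi))"
      by (simp add: set_integrable_def einterval_def)
  qed auto
  also have "\<dots> = (LINT t|lborel. (inverse (1 + t\<^sup>2) / pi) *\<^sub>R F (arctan t / pi))"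
    by (simp add: interval_lebesgue_integral_def einterval_def set_lebesgue_integral_def)
  also have "\<dots> = (LINT t|lborel. \<i> * (f (1 / eta t) / (eta t)\<^sup>2))"
  proof (intro Bochner_Integration.integral_cong refl)
    fix t
    have n: "of_real (1 + t\<^sup>2) = cnj (eta t) * eta t"
      by (simp add: complex_eq_iff eta_def power2_eq_square)
    have "\<gamma> (arctan t / pi) = 1/2 + 1/2 * (cnj (eta t) / eta t)"
      unfolding \<gamma>_def circlepath exp_arctan by simp
    also have "\<dots> = 1 / eta t"
    proof -
      have "eta t + cnj (eta t) = 2" by (simp add: complex_eq_iff)
      then show ?thesis by (simp add: field_simps)
    qed
    finally have "(inverse (1 + t\<^sup>2) / pi) *\<^sub>R F (arctan t / pi)
       = inverse (of_real (1 + t\<^sup>2)) / of_real pi * (f (1 / eta t) * (of_real pi * \<i> * (cnj (eta t) / eta t)))"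
      unfolding F_def exp_arctan scaleR_conv_of_real by simp
    also have "\<dots> = \<i> * (f (1 / eta t) / (eta t)\<^sup>2)"
      unfolding n by (simp add: field_simps power2_eq_square)
    finally show "(inverse (1 + t\<^sup>2) / pi) *\<^sub>R F (arctan t / pi) = \<i> * (f (1 / eta t) / (eta t)\<^sup>2)" .
  qed
  also have "\<dots> = \<i> * (LINT t|lborel. f (1 / eta t) / (eta t)\<^sup>2)"
    by (rule integral_mult_right_zero)
  finally show ?thesis
    unfolding circ_int_def \<gamma>_def by simp
qed

definition line_int :: "complex poly \<Rightarrow> int \<Rightarrow> complex" where
  "line_int A m = (LINT t|lborel. eta t powi (m - 1) / poly A (eta t)) / (2 * of_real pi)"

text \<open>Inversion replaces the polynomial by its reflection, which is \<open>A\<close> times the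
  product of the \<open>Y j\<close>. That product cancels between coefficients and integrals, and
  the top coefficients become the bottom coefficients of \<open>A\<close>.\<close>

lemma gap_kernel_line:
  fixes X Y :: "nat \<Rightarrow> complex"
  assumes X: "\<And>i. i < n \<Longrightarrow> X i \<in> ball (1/2) (1/2)"
    and Y: "\<And>j w. j \<in> {1..k} \<Longrightarrow> w \<in> half_disc \<Longrightarrow> 1 + Y j * w \<noteq> 0"
    and Y0: "\<And>j. j \<in> {1..k} \<Longrightarrow> Y j \<noteq> 0"
    and d: "d \<le> n" "d \<le> k" and r: "r < d" and s: "s < d"
  defines "A \<equiv> factor_poly (\<lambda>j. 1 / Y j) k * (\<Prod>i<n. [:1, - X i:])"
  shows "gap_kernel X Y n k d r s
    = (\<Sum>l\<le>d - 1 - r. coeff A l * line_int A (int l + int r - int s))"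
proof -
  let ?V = "factor_poly Y k * node_poly X n"
  let ?y = "\<Prod>j=1..k. Y j"
  have y0: "?y \<noteq> 0"
    using Y0 by (auto simp: prod_zero_iff)
  have "degree (factor_poly Y k) = k"
    by (subst degree_prod_eq_sum_degree) (use Y0 in auto)
  moreover have "degree (node_poly X n) = n"
    by (subst degree_prod_eq_sum_degree) auto
  moreover have "factor_poly Y k \<noteq> 0" "node_poly X n \<noteq> 0"
    by (auto simp: prod_zero_iff)
  ultimately have degV: "degree ?V = k + n"
    by (metis degree_mult_eq)
  have "reflect_poly ?V = (\<Prod>j=1..k. [:Y j, 1:]) * (\<Prod>i<n. [:1, - X i:])"
  proof -
    have "reflect_poly [:1, Y j:] = [:Y j, 1:]" if "j \<in> {1..k}" for j
      using Y0[OF that] by (simp add: reflect_poly_def)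
    moreover have "reflect_poly [:- X i, 1:] = [:1, - X i:]" for i
      by (simp add: reflect_poly_def)
    ultimately show ?thesis
      by (simp only: reflect_poly_mult reflect_poly_prod cong: prod.cong)
  qed
  also have "(\<Prod>j=1..k. [:Y j, 1:]) = (\<Prod>j=1..k. Polynomial.smult (Y j) [:1, 1 / Y j:])"
    using Y0 by (intro prod.cong) auto
  also have "\<dots> = Polynomial.smult ?y (factor_poly (\<lambda>j. 1 / Y j) k)"
    by (rule prod_smult)
  finally have reflV: "reflect_poly ?V = Polynomial.smult ?y A"
    by (simp add: A_def)
  have coeffV: "coeff ?V (k + n - l) = ?y * coeff A l" if "l \<le> k + n" for l
  proof -
    have "coeff (reflect_poly ?V) l = coeff ?V (k + n - l)"
      unfolding coeff_reflect_poly degV using that by simp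
    then show ?thesis
      unfolding reflV by simp
  qed
  \<comment> \<open>The exponent collects k + n from the reflection, - e from the power and - 2 from
    the differential; \<open>line_int\<close> subtracts 1 itself, which leaves k + n - e - 1 as its
    index.\<close>
  have ci: "circ_int (\<lambda>w. w ^ e / poly ?V w) = line_int A (int (k + n) - int e - 1) / ?y" for e
  proof -
    have "continuous_on half_circle (\<lambda>w. w ^ e / poly ?V w)"
      using factor_poly_neq_0[OF X Y d] node_poly_neq_0[OF X Y d]
      by (intro continuous_intros) (auto simp: sphere_cball subset_iff)
    then have "circ_int (\<lambda>w. w ^ e / poly ?V w)
      = (LINT t|lborel. (1 / eta t) ^ e / poly ?V (1 / eta t) / (eta t)\<^sup>2) / (2 * of_real pi)"
      by (rule circ_int_eq_line)
    also have "(\<lambda>t. (1 / eta t) ^ e / poly ?V (1 / eta t) / (eta t)\<^sup>2)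
        = (\<lambda>t. (1 / ?y) * (eta t powi (int (k + n) - int e - 1 - 1) / poly A (eta t)))"
    proof
      fix t
      let ?h = "eta t"
      have "?h ^ (k + n) * poly ?V (1 / ?h) = ?y * poly A ?h"
        using poly_reflect_poly_nz[of ?h ?V] unfolding degV reflV inverse_eq_divide by simp
      then have V: "poly ?V (1 / ?h) = ?y * poly A ?h / ?h ^ (k + n)"
        by (simp add: eq_divide_eq mult.commute)
      have "?h powi (int (k + n) - int e - 1 - 1) = ?h powi (int (k + n) - int (e + 2))"
        by (rule arg_cong) simp
      also have "\<dots> = ?h ^ (k + n) / ?h ^ (e + 2)"
        by (subst power_int_diff) (simp_all only: power_int_of_nat eta_neq_0 simp_thms)
      finally show "(1 / ?h) ^ e / poly ?V (1 / ?h) / ?h\<^sup>2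
          = (1 / ?y) * (?h powi (int (k + n) - int e - 1 - 1) / poly A ?h)"
        unfolding V by (simp add: power_one_over power_add power2_eq_square)
    qed
    also have "(LINT t|lborel. (1 / ?y) * (eta t powi (int (k + n) - int e - 1 - 1) / poly A (eta t)))
        = (1 / ?y) * (LINT t|lborel. eta t powi (int (k + n) - int e - 1 - 1) / poly A (eta t))"
      by (rule integral_mult_right_zero)
    finally show ?thesis
      by (simp add: line_int_def)
  qed
  have "gap_kernel X Y n k d r s = (\<Sum>t<d - r. coeff ?V (Suc (n + (k - d) + r + t)) *
      circ_int (\<lambda>w. w ^ (n + (k - d) + s + t) / poly ?V w))"
    by (rule gap_kernel_def[OF X Y d])
  also have "\<dots> = (\<Sum>t<d - r. coeff A (d - 1 - r - t) * line_int A (int (d - 1 - r - t) + int r - int s))"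
  proof (rule sum.cong[OF refl])
    fix t assume "t \<in> {..<d - r}"
    then have t: "t < d - r" by simp
    have "Suc (n + (k - d) + r + t) = k + n - (d - 1 - r - t)"
      using t d r by linarith
    then have 1: "coeff ?V (Suc (n + (k - d) + r + t)) = ?y * coeff A (d - 1 - r - t)"
      using d coeffV[of "d - 1 - r - t"] by simp
    have 2: "int (k + n) - int (n + (k - d) + s + t) - 1 = int (d - 1 - r - t) + int r - int s"
      using t d r by linarith
    show "coeff ?V (Suc (n + (k - d) + r + t)) * circ_int (\<lambda>w. w ^ (n + (k - d) + s + t) / poly ?V w)
        = coeff A (d - 1 - r - t) * line_int A (int (d - 1 - r - t) + int r - int s)"
      unfolding 1 ci 2 using y0 by simp
  qed
  also have "\<dots> = (\<Sum>l\<le>d - 1 - r. coeff A l * line_int A (int l + int r - int s))"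
    using r by (intro sum.reindex_bij_witness[where i = "\<lambda>l. d - 1 - r - l" and j = "\<lambda>t. d - 1 - r - t"]) auto
  finally show ?thesis .
qed

subsection \<open>Hankel integrals\<close>

text \<open>With s = \<eta>^2 this is half of Hankel's integral for 1 / \<Gamma>(1 - m/2); the shift
  m - 1 in the exponent makes that argument come out.\<close>

definition hankel :: "int \<Rightarrow> complex" where
  "hankel m = (LINT t|lborel. eta t powi (m - 1) * exp ((eta t)\<^sup>2)) / (2 * of_real pi)"

lemma norm_exp_eta: "norm (exp ((eta t)\<^sup>2)) = exp (1 - t\<^sup>2)"
  by (simp add: norm_exp_eq_Re power2_eq_square eta_def)

lemma continuous_eta: "continuous_on A eta"
  unfolding eta_def by (intro continuous_intros)

lemma norm_eta_ge_1: "1 \<le> norm (eta t)"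
  using complex_Re_le_cmod[of "eta t"] by simp

lemma norm_eta_power_le:
  assumes "m \<le> int q"
  shows "norm (eta t powi m) \<le> (norm (eta t)) ^ q"
  unfolding norm_power_int power_int_of_nat[symmetric]
  by (rule power_int_increasing[OF assms norm_eta_ge_1])

lemma power_le_exp: "0 \<le> (x::real) \<Longrightarrow> x ^ n \<le> fact n * exp x"
proof -
  assume "0 \<le> x"
  have "x ^ n / fact n \<le> (\<Sum>k. x ^ k / fact k)"
    using sum_le_suminf[OF summable_exp_generic[of x], of "{n}"] \<open>0 \<le> x\<close>
    by (simp add: divide_inverse mult.commute)
  also have "\<dots> = exp x"
    by (simp add: exp_def divide_inverse mult.commute scaleR_conv_of_real)
  finally show ?thesis
    by (simp add: field_simps)
qed

text \<open>One power of 1 + t^2 more than required is absorbed by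
  \<open>fact (?q + 1) * exp (1 + t^2)\<close>; against exp (1 - t^2) only the constant exp 2
  remains.\<close>

lemma hankel_bound: "\<exists>C. \<forall>t. norm (eta t powi m * exp ((eta t)\<^sup>2)) \<le> C * inverse (1 + t\<^sup>2)"
proof (intro exI allI)
  fix t :: real
  let ?q = "nat (max m 0)"
  have u: "0 < 1 + t\<^sup>2" by (simp add: add_pos_nonneg)
  have "norm (eta t powi m) \<le> norm (eta t) ^ ?q"
    by (rule norm_eta_power_le) simp
  also have "\<dots> \<le> norm (eta t) ^ (2 * ?q)"
    by (rule power_increasing) (use norm_eta_ge_1 in auto)
  also have "\<dots> = (1 + t\<^sup>2) ^ ?q"
    by (simp only: power_mult norm_eta_squared)
  finally have "norm (eta t powi m * exp ((eta t)\<^sup>2)) \<le> (1 + t\<^sup>2) ^ ?q * exp (1 - t\<^sup>2)"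
    unfolding norm_mult norm_exp_eta by (rule mult_right_mono) simp
  also have "\<dots> = (1 + t\<^sup>2) ^ (?q + 1) * exp (1 - t\<^sup>2) * inverse (1 + t\<^sup>2)"
    using u by (simp add: field_simps)
  also have "\<dots> \<le> (fact (?q + 1) * exp (1 + t\<^sup>2)) * exp (1 - t\<^sup>2) * inverse (1 + t\<^sup>2)"
    using u by (intro mult_right_mono power_le_exp) auto
  also have "\<dots> = fact (?q + 1) * exp 2 * inverse (1 + t\<^sup>2)"
    by (simp add: mult.assoc exp_add[symmetric])
  finally show "norm (eta t powi m * exp ((eta t)\<^sup>2)) \<le> (fact (?q + 1) * exp 2) * inverse (1 + t\<^sup>2)" .
qed

lemma continuous_hankel: "continuous_on UNIV (\<lambda>t. eta t powi m * exp ((eta t)\<^sup>2))"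
  by (intro continuous_intros continuous_eta) auto

lemma hankel_integrable: "integrable lborel (\<lambda>t. eta t powi m * exp ((eta t)\<^sup>2))"
proof -
  obtain C where "\<And>t. norm (eta t powi m * exp ((eta t)\<^sup>2)) \<le> C * inverse (1 + t\<^sup>2)"
    using hankel_bound by blast
  then show ?thesis
    by (intro integrable_Cauchy_bound borel_measurable_continuous_onI continuous_hankel)
qed

text \<open>Integrate the derivative of \<eta>^m exp \<eta>^2 along the line; the boundary terms
  vanish. The factor \<i> in \<open>F\<close> compensates for the derivative of
  \<open>eta\<close>.\<close>

lemma hankel_rec: "of_int m * hankel m + 2 * hankel (m + 2) = 0"
proof -
  define F where "F = (\<lambda>t. \<i> * (eta t powi m * exp ((eta t)\<^sup>2)))"
  define G where "G = (\<lambda>t. of_int m * (eta t powi (m - 1) * exp ((eta t)\<^sup>2)) + 2 * (eta t powi (m + 2 - 1) * exp ((eta t)\<^sup>2)))"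
  have int: "integrable lborel G"
    unfolding G_def by (intro Bochner_Integration.integrable_add integrable_mult_right hankel_integrable)
  have der: "(F has_vector_derivative G t) (at t)" for t
  proof -
    have "((\<lambda>z. \<i> * (z powi m * exp (z\<^sup>2))) has_field_derivative
        \<i> * (of_int m * z powi (m - 1) * exp (z\<^sup>2) + z powi m * (2 * z * exp (z\<^sup>2)))) (at z)" if "z \<noteq> 0" for z
      using that by (auto intro!: derivative_eq_intros)
    moreover have "(eta has_vector_derivative - \<i>) (at t)"
      unfolding eta_def by (auto intro!: derivative_eq_intros simp: has_vector_derivative_def scaleR_conv_of_real mult.commute)
    ultimately have "((\<lambda>z. \<i> * (z powi m * exp (z\<^sup>2))) \<circ> eta has_vector_derivative
       (- \<i>) * (\<i> * (of_int m * eta t powi (m - 1) * exp ((eta t)\<^sup>2) + eta t powi m * (2 * eta t * exp ((eta t)\<^sup>2))))) (at t)"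
      by (intro field_vector_diff_chain_at) auto
    moreover have "eta t powi (m + 2 - 1) = eta t powi m * eta t"
      using power_int_add_1[of "eta t" m] by (simp add: add.commute)
    ultimately show ?thesis
      by (simp add: F_def G_def o_def mult_ac add.commute)
  qed
  have lim: "(F \<longlongrightarrow> 0) at_top" "(F \<longlongrightarrow> 0) at_bot"
  proof -
    obtain C where C: "\<And>t. norm (eta t powi m * exp ((eta t)\<^sup>2)) \<le> C * inverse (1 + t\<^sup>2)"
      using hankel_bound by blast
    have b: "\<forall>\<^sub>F t in E. norm (F t) \<le> C * inverse (1 + t\<^sup>2)" for E
      using C by (simp add: F_def norm_mult)
    have l: "((\<lambda>t. C * inverse (1 + t\<^sup>2)) \<longlongrightarrow> 0) at_top" "((\<lambda>t. C * inverse (1 + t\<^sup>2)) \<longlongrightarrow> 0) at_bot"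
      by real_asymp+
    show "(F \<longlongrightarrow> 0) at_top" "(F \<longlongrightarrow> 0) at_bot"
      using Lim_null_comparison[OF b l(1)] Lim_null_comparison[OF b l(2)] by simp_all
  qed
  have "(LBINT t=-\<infinity>..\<infinity>. G t) = 0 - 0"
  proof (rule interval_integral_FTC_integrable)
    show "(F has_vector_derivative G t) (at t)" for t by (rule der)
    show "isCont G t" for t
      using continuous_eta[of UNIV] unfolding G_def
      by (intro continuous_intros) (simp_all add: continuous_on_eq_continuous_at)
    show "set_integrable lborel (einterval (-\<infinity>) \<infinity>) G"
      using int by (simp add: set_integrable_def einterval_def)
    show "((F \<circ> real_of_ereal) \<longlongrightarrow> 0) (at_right (-\<infinity>))" "((F \<circ> real_of_ereal) \<longlongrightarrow> 0) (at_left \<infinity>)"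
      using lim by (simp_all add: ereal_tendsto_simps)
  qed simp
  then have "(LINT t|lborel. G t) = 0"
    by (simp add: interval_lebesgue_integral_def einterval_def set_lebesgue_integral_def)
  moreover have "(LINT t|lborel. G t) = of_int m * (LINT t|lborel. eta t powi (m - 1) * exp ((eta t)\<^sup>2))
      + 2 * (LINT t|lborel. eta t powi (m + 2 - 1) * exp ((eta t)\<^sup>2))"
    unfolding G_def by (subst Bochner_Integration.integral_add) (auto intro!: integrable_mult_right hankel_integrable)
  ultimately have "of_int m * (LINT t|lborel. eta t powi (m - 1) * exp ((eta t)\<^sup>2))
      + 2 * (LINT t|lborel. eta t powi (m + 2 - 1) * exp ((eta t)\<^sup>2)) = 0"
    by simp
  then show ?thesis
    unfolding hankel_def times_divide_eq_right add_divide_distrib[symmetric] by (simp only: div_0)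
qed

text \<open>After x = sqrt 2 t, the exponential is, up to a constant, the standard normal density
  times a character, so its integral is the known characteristic function.\<close>

lemma gaussian_line_integral:
  "(LINT t|lborel. exp ((eta t)\<^sup>2 - of_real u * eta t)) = of_real (sqrt pi * exp (- u\<^sup>2 / 4))"
proof -
  \<comment> \<open>The imaginary part of the exponent is (u - 2) t; the rescaling of t by sqrt 2
    divides the frequency by sqrt 2.\<close>
  define s where "s = (u - 2) / sqrt 2"
  have "char std_normal_distribution s = of_real (exp (- (s^2) / 2))"
    by (simp add: char_std_normal_distribution)
  moreover have "char std_normal_distribution s = (LINT x|lborel. of_real (std_normal_density x) * iexp (s * x))"
    unfolding char_def by (subst integral_density) (auto simp: normal_density_nonneg scaleR_conv_of_real)
  ultimately have 1: "(LINT x|lborel. of_real (std_normal_density x) * iexp (s * x)) = of_real (exp (- (s^2) / 2))"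
    by simp
  have "(LINT x|lborel. of_real (std_normal_density x) * iexp (s * x))
    = sqrt 2 *\<^sub>R (LINT t|lborel. of_real (std_normal_density (0 + sqrt 2 * t)) * iexp (s * (0 + sqrt 2 * t)))"
    by (subst lborel_integral_real_affine[of "sqrt 2" _ 0]) simp_all
  also have "(LINT t|lborel. of_real (std_normal_density (0 + sqrt 2 * t)) * iexp (s * (0 + sqrt 2 * t)))
    = (LINT t|lborel. (of_real (exp (u - 1) / sqrt (2 * pi))) * exp ((eta t)\<^sup>2 - of_real u * eta t))"
  proof (intro Bochner_Integration.integral_cong refl)
    fix t
    have "std_normal_density (0 + sqrt 2 * t) = exp (- t\<^sup>2) / sqrt (2 * pi)"
      by (simp add: std_normal_density_def power_mult_distrib)
    moreover have "iexp (s * (0 + sqrt 2 * t)) = exp (\<i> * of_real ((u - 2) * t))"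
      by (simp add: s_def)
    moreover have "of_real (exp (- t\<^sup>2)) * exp (\<i> * of_real ((u - 2) * t))
        = of_real (exp (u - 1)) * exp ((eta t)\<^sup>2 - of_real u * eta t)"
      by (simp add: exp_of_real[symmetric] exp_add[symmetric] eta_def power2_eq_square algebra_simps)
    ultimately show "of_real (std_normal_density (0 + sqrt 2 * t)) * iexp (s * (0 + sqrt 2 * t))
       = (of_real (exp (u - 1) / sqrt (2 * pi))) * exp ((eta t)\<^sup>2 - of_real u * eta t)"
      by simp
  qed
  also have "\<dots> = of_real (exp (u - 1) / sqrt (2 * pi)) * (LINT t|lborel. exp ((eta t)\<^sup>2 - of_real u * eta t))"
    by (rule integral_mult_right_zero)
  finally have 2: "of_real (sqrt 2 * exp (u - 1) / sqrt (2 * pi)) * (LINT t|lborel. exp ((eta t)\<^sup>2 - of_real u * eta t))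
      = of_real (exp (- (s^2) / 2))"
    unfolding 1 by (simp add: scaleR_conv_of_real mult_ac)
  have a: "sqrt 2 * exp (u - 1) / sqrt (2 * pi) = exp (u - 1) / sqrt pi"
    by (simp add: real_sqrt_mult)
  have b: "sqrt pi * exp (- u\<^sup>2 / 4) = exp (- (s^2) / 2) / (exp (u - 1) / sqrt pi)"
  proof -
    have "s\<^sup>2 = (u - 2)\<^sup>2 / 2" by (simp add: s_def power_divide)
    then have "- (s^2) / 2 = - u\<^sup>2 / 4 + (u - 1)"
      by (simp add: power2_eq_square field_simps)
    then have "exp (- (s^2) / 2) = exp (- u\<^sup>2 / 4) * exp (u - 1)"
      by (simp only: exp_add)
    then show ?thesis by (simp add: field_simps)
  qed
  have "of_real (exp (u - 1) / sqrt pi) \<noteq> (0 :: complex)" by simp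
  then have "(LINT t|lborel. exp ((eta t)\<^sup>2 - of_real u * eta t))
      = of_real (exp (- (s^2) / 2)) / of_real (exp (u - 1) / sqrt pi)"
    using 2 unfolding a by (metis nonzero_mult_div_cancel_left)
  then show ?thesis
    unfolding b by (simp only: of_real_divide)
qed

lemma hankel_1: "hankel 1 = of_real (1 / (2 * sqrt pi))"
proof -
  have "hankel 1 = of_real (sqrt pi) / (2 * of_real pi)"
    using gaussian_line_integral[of 0] by (simp add: hankel_def)
  also have "of_real (sqrt pi) / (2 * of_real pi) = (of_real (sqrt pi / (2 * pi)) :: complex)"
    by simp
  also have "sqrt pi / (2 * pi) = 1 / (2 * sqrt pi)"
    by (simp add: field_simps)
  finally show ?thesis .
qed

lemma exp_half_line:
  fixes a :: real
  assumes "0 < a"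
  shows "integrable lborel (\<lambda>u. indicator {0<..} u * exp (- u * a))"
    and "(LINT u|lborel. indicator {0<..} u * exp (- u * a)) = 1 / a"
proof -
  have der: "((\<lambda>u. - exp (- u * a) / a) has_real_derivative exp (- u * a)) (at u)" for u
    using assms by (auto intro!: derivative_eq_intros)
  have lim0: "(((\<lambda>u. - exp (- u * a) / a) \<circ> real_of_ereal) \<longlongrightarrow> - 1 / a) (at_right 0)"
    using assms by (auto simp: zero_ereal_def ereal_tendsto_simps intro!: tendsto_eq_intros)
  have "((\<lambda>u. - exp (- u * a) / a) \<longlongrightarrow> 0) at_top"
    using assms by real_asymp
  then have lim1: "(((\<lambda>u. - exp (- u * a) / a) \<circ> real_of_ereal) \<longlongrightarrow> 0) (at_left \<infinity>)"
    by (simp add: ereal_tendsto_simps)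
  have e: "einterval 0 \<infinity> = {0<..}"
    by (auto simp: einterval_def)
  have "set_integrable lborel (einterval 0 \<infinity>) (\<lambda>u. exp (- u * a))"
    by (rule interval_integral_FTC_nonneg(1)[OF _ der _ _ lim0 lim1]) auto
  then show "integrable lborel (\<lambda>u. indicator {0<..} u * exp (- u * a))"
    by (simp add: set_integrable_def e)
  have "(LBINT u=0..\<infinity>. exp (- u * a)) = 0 - (- 1 / a)"
    by (rule interval_integral_FTC_nonneg(2)[OF _ der _ _ lim0 lim1]) auto
  then show "(LINT u|lborel. indicator {0<..} u * exp (- u * a)) = 1 / a"
    by (simp add: interval_lebesgue_integral_def set_lebesgue_integral_def e)
qed

lemma laplace_exp:
  assumes "0 < Re z"
  shows "integrable lborel (\<lambda>u. indicator {0<..} u *\<^sub>R exp (- of_real u * z))"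
    and "(LINT u|lborel. indicator {0<..} u *\<^sub>R exp (- of_real u * z)) = 1 / z"
proof -
  have z: "z \<noteq> 0" using assms by auto
  have e: "einterval 0 \<infinity> = {0<..}"
    by (auto simp: einterval_def)
  have n: "norm (exp (- of_real u * z)) = exp (- u * Re z)" for u
    by (simp add: norm_exp_eq_Re)
  show int: "integrable lborel (\<lambda>u. indicator {0<..} u *\<^sub>R exp (- of_real u * z))"
  proof (rule Bochner_Integration.integrable_bound[OF exp_half_line(1)[OF assms]])
    show "AE u in lborel. norm (indicator {0<..} u *\<^sub>R exp (- of_real u * z))
        \<le> norm (indicator {0<..} u * exp (- u * Re z))"
      by (intro AE_I2) (simp add: n indicator_def)
  qed simp
  have der: "((\<lambda>u. - exp (- of_real u * z) / z) has_vector_derivative exp (- of_real u * z)) (at u)" for u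
  proof -
    have "((\<lambda>w. - exp (- w * z) / z) has_field_derivative exp (- of_real u * z)) (at (of_real u))"
      using z by (auto intro!: derivative_eq_intros)
    then show ?thesis
      using has_vector_derivative_real_field by blast
  qed
  have "(LBINT u=0..\<infinity>. exp (- of_real u * z)) = 0 - (- 1 / z)"
  proof (rule interval_integral_FTC_integrable)
    show "((\<lambda>u. - exp (- of_real u * z) / z) has_vector_derivative exp (- of_real u * z)) (at u)" for u
      by (rule der)
    show "isCont (\<lambda>u. exp (- of_real u * z)) u" for u
      by (intro continuous_intros)
    show "set_integrable lborel (einterval 0 \<infinity>) (\<lambda>u. exp (- of_real u * z))"
      using int by (simp add: set_integrable_def e)
    show "(((\<lambda>u. - exp (- of_real u * z) / z) \<circ> real_of_ereal) \<longlongrightarrow> - 1 / z) (at_right 0)"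
      using z by (auto simp: zero_ereal_def ereal_tendsto_simps intro!: tendsto_eq_intros)
    have "((\<lambda>u. - exp (- of_real u * z) / z) \<longlongrightarrow> 0) at_top"
    proof (rule Lim_null_comparison)
      show "\<forall>\<^sub>F u in at_top. norm (- exp (- of_real u * z) / z) \<le> exp (- u * Re z) / norm z"
        by (simp add: norm_divide norm_exp_eq_Re)
      show "((\<lambda>u. exp (- u * Re z) / norm z) \<longlongrightarrow> 0) at_top"
        using assms z by real_asymp
    qed
    then show "(((\<lambda>u. - exp (- of_real u * z) / z) \<circ> real_of_ereal) \<longlongrightarrow> 0) (at_left \<infinity>)"
      by (simp add: ereal_tendsto_simps)
  qed simp
  then show "(LINT u|lborel. indicator {0<..} u *\<^sub>R exp (- of_real u * z)) = 1 / z"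
    by (simp add: interval_lebesgue_integral_def set_lebesgue_integral_def e)
qed

lemma half_gaussian:
  "(LINT u|lborel. indicator {0<..} u * exp (- (u::real)\<^sup>2 / 4)) = sqrt pi"
proof -
  have "(LINT u|lborel. indicator {0<..} u * exp (- (u::real)\<^sup>2 / 4))
    = 2 * (LINT u|lborel. indicator {0<..} (0 + 2 * u) * exp (- (0 + 2 * (u::real))\<^sup>2 / 4))"
    by (subst lborel_integral_real_affine[of 2 _ 0]) simp_all
  also have "(LINT u|lborel. indicator {0<..} (0 + 2 * u) * exp (- (0 + 2 * (u::real))\<^sup>2 / 4))
    = (LINT u|lborel. indicator {0..} u *\<^sub>R exp (- u\<^sup>2))"
  proof (rule Bochner_Integration.integral_cong_AE)
    show "AE u in lborel. indicator {0<..} (0 + 2 * u) * exp (- (0 + 2 * (u::real))\<^sup>2 / 4) = indicator {0..} u *\<^sub>R exp (- u\<^sup>2)"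
      using AE_lborel_singleton[of 0] by eventually_elim (auto simp: indicator_def power2_eq_square)
  qed simp_all
  also have "\<dots> = sqrt pi / 2"
    using gaussian_moment_0 by (rule has_bochner_integral_integral_eq)
  finally show ?thesis by simp
qed

text \<open>At m = 0 the recursion loses its first term and cannot determine this value. The factor
  1 / \<eta> is written as the Laplace integral of exp (- u \<eta>) over u > 0; Fubini leaves a
  Gaussian integral in t and then half a Gaussian in u.\<close>

lemma hankel_0: "hankel 0 = 1 / 2"
proof -
  define h where "h = (\<lambda>t u. indicator {0<..} u *\<^sub>R exp ((eta t)\<^sup>2 - of_real u * eta t))"
  have h_eq: "h t u = exp ((eta t)\<^sup>2) * (indicator {0<..} u *\<^sub>R exp (- of_real u * eta t))" for t u
    by (simp add: h_def exp_diff exp_minus scaleR_conv_of_real divide_inverse)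
  have int_u: "integrable lborel (h t)" "(LINT u|lborel. h t u) = exp ((eta t)\<^sup>2) / eta t" for t
    unfolding h_eq using laplace_exp[of "eta t"]
    by (auto simp del: mult_minus_left scaleR_conv_of_real mult_scaleR_right intro!: integrable_mult_right)
  have norm_h: "norm (h t u) = exp (1 - t\<^sup>2) * (indicator {0<..} u * exp (- u))" for t u
  proof -
    have "norm (exp (- of_real u * eta t)) = exp (- u)"
      by (simp add: norm_exp_eq_Re)
    then show ?thesis
      unfolding h_eq norm_mult norm_exp_eta norm_scaleR by simp
  qed
  have norm_int: "(LINT u|lborel. norm (h t u)) = exp (1 - t\<^sup>2)" for t
    unfolding norm_h using exp_half_line(2)[of 1] by simp
  have cont: "continuous_on UNIV (\<lambda>p. exp ((eta (fst p))\<^sup>2 - of_real (snd p) * eta (fst p)))"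
    unfolding eta_def by (intro continuous_intros)
  have "integrable (lborel \<Otimes>\<^sub>M lborel) (\<lambda>p. h (fst p) (snd p))"
  proof (rule lborel_pair.Fubini_integrable)
    have "(\<lambda>p. exp ((eta (fst p))\<^sup>2 - of_real (snd p) * eta (fst p))) \<in> borel_measurable borel"
      by (rule borel_measurable_continuous_onI[OF cont])
    then have "(\<lambda>p. indicator {0<..} (snd p) *\<^sub>R exp ((eta (fst p))\<^sup>2 - of_real (snd p) * eta (fst p)))
        \<in> borel_measurable (borel \<Otimes>\<^sub>M borel)"
      unfolding borel_prod[symmetric] by simp
    then show "(\<lambda>p. h (fst p) (snd p)) \<in> borel_measurable (lborel \<Otimes>\<^sub>M lborel)"
      unfolding h_def by (simp cong: measurable_cong_sets add: sets_pair_measure_cong[OF sets_lborel sets_lborel])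
    have "integrable lborel (\<lambda>t. norm (eta t powi 0 * exp ((eta t)\<^sup>2)))"
      by (intro integrable_norm hankel_integrable)
    then show "integrable lborel (\<lambda>t. LINT u|lborel. norm (h (fst (t, u)) (snd (t, u))))"
      by (simp only: fst_conv snd_conv norm_int norm_exp_eta power_int_0_right mult_1)
    show "AE t in lborel. integrable lborel (\<lambda>u. h (fst (t, u)) (snd (t, u)))"
      using int_u by simp
  qed
  then have "(LINT u|lborel. (LINT t|lborel. h t u)) = (LINT t|lborel. (LINT u|lborel. h t u))"
    using lborel_pair.Fubini_integral[of h] by (simp add: case_prod_unfold)
  also have "\<dots> = (LINT t|lborel. eta t powi (0 - 1) * exp ((eta t)\<^sup>2))"
    by (simp add: int_u power_int_minus field_simps)
  finally have "(LINT t|lborel. eta t powi (0 - 1) * exp ((eta t)\<^sup>2)) = (LINT u|lborel. (LINT t|lborel. h t u))" ..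
  also have "\<dots> = (LINT u|lborel. of_real (sqrt pi * (indicator {0<..} u * exp (- u\<^sup>2 / 4))))"
    unfolding h_def by (intro Bochner_Integration.integral_cong refl)
      (simp add: gaussian_line_integral scaleR_conv_of_real)
  also have "\<dots> = of_real (LINT u|lborel. sqrt pi * (indicator {0<..} u * exp (- u\<^sup>2 / 4)))"
    by (rule integral_complex_of_real)
  also have "(LINT u|lborel. sqrt pi * (indicator {0<..} u * exp (- u\<^sup>2 / 4))) = pi"
    by (subst integral_mult_right_zero) (simp only: half_gaussian real_sqrt_mult_self abs_of_pos[OF pi_gt_zero])
  finally show ?thesis
    unfolding hankel_def by simp
qed

text \<open>Both sides satisfy the same two-step recursion, with seeds m = 0 and m = 1. The upward
  step is always possible; the downward step divides by m, and starting from 0 and from 1 it never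
  meets m = 0. \<open>rGamma\<close> is used since it is 0 at the poles of \<Gamma>.\<close>

lemma hankel_eq: "hankel m = of_real (rGamma (1 - of_int m / 2) / 2)"
proof -
  define R where "R = (\<lambda>m. hankel m = of_real (rGamma (1 - of_int m / 2) / 2))"
  have rec: "rGamma (1 - of_int (m + 2) / 2) = - (of_int m / 2) * rGamma (1 - of_int m / 2 :: real)" for m
    using rGamma_plus1[of "- of_int m / 2 :: real"] by (simp add: field_simps)
  have up: "R (m + 2)" if "R m" for m
  proof -
    have "hankel (m + 2) = of_real (- (of_int m / 2)) * hankel m"
      using hankel_rec[of m] by (simp add: field_simps add_eq_0_iff)
    also have "\<dots> = of_real (- (of_int m / 2) * (rGamma (1 - of_int m / 2) / 2))"
      using that unfolding R_def by (simp only: of_real_mult)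
    also have "- (of_int m / 2) * (rGamma (1 - of_int m / 2) / 2) = rGamma (1 - of_int (m + 2) / 2 :: real) / 2"
      unfolding rec by simp
    finally show ?thesis by (simp only: R_def)
  qed
  have down: "R m" if "R (m + 2)" "m \<noteq> 0" for m
  proof -
    have "of_int m * hankel m = - 2 * hankel (m + 2)"
      using hankel_rec[of m] by (simp add: eq_neg_iff_add_eq_0)
    also have "\<dots> = of_real (- 2 * (rGamma (1 - of_int (m + 2) / 2) / 2))"
      using that(1) by (simp only: R_def of_real_mult of_real_minus of_real_numeral)
    also have "- 2 * (rGamma (1 - of_int (m + 2) / 2) / 2) = of_int m * (rGamma (1 - of_int m / 2) / 2 :: real)"
      unfolding rec by simp
    finally have "of_int m * hankel m = of_int m * of_real (rGamma (1 - of_int m / 2) / 2)"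
      by (simp only: of_real_mult of_real_of_int_eq)
    then show ?thesis
      using that(2) unfolding R_def by (metis mult_cancel_left of_int_eq_0_iff)
  qed
  have "R 0" "R 1"
    unfolding R_def hankel_0 hankel_1
    by (simp_all add: rGamma_inverse_Gamma Gamma_one_half_real field_simps)
  have "R (2 * int i) \<and> R (1 + 2 * int i)" for i
    by (induction i) (use \<open>R 0\<close> \<open>R 1\<close> up[of "2 * int i" for i] up[of "1 + 2 * int i" for i] in \<open>auto simp: algebra_simps\<close>)
  moreover have "R (- 2 * int i) \<and> R (1 - 2 * int i)" for i
  proof (induction i)
    case (Suc i)
    then show ?case
      using down[of "- 2 * int (Suc i)"] down[of "1 - 2 * int (Suc i)"] by (auto simp: algebra_simps)
  qed (use \<open>R 0\<close> \<open>R 1\<close> in auto)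
  moreover have "\<exists>i. m = 2 * int i \<or> m = 1 + 2 * int i \<or> m = - 2 * int i \<or> m = 1 - 2 * int i"
  proof -
    obtain k where k: "m = 2 * k \<or> m = 1 + 2 * k"
      by (metis add.commute evenE oddE)
    show ?thesis
    proof (cases "0 \<le> k")
      case True
      then show ?thesis using k by (intro exI[of _ "nat k"]) auto
    next
      case False
      then show ?thesis using k by (intro exI[of _ "nat (- k)"]) auto
    qed
  qed
  ultimately have "R m" by blast
  then show ?thesis by (simp add: R_def)
qed

subsection \<open>Gaussian limit of the generating polynomials\<close>

text \<open>The remainder has derivative w^2 / (1 + w), which is at most 2 |z|^2 in norm on the disc
  of radius |z|.\<close>

lemma norm_Ln_quadratic_le:
  fixes z :: complex
  assumes "norm z \<le> 1/2"
  shows "norm (Ln (1 + z) - (z - z\<^sup>2 / 2)) \<le> 2 * norm z ^ 3"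
proof -
  let ?f = "\<lambda>w::complex. Ln (1 + w) - (w - w\<^sup>2 / 2)" and ?S = "cball 0 (norm z) :: complex set"
  have re: "1/2 \<le> Re (1 + w)" if "w \<in> ?S" for w
    using that assms abs_Re_le_cmod[of w] by simp
  have "norm (?f z - ?f 0) \<le> 2 * (norm z)\<^sup>2 * norm (z - 0)"
  proof (rule field_differentiable_bound)
    show "convex ?S" by simp
    show "(?f has_field_derivative w\<^sup>2 / (1 + w)) (at w within ?S)" if w: "w \<in> ?S" for w
    proof -
      have "1 + w \<notin> \<real>\<^sub>\<le>\<^sub>0"
        using re[OF w] by (auto simp: complex_nonpos_Reals_iff)
      moreover have "1 + w \<noteq> 0"
      proof
        assume e: "1 + w = 0"
        show False using re[OF w] unfolding e by simp
      qed
      moreover have "w\<^sup>2 / (1 + w) = 1 / (1 + w) - (1 - w)"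
        using calculation(2) by (simp add: field_simps power2_eq_square)
      ultimately show ?thesis
        by (auto intro!: derivative_eq_intros simp: inverse_eq_divide)
    qed
    show "norm (w\<^sup>2 / (1 + w)) \<le> 2 * (norm z)\<^sup>2" if w: "w \<in> ?S" for w
    proof -
      have "1/2 \<le> norm (1 + w)"
        using re[OF w] complex_Re_le_cmod[of "1 + w"] by linarith
      then have "norm w ^ 2 / norm (1 + w) \<le> norm z ^ 2 / (1/2)"
        using w by (intro frac_le power_mono) auto
      then show ?thesis by (simp add: norm_divide norm_power)
    qed
  qed auto
  then show ?thesis by (simp add: power2_eq_square power3_eq_cube mult_ac)
qed

text \<open>Bernoulli's inequality for exponents in [0,1], from the convexity of exp between 0 and
  ln (1 + x).\<close>

lemma one_plus_powr_le:
  fixes x a :: real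
  assumes "0 \<le> x" "0 \<le> a" "a \<le> 1"
  shows "(1 + x) powr a \<le> 1 + a * x"
proof -
  have "exp ((1 - a) *\<^sub>R 0 + a *\<^sub>R ln (1 + x)) \<le> (1 - a) * exp 0 + a * exp (ln (1 + x))"
    using assms by (intro convex_onD[OF exp_convex]) auto
  then show ?thesis
    using assms by (simp add: powr_def algebra_simps)
qed

text \<open>\<open>e\<close> lists elementary symmetric functions and the inner sums are power sums.
  The left side is a coefficient of the derivative of the product.\<close>

lemma newton_identity:
  fixes \<beta> :: "'a \<Rightarrow> 'b::idom"
  assumes "finite B"
  defines "e \<equiv> coeff (\<Prod>b\<in>B. [:1, \<beta> b:])"
  shows "of_nat (Suc s) * e (Suc s) = (\<Sum>i\<le>s. (-1) ^ i * (\<Sum>b\<in>B. \<beta> b ^ Suc i) * e (s - i))"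
proof -
  let ?P = "\<Prod>b\<in>B. [:1, \<beta> b:]"
  \<comment> \<open>Omitting one factor is division by 1 + \<beta> z, expanded as a geometric
    series.\<close>
  have D: "coeff (\<Prod>b\<in>B - {c}. [:1, \<beta> b:]) s = (\<Sum>i\<le>s. (- \<beta> c) ^ i * e (s - i))" if c: "c \<in> B" for c s
  proof -
    have "?P = [:1, \<beta> c:] * (\<Prod>b\<in>B - {c}. [:1, \<beta> b:])"
      by (rule prod.remove[OF assms(1) c])
    then have e: "e s = coeff (\<Prod>b\<in>B - {c}. [:1, \<beta> b:]) s + \<beta> c * coeff (pCons 0 (\<Prod>b\<in>B - {c}. [:1, \<beta> b:])) s" for s
      by (simp add: e_def coeff_pCons split: nat.split)
    show ?thesis
    proof (induction s)
      case 0
      then show ?case using e[of 0] by simp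
    next
      case (Suc s)
      have "coeff (\<Prod>b\<in>B - {c}. [:1, \<beta> b:]) (Suc s) = e (Suc s) - \<beta> c * (\<Sum>i\<le>s. (- \<beta> c) ^ i * e (s - i))"
        using e[of "Suc s"] by (simp add: Suc)
      also have "\<dots> = (\<Sum>i\<le>Suc s. (- \<beta> c) ^ i * e (Suc s - i))"
        by (subst sum.atMost_Suc_shift) (simp add: sum_distrib_left mult_ac sum_negf)
      finally show ?case .
    qed
  qed
  have "of_nat (Suc s) * e (Suc s) = coeff (pderiv ?P) s"
    by (simp add: coeff_pderiv e_def)
  also have "\<dots> = (\<Sum>c\<in>B. coeff (\<Prod>b\<in>B - {c}. [:1, \<beta> b:]) s * \<beta> c)"
    by (simp add: pderiv_prod coeff_sum pderiv_pCons mult.commute)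
  also have "\<dots> = (\<Sum>c\<in>B. \<Sum>i\<le>s. (-1) ^ i * \<beta> c ^ Suc i * e (s - i))"
    by (intro sum.cong refl) (simp add: D sum_distrib_left sum_distrib_right power_minus[of "\<beta> _"] mult_ac)
  also have "\<dots> = (\<Sum>i\<le>s. (-1) ^ i * (\<Sum>b\<in>B. \<beta> b ^ Suc i) * e (s - i))"
    by (subst sum.swap) (simp add: sum_distrib_left sum_distrib_right)
  finally show ?thesis .
qed

section \<open>Products of many small linear factors\<close>

context
  fixes B :: "nat \<Rightarrow> 'a set" and \<beta> :: "nat \<Rightarrow> 'a \<Rightarrow> real"
  assumes fin: "\<And>n. finite (B n)"
    and sum1: "(\<lambda>n. \<Sum>b\<in>B n. \<beta> n b) \<longlonglongrightarrow> 0"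
    and sum2: "\<forall>\<^sub>F n in sequentially. (\<Sum>b\<in>B n. (\<beta> n b)\<^sup>2) = 2"
    and small: "\<And>e. 0 < e \<Longrightarrow> \<forall>\<^sub>F n in sequentially. \<forall>b\<in>B n. \<bar>\<beta> n b\<bar> \<le> e"
begin

abbreviation "beta_poly n \<equiv> \<Prod>b\<in>B n. [:1, of_real (\<beta> n b):] :: complex poly"

lemma poly_beta_poly: "poly (beta_poly n) z = (\<Prod>b\<in>B n. 1 + of_real (\<beta> n b) * z)"
  by (simp add: poly_prod mult.commute)

text \<open>All but two powers of each \<beta> are estimated by the largest |\<beta>|; the remaining
  squares add up to 2.\<close>

lemma power_sums_small:
  assumes "3 \<le> p"
  shows "(\<lambda>n. \<Sum>b\<in>B n. \<bar>\<beta> n b\<bar> ^ p) \<longlonglongrightarrow> 0"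
proof (rule tendstoI)
  fix e :: real assume e: "0 < e"
  define d where "d = min 1 (e / 4)"
  have d: "0 < d" "d \<le> 1" "d \<le> e / 4" using e by (auto simp: d_def)
  show "\<forall>\<^sub>F n in sequentially. dist (\<Sum>b\<in>B n. \<bar>\<beta> n b\<bar> ^ p) 0 < e"
    using small[OF d(1)] sum2
  proof eventually_elim
    case (elim n)
    have "(\<Sum>b\<in>B n. \<bar>\<beta> n b\<bar> ^ p) \<le> (\<Sum>b\<in>B n. d * (\<beta> n b)\<^sup>2)"
    proof (rule sum_mono)
      fix b assume "b \<in> B n"
      then have b: "\<bar>\<beta> n b\<bar> \<le> d" using elim by blast
      have "p = (p - 2) + 2" using assms by simp
      then have "\<bar>\<beta> n b\<bar> ^ p = \<bar>\<beta> n b\<bar> ^ (p - 2) * \<bar>\<beta> n b\<bar>\<^sup>2"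
        by (metis power_add)
      also have "\<bar>\<beta> n b\<bar> ^ (p - 2) \<le> \<bar>\<beta> n b\<bar> ^ 1"
        using assms b d by (intro power_decreasing) auto
      finally show "\<bar>\<beta> n b\<bar> ^ p \<le> d * (\<beta> n b)\<^sup>2"
        using b by (simp add: mult_right_mono order_trans[OF _ mult_right_mono])
    qed
    also have "\<dots> = d * 2"
      using elim by (simp add: sum_distrib_left[symmetric])
    also have "\<dots> < e" using d e by simp
    finally show ?case
      by (simp add: sum_nonneg)
  qed
qed

text \<open>In the sum of logarithms the linear term vanishes in the limit, the quadratic one is
  exactly - z^2 because the squares add up to 2, and the third absolute power sum controls the
  rest.\<close>

lemma beta_poly_pointwise: "(\<lambda>n. poly (beta_poly n) z) \<longlonglongrightarrow> exp (- z\<^sup>2)"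
proof -
  define E where "E = (\<lambda>n. \<Sum>b\<in>B n. Ln (1 + of_real (\<beta> n b) * z))"
  have sm: "\<forall>\<^sub>F n in sequentially. \<forall>b\<in>B n. norm (of_real (\<beta> n b) * z) \<le> 1/2"
  proof -
    have "0 < 1 / (2 * (norm z + 1))" by (simp add: add_nonneg_pos)
    from small[OF this] show ?thesis
  proof eventually_elim
    case (elim n)
    show ?case
    proof
      fix b assume "b \<in> B n"
      then have "\<bar>\<beta> n b\<bar> * norm z \<le> 1 / (2 * (norm z + 1)) * (norm z + 1)"
        using elim by (intro mult_mono) (auto simp: add_nonneg_pos)
      also have "\<dots> = 1/2"
        by (simp add: field_simps add_nonneg_eq_0_iff)
      finally show "norm (of_real (\<beta> n b) * z) \<le> 1/2"
        by (simp add: norm_mult)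
    qed
  qed
  qed
  have "(\<lambda>n. E n - (of_real (\<Sum>b\<in>B n. \<beta> n b) * z - z\<^sup>2)) \<longlonglongrightarrow> 0"
  proof (rule Lim_null_comparison)
    show "\<forall>\<^sub>F n in sequentially. norm (E n - (of_real (\<Sum>b\<in>B n. \<beta> n b) * z - z\<^sup>2))
        \<le> 2 * norm z ^ 3 * (\<Sum>b\<in>B n. \<bar>\<beta> n b\<bar> ^ 3)"
      using sm sum2
    proof eventually_elim
      case (elim n)
      have "of_real (\<Sum>b\<in>B n. \<beta> n b) * z - z\<^sup>2
          = of_real (\<Sum>b\<in>B n. \<beta> n b) * z - of_real (\<Sum>b\<in>B n. (\<beta> n b)\<^sup>2) * z\<^sup>2 / 2"
        using elim by simp
      also have "\<dots> = (\<Sum>b\<in>B n. of_real (\<beta> n b) * z - (of_real (\<beta> n b) * z)\<^sup>2 / 2)"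
        by (simp add: sum_subtractf sum_distrib_right sum_divide_distrib power_mult_distrib)
      finally have "E n - (of_real (\<Sum>b\<in>B n. \<beta> n b) * z - z\<^sup>2)
          = (\<Sum>b\<in>B n. Ln (1 + of_real (\<beta> n b) * z) - (of_real (\<beta> n b) * z - (of_real (\<beta> n b) * z)\<^sup>2 / 2))"
        by (simp add: E_def sum_subtractf)
      also have "norm \<dots> \<le> (\<Sum>b\<in>B n. 2 * norm (of_real (\<beta> n b) * z) ^ 3)"
        using elim by (intro sum_norm_le norm_Ln_quadratic_le) auto
      also have "\<dots> = 2 * norm z ^ 3 * (\<Sum>b\<in>B n. \<bar>\<beta> n b\<bar> ^ 3)"
        by (simp add: norm_mult power_mult_distrib sum_distrib_left mult_ac)
      finally show ?case .
    qed
    show "(\<lambda>n. 2 * norm z ^ 3 * (\<Sum>b\<in>B n. \<bar>\<beta> n b\<bar> ^ 3)) \<longlonglongrightarrow> 0"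
      using power_sums_small[of 3] by (intro tendsto_mult_right_zero) simp
  qed
  moreover have "(\<lambda>n. of_real (\<Sum>b\<in>B n. \<beta> n b) * z - z\<^sup>2) \<longlonglongrightarrow> of_real 0 * z - z\<^sup>2"
    by (intro tendsto_intros sum1)
  ultimately have "(\<lambda>n. (E n - (of_real (\<Sum>b\<in>B n. \<beta> n b) * z - z\<^sup>2)) + (of_real (\<Sum>b\<in>B n. \<beta> n b) * z - z\<^sup>2))
      \<longlonglongrightarrow> 0 + (of_real 0 * z - z\<^sup>2)"
    by (rule tendsto_add)
  then have "E \<longlonglongrightarrow> - z\<^sup>2" by simp
  then have "(\<lambda>n. exp (E n)) \<longlonglongrightarrow> exp (- z\<^sup>2)"
    by (rule tendsto_exp)
  moreover have "\<forall>\<^sub>F n in sequentially. exp (E n) = poly (beta_poly n) z"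
    using sm
  proof eventually_elim
    case (elim n)
    have "exp (E n) = (\<Prod>b\<in>B n. exp (Ln (1 + of_real (\<beta> n b) * z)))"
      unfolding E_def by (rule exp_sum[OF fin])
    also have "\<dots> = (\<Prod>b\<in>B n. 1 + of_real (\<beta> n b) * z)"
    proof (intro prod.cong refl exp_Ln)
      fix b assume "b \<in> B n"
      then have "norm (of_real (\<beta> n b) * z) \<le> 1/2" using elim by blast
      moreover have "norm w = 1" if "1 + w = 0" for w :: complex
        using that by (metis add_eq_0_iff norm_minus_cancel norm_one)
      ultimately show "1 + of_real (\<beta> n b) * z \<noteq> 0"
        by force
    qed
    finally show ?case by (simp add: poly_beta_poly)
  qed
  ultimately show ?thesis
    by (rule Lim_transform_eventually)
qed

lemma power_sum_limit:
  "(\<lambda>n. \<Sum>b\<in>B n. \<beta> n b ^ Suc i) \<longlonglongrightarrow> (if i = 1 then 2 else 0)"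
proof -
  consider "i = 0" | "i = 1" | "3 \<le> Suc i" by linarith
  then show ?thesis
  proof cases
    case 1
    then show ?thesis using sum1 by simp
  next
    case 2
    then show ?thesis
      using sum2 by (intro tendsto_eventually) (simp add: numeral_2_eq_2)
  next
    case 3
    have "(\<lambda>n. \<Sum>b\<in>B n. \<beta> n b ^ Suc i) \<longlonglongrightarrow> 0"
    proof (rule Lim_null_comparison[OF _ power_sums_small[OF 3]])
      show "\<forall>\<^sub>F n in sequentially. norm (\<Sum>b\<in>B n. \<beta> n b ^ Suc i) \<le> (\<Sum>b\<in>B n. \<bar>\<beta> n b\<bar> ^ Suc i)"
        by (intro always_eventually allI sum_norm_le) (simp add: power_abs abs_mult)
    qed
    then show ?thesis using 3 by simp
  qed
qed

text \<open>In Newton's identities only the second power sum survives, which leaves (s + 1) e(s + 1)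
  = - 2 e(s - 1), the recursion of the Taylor coefficients of exp (- z^2).\<close>

lemma coeff_beta_poly_limit:
  "(\<lambda>n. coeff (beta_poly n) s) \<longlonglongrightarrow>
    of_real (if even s then (-1) ^ (s div 2) / fact (s div 2) else 0)"
proof (induction s rule: less_induct)
  case (less s)
  define c where "c = (\<lambda>s::nat. if even s then (-1) ^ (s div 2) / fact (s div 2) else (0::real))"
  show ?case
  proof (cases s)
    case 0
    have "coeff (beta_poly n) 0 = 1" for n
      by (simp add: poly_0_coeff_0[symmetric] poly_prod)
    then show ?thesis using 0 by simp
  next
    case (Suc s')
    have IH: "(\<lambda>n. coeff (beta_poly n) (s' - i)) \<longlonglongrightarrow> of_real (c (s' - i))" for i
      using less[of "s' - i"] Suc by (simp add: c_def)
    have "(\<lambda>n. \<Sum>i\<le>s'. (-1) ^ i * of_real (\<Sum>b\<in>B n. \<beta> n b ^ Suc i) * coeff (beta_poly n) (s' - i))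
       \<longlonglongrightarrow> (\<Sum>i\<le>s'. (-1) ^ i * of_real (if i = 1 then 2 else 0) * of_real (c (s' - i)))"
      by (intro tendsto_intros power_sum_limit IH)
    also have "(\<Sum>i\<le>s'. (-1) ^ i * of_real (if i = 1 then 2 else 0) * of_real (c (s' - i)))
       = (\<Sum>i\<le>s'. if i = 1 then - 2 * of_real (c (s' - 1)) else (0::complex))"
      by (intro sum.cong) auto
    also have "\<dots> = of_real (real (Suc s') * c (Suc s'))"
    proof (cases s')
      case 0
      then show ?thesis by (simp add: c_def)
    next
      case (Suc r)
      have "real (Suc (Suc r)) * c (Suc (Suc r)) = - 2 * c r"
      proof (cases "even r")
        case True
        then obtain b where b: "r = 2 * b" by (elim evenE)
        have "real (Suc (Suc r)) = 2 * real (Suc b)"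
          using b by simp
        moreover have "c (Suc (Suc r)) = - ((-1) ^ b) / (real (Suc b) * fact b)" "c r = (-1) ^ b / fact b"
          using b by (simp_all add: c_def)
        ultimately show ?thesis
          by (simp del: of_nat_Suc)
      qed (simp add: c_def)
      then show ?thesis using Suc by (simp del: of_nat_Suc)
    qed
    also have "(\<lambda>n. \<Sum>i\<le>s'. (-1) ^ i * of_real (\<Sum>b\<in>B n. \<beta> n b ^ Suc i) * coeff (beta_poly n) (s' - i))
        = (\<lambda>n. of_nat (Suc s') * coeff (beta_poly n) (Suc s'))"
      by (rule ext, subst newton_identity[OF fin]) simp
    finally have "(\<lambda>n. of_nat (Suc s') * coeff (beta_poly n) (Suc s') / of_nat (Suc s'))
        \<longlonglongrightarrow> of_real (real (Suc s') * c (Suc s')) / of_nat (Suc s')"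
      by (rule tendsto_divide) (use of_nat_neq_0 in auto)
    then have "(\<lambda>n. coeff (beta_poly n) (Suc s')) \<longlonglongrightarrow> of_real (c (Suc s'))"
      using of_nat_neq_0[of s', where 'a = complex] by (simp del: of_nat_Suc)
    then show ?thesis
      by (simp only: Suc c_def)
  qed
qed

text \<open>Polynomial growth in t of prescribed degree, uniformly in n. By Bernoulli each squared
  factor exceeds its value at t = 0 by at least the power \<open>K * \<beta>^2\<close> of 1 + \<tau>
  / K, and these exponents add up to 2 K. Smallness of \<beta> is what keeps each exponent at most
  1.\<close>

lemma norm_beta_poly_eta_ge:
  fixes K :: nat
  assumes n: "(\<Sum>b\<in>B n. (\<beta> n b)\<^sup>2) = 2" "\<And>b. b \<in> B n \<Longrightarrow> \<bar>\<beta> n b\<bar> \<le> 1 / (real K)"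
    and K: "1 \<le> K"
  shows "norm (poly (beta_poly n) 1) * ((1 + t\<^sup>2) / (4 * real K)) ^ K \<le> norm (poly (beta_poly n) (eta t))"
proof -
  \<comment> \<open>The quarter compensates for (1 + \<beta>)^2, which is at most 4, when (1 +
    \<beta>)^2 is factored out.\<close>
  define \<tau> where "\<tau> = t\<^sup>2 / 4"
  have \<tau>: "0 \<le> \<tau>" by (simp add: \<tau>_def)
  have le1: "\<bar>\<beta> n b\<bar> \<le> 1" if "b \<in> B n" for b
  proof -
    have "1 / real K \<le> 1" using K by simp
    then show ?thesis using n(2)[OF that] by linarith
  qed
  have factor: "(norm (1 + of_real (\<beta> n b) * eta t))\<^sup>2 \<ge> (norm (1 + of_real (\<beta> n b) * 1 :: complex))\<^sup>2 * (1 + \<tau> / K) powr (K * (\<beta> n b)\<^sup>2)"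
    if b: "b \<in> B n" for b
  proof -
    let ?b = "\<beta> n b"
    have sq: "?b\<^sup>2 \<le> 1 / K"
    proof -
      have "\<bar>?b\<bar>\<^sup>2 \<le> \<bar>?b\<bar>" using mult_left_mono[OF le1[OF b], of "\<bar>?b\<bar>"] unfolding power2_eq_square by simp
      then show ?thesis using n(2)[OF b] by simp
    qed
    have "(1 + \<tau> / K) powr (K * ?b\<^sup>2) \<le> 1 + (K * ?b\<^sup>2) * (\<tau> / K)"
      using \<tau> K sq by (intro one_plus_powr_le) (auto simp: field_simps)
    also have "\<dots> = 1 + ?b\<^sup>2 * \<tau>"
      using K by simp
    finally have 1: "(1 + \<tau> / K) powr (K * ?b\<^sup>2) \<le> 1 + ?b\<^sup>2 * \<tau>" .
    have n1: "(norm (1 + of_real ?b * 1 :: complex))\<^sup>2 = (1 + ?b)\<^sup>2"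
      by (simp add: cmod_power2)
    have n2: "(norm (1 + of_real ?b * eta t))\<^sup>2 = (1 + ?b)\<^sup>2 + ?b\<^sup>2 * t\<^sup>2"
      by (simp add: cmod_power2 power_mult_distrib)
    have i1: "(1 + ?b)\<^sup>2 * (1 + \<tau> / K) powr (K * ?b\<^sup>2) \<le> (1 + ?b)\<^sup>2 * (1 + ?b\<^sup>2 * \<tau>)"
      using 1 by (rule mult_left_mono) simp
    have i2: "(1 + ?b)\<^sup>2 * (1 + ?b\<^sup>2 * \<tau>) \<le> (1 + ?b)\<^sup>2 + ?b\<^sup>2 * t\<^sup>2"
    proof -
      have "(1 + ?b)\<^sup>2 \<le> 2\<^sup>2"
        using le1[OF b] by (intro power_mono) auto
      then have "(1 + ?b)\<^sup>2 * (?b\<^sup>2 * \<tau>) \<le> 4 * (?b\<^sup>2 * \<tau>)"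
        using \<tau> by (intro mult_right_mono) auto
      then show ?thesis by (simp add: \<tau>_def algebra_simps)
    qed
    show ?thesis
      unfolding n1 n2 by (rule order_trans[OF i1 i2])
  qed
  have "(norm (poly (beta_poly n) 1))\<^sup>2 * (1 + \<tau> / K) ^ (2 * K)
      = (\<Prod>b\<in>B n. (norm (1 + of_real (\<beta> n b) * 1 :: complex))\<^sup>2 * (1 + \<tau> / K) powr (K * (\<beta> n b)\<^sup>2))"
  proof -
    have pos: "0 < 1 + \<tau> / K" using \<tau> K by (simp add: add_pos_nonneg)
    have "(\<Prod>b\<in>B n. (1 + \<tau> / K) powr (K * (\<beta> n b)\<^sup>2)) = (1 + \<tau> / K) powr (\<Sum>b\<in>B n. K * (\<beta> n b)\<^sup>2)"
      using pos by (subst powr_sum) (auto simp: fin)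
    also have "(\<Sum>b\<in>B n. K * (\<beta> n b)\<^sup>2) = real (2 * K)"
      using n(1) by (simp add: sum_distrib_left[symmetric])
    also have "(1 + \<tau> / K) powr real (2 * K) = (1 + \<tau> / K) ^ (2 * K)"
      using pos by (rule powr_realpow)
    finally show ?thesis
      unfolding poly_beta_poly by (simp add: prod.distrib prod_norm[symmetric] prod_power_distrib)
  qed
  also have "\<dots> \<le> (\<Prod>b\<in>B n. (norm (1 + of_real (\<beta> n b) * eta t))\<^sup>2)"
    using factor by (intro prod_mono) auto
  also have "\<dots> = (norm (poly (beta_poly n) (eta t)))\<^sup>2"
    unfolding poly_beta_poly by (simp add: prod_norm[symmetric] prod_power_distrib)
  finally have sq: "(norm (poly (beta_poly n) 1) * (1 + \<tau> / K) ^ K)\<^sup>2 \<le> (norm (poly (beta_poly n) (eta t)))\<^sup>2"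
    by (simp add: power_mult_distrib power_mult[symmetric] mult.commute)
  have "norm (poly (beta_poly n) 1) * (1 + \<tau> / K) ^ K \<le> norm (poly (beta_poly n) (eta t))"
    by (rule power2_le_imp_le[OF sq]) simp
  moreover have "((1 + t\<^sup>2) / (4 * real K)) ^ K \<le> (1 + \<tau> / K) ^ K"
    using K by (intro power_mono) (auto simp: \<tau>_def field_simps)
  then have "norm (poly (beta_poly n) 1) * ((1 + t\<^sup>2) / (4 * real K)) ^ K \<le> norm (poly (beta_poly n) 1) * (1 + \<tau> / K) ^ K"
    by (rule mult_left_mono) simp
  ultimately show ?thesis by linarith
qed

text \<open>Dominated convergence, with the majorant supplied by
  \<open>norm_beta_poly_eta_ge\<close>.\<close>

lemma line_int_limit: "(\<lambda>n. line_int (beta_poly n) m) \<longlonglongrightarrow> hankel m"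
proof -
  define q where "q = nat (max (m - 1) 0)"
  \<comment> \<open>One power more than the numerator's growth (1 + t^2)^q, so that the quotient is
    bounded by a multiple of 1 / (1 + t^2). The constant \<open>c\<close> below is half the limit of
    the product at 1.\<close>
  define K where "K = q + 1"
  define c where "c = exp (- 1 :: real) / 2"
  have c: "0 < c" by (simp add: c_def)
  have K: "1 \<le> K" by (simp add: K_def)
  then have K': "0 < 1 / real K" by simp
  have "(\<lambda>n. norm (poly (beta_poly n) 1)) \<longlonglongrightarrow> norm (exp (- 1\<^sup>2 :: complex))"
    by (intro tendsto_norm beta_poly_pointwise)
  moreover have "norm (exp (- 1\<^sup>2 :: complex)) > c"
    by (simp add: c_def norm_exp_eq_Re)
  ultimately have ev1: "\<forall>\<^sub>F n in sequentially. c < norm (poly (beta_poly n) 1)"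
    by (rule order_tendstoD(1))
  have "\<forall>\<^sub>F n in sequentially. \<forall>t. norm (eta t powi (m - 1) / poly (beta_poly n) (eta t))
      \<le> (4 * real K) ^ K / c * inverse (1 + t\<^sup>2) \<and> poly (beta_poly n) (eta t) \<noteq> 0"
    using ev1 sum2 small[OF K']
  proof eventually_elim
    case (elim n)
    show ?case
    proof
      fix t :: real
      have u: "0 < 1 + t\<^sup>2" by (simp add: add_pos_nonneg)
      have "c * ((1 + t\<^sup>2) / (4 * real K)) ^ K \<le> norm (poly (beta_poly n) 1) * ((1 + t\<^sup>2) / (4 * real K)) ^ K"
        using elim(1) u by (intro mult_right_mono) auto
      also have "\<dots> \<le> norm (poly (beta_poly n) (eta t))"
        using elim K by (intro norm_beta_poly_eta_ge) auto
      finally have lower: "c * ((1 + t\<^sup>2) / (4 * real K)) ^ K \<le> norm (poly (beta_poly n) (eta t))" .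
      have pos: "0 < c * ((1 + t\<^sup>2) / (4 * real K)) ^ K"
        using c u K by simp
      have "norm (eta t powi (m - 1)) \<le> norm (eta t) ^ q"
        by (rule norm_eta_power_le) (simp add: q_def)
      also have "\<dots> \<le> norm (eta t) ^ (2 * q)"
        by (rule power_increasing) (use norm_eta_ge_1 in auto)
      also have "\<dots> = (1 + t\<^sup>2) ^ q"
        by (simp only: power_mult norm_eta_squared)
      finally have "norm (eta t powi (m - 1) / poly (beta_poly n) (eta t))
          \<le> (1 + t\<^sup>2) ^ q / (c * ((1 + t\<^sup>2) / (4 * real K)) ^ K)"
        unfolding norm_divide using lower pos by (intro frac_le) auto
      also have "\<dots> = (4 * real K) ^ K / c * inverse (1 + t\<^sup>2)"
      proof -
        have k: "a / (c * (a * v / d)) = d / c * inverse v" if "a \<noteq> 0" for a v d :: real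
          using that by (simp add: field_simps)
        have e: "((1 + t\<^sup>2) / (4 * real K)) ^ K = (1 + t\<^sup>2) ^ q * (1 + t\<^sup>2) / (4 * real K) ^ K"
          unfolding power_divide by (simp add: K_def mult.commute)
        show ?thesis unfolding e by (rule k) (use u in simp)
      qed
      finally show "norm (eta t powi (m - 1) / poly (beta_poly n) (eta t)) \<le> (4 * real K) ^ K / c * inverse (1 + t\<^sup>2)
          \<and> poly (beta_poly n) (eta t) \<noteq> 0"
        using lower pos by auto
    qed
  qed
  then obtain N where N: "\<And>n t. N \<le> n \<Longrightarrow> norm (eta t powi (m - 1) / poly (beta_poly n) (eta t))
      \<le> (4 * real K) ^ K / c * inverse (1 + t\<^sup>2)"
    and nz: "\<And>n t. N \<le> n \<Longrightarrow> poly (beta_poly n) (eta t) \<noteq> 0"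
    unfolding eventually_sequentially by blast
  \<comment> \<open>The majorant is available from index \<open>N\<close> on, hence the shifted
    sequence.\<close>
  have "(\<lambda>n. LINT t|lborel. eta t powi (m - 1) / poly (beta_poly (n + N)) (eta t))
      \<longlonglongrightarrow> (LINT t|lborel. eta t powi (m - 1) * exp ((eta t)\<^sup>2))"
  proof (rule integral_dominated_convergence)
    show "(\<lambda>t. eta t powi (m - 1) * exp ((eta t)\<^sup>2)) \<in> borel_measurable lborel"
      using hankel_integrable by (rule borel_measurable_integrable)
    show "(\<lambda>t. eta t powi (m - 1) / poly (beta_poly (n + N)) (eta t)) \<in> borel_measurable lborel" for n
    proof -
      have "continuous_on UNIV (\<lambda>t. eta t powi (m - 1) / poly (beta_poly (n + N)) (eta t))"
        using nz by (intro continuous_intros continuous_eta) auto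
      then show ?thesis
        using borel_measurable_continuous_onI by simp
    qed
    show "integrable lborel (\<lambda>t. (4 * real K) ^ K / c * inverse (1 + t\<^sup>2))"
      by (intro integrable_mult_right integrable_Cauchy_density)
    show "AE t in lborel. (\<lambda>n. eta t powi (m - 1) / poly (beta_poly (n + N)) (eta t))
        \<longlonglongrightarrow> eta t powi (m - 1) * exp ((eta t)\<^sup>2)"
    proof (rule AE_I2)
      fix t
      have "(\<lambda>n. eta t powi (m - 1) / poly (beta_poly (n + N)) (eta t))
        \<longlonglongrightarrow> eta t powi (m - 1) / exp (- (eta t)\<^sup>2)"
        by (intro tendsto_intros LIMSEQ_ignore_initial_segment beta_poly_pointwise) simp
      then show "(\<lambda>n. eta t powi (m - 1) / poly (beta_poly (n + N)) (eta t))
        \<longlonglongrightarrow> eta t powi (m - 1) * exp ((eta t)\<^sup>2)"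
        by (simp add: exp_minus divide_inverse)
    qed
    show "AE t in lborel. norm (eta t powi (m - 1) / poly (beta_poly (n + N)) (eta t))
        \<le> (4 * real K) ^ K / c * inverse (1 + t\<^sup>2)" for n
      using N by (intro AE_I2) simp
  qed
  then have "(\<lambda>n. LINT t|lborel. eta t powi (m - 1) / poly (beta_poly n) (eta t))
      \<longlonglongrightarrow> (LINT t|lborel. eta t powi (m - 1) * exp ((eta t)\<^sup>2))"
    by (rule LIMSEQ_offset)
  then show ?thesis
    unfolding line_int_def hankel_def by (intro tendsto_divide tendsto_const) auto
qed

end

subsection \<open>Riemann sums\<close>

text \<open>One constant serves all pieces. Unlike a condition on derivatives, this passes to 1 / g
  by a direct estimate once g is bounded away from 0.\<close>

definition piecewise_lipschitz :: "(real \<Rightarrow> real) \<Rightarrow> bool" where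
  "piecewise_lipschitz f \<longleftrightarrow> (\<exists>P B. finite P \<and> \<Union>P = {0..1} \<and>
     (\<forall>I\<in>P. is_interval I \<and> interior I \<noteq> {} \<and>
        (\<forall>s\<in>I. \<forall>t\<in>I. \<bar>f s - f t\<bar> \<le> B * \<bar>s - t\<bar>)))"

lemma C1_closed_interval_lipschitz:
  fixes h :: "real \<Rightarrow> real"
  assumes "h C1_differentiable_on closure I" "is_interval I" "bounded I"
  shows "\<exists>B. \<forall>s\<in>closure I. \<forall>t\<in>closure I. \<bar>h s - h t\<bar> \<le> B * \<bar>s - t\<bar>"
proof -
  obtain D where D: "\<And>x. x \<in> closure I \<Longrightarrow> (h has_vector_derivative D x) (at x)"
    and cont: "continuous_on (closure I) D"
    using assms(1) unfolding C1_differentiable_on_def by blast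
  have comp: "compact (closure I)"
    using assms(3) by (simp add: compact_closure)
  obtain B where B: "\<And>x. x \<in> closure I \<Longrightarrow> norm (D x) \<le> B"
    using compact_imp_bounded[OF compact_continuous_image[OF cont comp]] unfolding bounded_iff by blast
  have "norm (h s - h t) \<le> B * norm (s - t)" if "s \<in> closure I" "t \<in> closure I" for s t
  proof (rule differentiable_bound[of "closure I" h "\<lambda>x y. y *\<^sub>R D x"])
    show "convex (closure I)"
      using assms(2) by (simp add: is_interval_convex convex_closure)
    show "(h has_derivative (\<lambda>y. y *\<^sub>R D x)) (at x within closure I)" if "x \<in> closure I" for x
      using D[OF that] has_derivative_at_withinI unfolding has_vector_derivative_def by blast
    show "onorm (\<lambda>y. y *\<^sub>R D x) \<le> B" if "x \<in> closure I" for x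
    proof (rule onorm_le)
      fix y :: real
      have "\<bar>y\<bar> * \<bar>D x\<bar> \<le> \<bar>y\<bar> * B"
        using B[OF that] by (intro mult_left_mono) auto
      then show "norm (y *\<^sub>R D x) \<le> B * norm y"
        by (simp add: abs_mult mult.commute)
    qed
  qed (use that in auto)
  then show ?thesis by auto
qed

text \<open>The extension h to the closure is retained because g may approach its infimum on a piece
  at an end point that belongs to another piece.\<close>

lemma piecewise_C1_pieces:
  assumes "piecewise_C1 f"
  shows "\<exists>P B. finite P \<and> \<Union>P = {0..1} \<and>
    (\<forall>I\<in>P. is_interval I \<and> interior I \<noteq> {} \<and> bounded I \<and>
      (\<exists>h. (\<forall>s\<in>closure I. \<forall>t\<in>closure I. \<bar>h s - h t\<bar> \<le> B * \<bar>s - t\<bar>) \<and> (\<forall>s\<in>I. f s = h s)))"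
proof -
  obtain P where P: "finite P" "\<Union>P = {0..1}" and I: "\<And>I. I \<in> P \<Longrightarrow> is_interval I" "\<And>I. I \<in> P \<Longrightarrow> interior I \<noteq> {}"
    and h: "\<And>I. I \<in> P \<Longrightarrow> \<exists>h. h C1_differentiable_on closure I \<and> (\<forall>s\<in>I. f s = h s)"
    using assms unfolding piecewise_C1_def by blast
  have bd: "bounded I" if "I \<in> P" for I
    using P(2) that by (metis Union_upper bounded_closed_interval bounded_subset)
  have "\<exists>B h. (\<forall>s\<in>closure I. \<forall>t\<in>closure I. \<bar>h s - h t\<bar> \<le> B * \<bar>s - t\<bar>) \<and> (\<forall>s\<in>I. f s = h s)" if "I \<in> P" for I
    using h[OF that] C1_closed_interval_lipschitz[OF _ I(1)[OF that] bd[OF that]] by blast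
  then obtain Bf where Bf: "\<And>I. I \<in> P \<Longrightarrow> \<exists>h. (\<forall>s\<in>closure I. \<forall>t\<in>closure I. \<bar>h s - h t\<bar> \<le> Bf I * \<bar>s - t\<bar>) \<and> (\<forall>s\<in>I. f s = h s)"
    by metis
  define B where "B = (\<Sum>I\<in>P. \<bar>Bf I\<bar>)"
  have "Bf I \<le> B" if "I \<in> P" for I
    using member_le_sum[OF that, of "\<lambda>I. \<bar>Bf I\<bar>"] P(1) by (simp add: B_def)
  then have "\<exists>h. (\<forall>s\<in>closure I. \<forall>t\<in>closure I. \<bar>h s - h t\<bar> \<le> B * \<bar>s - t\<bar>) \<and> (\<forall>s\<in>I. f s = h s)" if "I \<in> P" for I
    using Bf[OF that] that by (meson abs_ge_zero mult_right_mono order_trans)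
  then show ?thesis
    using P I bd by (intro exI[of _ P] exI[of _ B] conjI ballI) simp_all
qed

lemma piecewise_C1_imp_lipschitz:
  assumes "piecewise_C1 f"
  shows "piecewise_lipschitz f"
proof -
  obtain P B where P: "finite P" "\<Union>P = {0..1}"
    and h: "\<forall>I\<in>P. is_interval I \<and> interior I \<noteq> {} \<and> bounded I \<and>
      (\<exists>h. (\<forall>s\<in>closure I. \<forall>t\<in>closure I. \<bar>h s - h t\<bar> \<le> B * \<bar>s - t\<bar>) \<and> (\<forall>s\<in>I. f s = h s))"
    using piecewise_C1_pieces[OF assms] by (elim exE conjE)
  have "\<bar>f s - f t\<bar> \<le> B * \<bar>s - t\<bar>" if mem: "I \<in> P" "s \<in> I" "t \<in> I" for I s t
  proof -
    obtain g where "\<forall>s\<in>closure I. \<forall>t\<in>closure I. \<bar>g s - g t\<bar> \<le> B * \<bar>s - t\<bar>" "\<forall>s\<in>I. f s = g s"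
      using bspec[OF h mem(1)] by (elim exE conjE)
    then show ?thesis
      using mem(2,3) closure_subset[of I] by (simp add: subset_iff)
  qed
  then show ?thesis
    unfolding piecewise_lipschitz_def using P h by (intro exI[of _ P] exI[of _ B] conjI ballI) simp_all
qed

lemma piecewise_lipschitz_bounded:
  assumes "piecewise_lipschitz f"
  obtains M where "0 < M" "\<And>s. s \<in> {0..1} \<Longrightarrow> \<bar>f s\<bar> \<le> M"
proof -
  obtain P B where P: "finite P" "\<Union>P = {0..1}"
    and all: "\<forall>I\<in>P. is_interval I \<and> interior I \<noteq> {} \<and>
        (\<forall>s\<in>I. \<forall>t\<in>I. \<bar>f s - f t\<bar> \<le> B * \<bar>s - t\<bar>)"
    using assms unfolding piecewise_lipschitz_def by (elim exE conjE)
  have I: "\<And>I. I \<in> P \<Longrightarrow> interior I \<noteq> {}"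
    and B: "\<And>I s t. I \<in> P \<Longrightarrow> s \<in> I \<Longrightarrow> t \<in> I \<Longrightarrow> \<bar>f s - f t\<bar> \<le> B * \<bar>s - t\<bar>"
    using all by simp_all
  define p where "p = (\<lambda>I::real set. SOME s. s \<in> I)"
  have p: "p I \<in> I" if "I \<in> P" for I
  proof -
    have "\<exists>s. s \<in> I" using I[OF that] interior_subset[of I] by blast
    then show ?thesis unfolding p_def by (rule someI_ex)
  qed
  define M where "M = 1 + \<bar>B\<bar> + (\<Sum>I\<in>P. \<bar>f (p I)\<bar>)"
  have "\<bar>f s\<bar> \<le> M" if s: "s \<in> {0..1}" for s
  proof -
    obtain I where I: "I \<in> P" "s \<in> I" using s P(2) by blast
    have "p I \<in> {0..1}" using P(2) p[OF I(1)] I(1) by blast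
    then have "\<bar>s - p I\<bar> \<le> 1" using s by auto
    have "\<bar>f s - f (p I)\<bar> \<le> B * \<bar>s - p I\<bar>"
      using B I p by blast
    also have "\<dots> \<le> \<bar>B\<bar> * 1"
      using \<open>\<bar>s - p I\<bar> \<le> 1\<close> by (intro mult_mono) auto
    finally have "\<bar>f s\<bar> \<le> \<bar>f (p I)\<bar> + \<bar>B\<bar>" by linarith
    also have "\<bar>f (p I)\<bar> \<le> (\<Sum>I\<in>P. \<bar>f (p I)\<bar>)"
      using P(1) I(1) by (intro member_le_sum) auto
    finally show ?thesis by (simp add: M_def)
  qed
  moreover have "0 < M" by (simp add: M_def add_pos_nonneg sum_nonneg)
  ultimately show ?thesis using that by blast
qed

lemma interval_sets_borel: "is_interval (I :: real set) \<Longrightarrow> I \<in> sets borel"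
  by (rule real_interval_borel_measurable)

lemma piecewise_lipschitz_measurable:
  assumes "piecewise_lipschitz f"
  shows "(\<lambda>s. indicator {0..1} s * f s) \<in> borel_measurable borel"
proof -
  obtain P B where P: "finite P" "\<Union>P = {0..1}"
    and all: "\<forall>I\<in>P. is_interval I \<and> interior I \<noteq> {} \<and>
        (\<forall>s\<in>I. \<forall>t\<in>I. \<bar>f s - f t\<bar> \<le> B * \<bar>s - t\<bar>)"
    using assms unfolding piecewise_lipschitz_def by (elim exE conjE)
  have I: "\<And>I. I \<in> P \<Longrightarrow> is_interval I"
    and B: "\<And>I s t. I \<in> P \<Longrightarrow> s \<in> I \<Longrightarrow> t \<in> I \<Longrightarrow> \<bar>f s - f t\<bar> \<le> B * \<bar>s - t\<bar>"
    using all by simp_all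
  have cont: "continuous_on I f" if "I \<in> P" for I
  proof -
    have "\<bar>B\<bar>-lipschitz_on I f"
    proof (rule lipschitz_onI)
      fix s t assume "s \<in> I" "t \<in> I"
      then have "\<bar>f s - f t\<bar> \<le> B * \<bar>s - t\<bar>" using B that by blast
      also have "\<dots> \<le> \<bar>B\<bar> * \<bar>s - t\<bar>" by (intro mult_right_mono) auto
      finally show "dist (f s) (f t) \<le> \<bar>B\<bar> * dist s t" by (simp add: dist_real_def)
    qed simp
    then show ?thesis by (rule lipschitz_on_continuous_on)
  qed
  show ?thesis
  proof (rule measurable_piecewise_restrict[of "insert (- {0..1}) P"])
    show "countable (insert (- {0..1}) P)" using P(1) by (simp add: countable_finite)
    show "\<Omega> \<inter> space borel \<in> sets borel" if "\<Omega> \<in> insert (- {0..1}) P" for \<Omega> :: "real set"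
      using that I interval_sets_borel by auto
    show "space borel \<subseteq> \<Union> (insert (- {0..1::real}) P)"
      using P(2) by auto
    fix \<Omega> assume \<Omega>: "\<Omega> \<in> insert (- {0..1}) P"
    have "continuous_on \<Omega> (\<lambda>s. indicator {0..1} s * f s)"
    proof (cases "\<Omega> = - {0..1}")
      case True
      then show ?thesis
        by (subst continuous_on_cong[of _ _ _ "\<lambda>_. 0"]) auto
    next
      case False
      then have "\<Omega> \<in> P" using \<Omega> by simp
      moreover then have "\<Omega> \<subseteq> {0..1}" using P(2) by blast
      ultimately show ?thesis
        using cont[of \<Omega>] by (subst continuous_on_cong[of _ _ _ f]) (auto simp: indicator_def subset_iff)
    qed
    then show "(\<lambda>s. indicator {0..1} s * f s) \<in> restrict_space borel \<Omega> \<rightarrow>\<^sub>M borel"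
      by (rule borel_measurable_continuous_on_restrict)
  qed
qed

text \<open>Each cell of the partition into \<open>n\<close> cells contributes \<open>O(1/n)\<close>, unless it contains an end
  point of a piece; there are only finitely many exceptional cells.\<close>

lemma riemann_sum_error:
  assumes "piecewise_lipschitz f"
  obtains C where "\<And>n. 0 < n \<Longrightarrow> \<bar>(\<Sum>i=1..n. f (real i / real n)) - real n * (LINT s|lborel. indicator {0..1} s * f s)\<bar> \<le> C"
proof -
  obtain P B where P: "finite P" "\<Union>P = {0..1}"
    and all: "\<forall>I\<in>P. is_interval I \<and> interior I \<noteq> {} \<and>
        (\<forall>s\<in>I. \<forall>t\<in>I. \<bar>f s - f t\<bar> \<le> B * \<bar>s - t\<bar>)"
    using assms unfolding piecewise_lipschitz_def by (elim exE conjE)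
  have I: "\<And>I. I \<in> P \<Longrightarrow> is_interval I"
    and B: "\<And>I s t. I \<in> P \<Longrightarrow> s \<in> I \<Longrightarrow> t \<in> I \<Longrightarrow> \<bar>f s - f t\<bar> \<le> B * \<bar>s - t\<bar>"
    using all by simp_all
  obtain M where M: "0 < M" "\<And>s. s \<in> {0..1} \<Longrightarrow> \<bar>f s\<bar> \<le> M"
    using piecewise_lipschitz_bounded[OF assms] by metis
  define C where "C = \<bar>B\<bar> + 2 * M * (2 * real (card P))"
  have "\<bar>(\<Sum>i=1..n. f (real i / real n)) - real n * (LINT s|lborel. indicator {0..1} s * f s)\<bar> \<le> C"
    if n: "0 < n" for n
  proof -
    \<comment> \<open>Half-open cells with the sample point at the right end: they are disjoint and
      cover (0,1], so only the null set {0} is lost.\<close>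
    define J where "J = (\<lambda>i. {real (i - 1) / real n<..real i / real n})"
    define F where "F = (\<lambda>s. indicator {0..1} s * f s)"
    have F: "F \<in> borel_measurable borel"
      unfolding F_def by (rule piecewise_lipschitz_measurable[OF assms])
    have FM: "\<bar>F s\<bar> \<le> M" for s
      using M(1) M(2)[of s] by (simp add: F_def indicator_def)
    have J01: "J i \<subseteq> {0..1}" if "i \<in> {1..n}" for i
    proof -
      have "0 \<le> real (i - 1) / n" "real i / n \<le> 1"
        using that n by auto
      moreover have "real (i - 1) / real n < s" "s \<le> real i / real n" if "s \<in> J i" for s
        using that by (simp_all add: J_def)
      ultimately have "0 \<le> s \<and> s \<le> 1" if "s \<in> J i" for s
        using that by (meson less_imp_le order_trans)
      then show ?thesis by auto
    qed
    have mJ: "measure lborel (J i) = 1 / n" if "i \<in> {1..n}" for i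
      using that n by (simp add: J_def field_simps of_nat_diff)
    have emJ: "emeasure lborel (J i) < \<infinity>" for i
      by (rule emeasure_bounded_finite, rule bounded_subset[of "{real (i - 1) / real n..real i / real n}"])
         (auto simp: J_def)
    have intF: "integrable lborel (\<lambda>s. indicator (J i) s * F s)" for i
    proof (rule Bochner_Integration.integrable_bound)
      show "integrable lborel (\<lambda>s. indicator (J i) s * M)"
        using emJ by (intro integrable_mult_left integrable_real_indicator) (simp_all add: J_def)
      show "AE s in lborel. norm (indicator (J i) s * F s) \<le> norm (indicator (J i) s * M)"
        using FM M(1) by (intro AE_I2) (auto simp: indicator_def)
    qed (use F in \<open>auto simp: J_def\<close>)
    have intc: "integrable lborel (\<lambda>s. indicator (J i) s * c)" for i and c :: real
      using emJ by (intro integrable_mult_left integrable_real_indicator) (simp_all add: J_def)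
    have split: "(LINT s|lborel. F s) = (\<Sum>i=1..n. (LINT s|lborel. indicator (J i) s * F s))"
    proof -
      have "(\<Sum>i=1..n. indicator (J i) s * F s) = F s" if "s \<noteq> 0" for s
      proof (cases "s \<in> {0<..1}")
        case True
        define i where "i = nat \<lceil>s * n\<rceil>"
        have i: "i \<in> {1..n}" "s \<in> J i"
        proof -
          have "0 < s * n" "s * n \<le> n" using True n by auto
          then show "i \<in> {1..n}" "s \<in> J i"
            using n unfolding i_def J_def by (auto simp: field_simps) linarith+
        qed
        have "(\<Sum>i'=1..n. indicator (J i') s * F s) = (\<Sum>i'=1..n. if i' = i then F s else 0)"
        proof (intro sum.cong refl)
          fix i' assume i': "i' \<in> {1..n}"
          have "s \<notin> J i'" if "i' \<noteq> i"
          proof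
            assume "s \<in> J i'"
            then have "real i' - 1 < s * n" "s * n \<le> i'" "real i - 1 < s * n" "s * n \<le> i"
              using i i' n by (auto simp: J_def field_simps of_nat_diff)
            then have "real i' < real i + 1" "real i < real i' + 1" by linarith+
            then show False using that by linarith
          qed
          then show "indicator (J i') s * F s = (if i' = i then F s else 0)"
            using i(2) by auto
        qed
        then show ?thesis using i by simp
      next
        case False
        then have "F s = 0" using that by (auto simp: F_def indicator_def)
        then show ?thesis by simp
      qed
      then have "(LINT s|lborel. F s) = (LINT s|lborel. (\<Sum>i=1..n. indicator (J i) s * F s))"
        using AE_lborel_singleton[of 0] F
        by (intro Bochner_Integration.integral_cong_AE) (auto simp: J_def elim!: eventually_mono)
      also have "\<dots> = (\<Sum>i=1..n. (LINT s|lborel. indicator (J i) s * F s))"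
        by (rule Bochner_Integration.integral_sum) (rule intF)
      finally show ?thesis .
    qed
    have cell: "f (real i / n) - n * (LINT s|lborel. indicator (J i) s * F s)
        = n * (LINT s|lborel. indicator (J i) s * (f (real i / n) - F s))" if i: "i \<in> {1..n}" for i
    proof -
      have "(LINT s|lborel. indicator (J i) s * (f (real i / n) - F s))
        = (LINT s|lborel. indicator (J i) s * f (real i / n)) - (LINT s|lborel. indicator (J i) s * F s)"
        by (simp add: right_diff_distrib Bochner_Integration.integral_diff[OF intc intF])
      also have "(LINT s|lborel. indicator (J i) s * f (real i / n)) = f (real i / n) / n"
        using mJ[OF i] by simp
      finally show ?thesis using n by (simp add: right_diff_distrib)
    qed
    have bound: "\<bar>f (real i / n) - n * (LINT s|lborel. indicator (J i) s * F s)\<bar> \<le> c"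
      if i: "i \<in> {1..n}" and c: "\<And>s. s \<in> J i \<Longrightarrow> \<bar>f (real i / n) - F s\<bar> \<le> c" for i c
    proof -
      have "norm (LINT s|lborel. indicator (J i) s * (f (real i / n) - F s)) \<le> (LINT s|lborel. indicator (J i) s * c)"
        by (rule Bochner_Integration.integral_norm_bound_integral)
           (use intc intF c in \<open>auto simp: right_diff_distrib indicator_def intro!: Bochner_Integration.integrable_diff\<close>)
      also have "\<dots> = c / n"
        using mJ[OF i] by simp
      finally have "n * \<bar>LINT s|lborel. indicator (J i) s * (f (real i / n) - F s)\<bar> \<le> n * (c / n)"
        by (intro mult_left_mono) auto
      then show ?thesis
        unfolding cell[OF i] using n by (simp add: abs_mult)
    qed
    \<comment> \<open>A cell is good if one piece contains it together with its sample point; then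
      the Lipschitz bound applies on the whole cell.\<close>
    define Bad where "Bad = {i \<in> {1..n}. \<not> (\<exists>I\<in>P. insert (real i / n) (J i) \<subseteq> I)}"
    have good: "\<bar>f (real i / n) - n * (LINT s|lborel. indicator (J i) s * F s)\<bar> \<le> \<bar>B\<bar> / n"
      if i: "i \<in> {1..n} - Bad" for i
    proof (rule bound)
      obtain I where I: "I \<in> P" "insert (real i / n) (J i) \<subseteq> I" using i by (auto simp: Bad_def)
      fix s assume s: "s \<in> J i"
      have "s \<in> {0..1}" using J01[of i] i s by blast
      then have "F s = f s" by (simp add: F_def)
      then have "\<bar>f (real i / n) - F s\<bar> \<le> B * \<bar>real i / n - s\<bar>"
        using B[OF I(1)] I(2) s by auto
      also have "\<dots> \<le> \<bar>B\<bar> * (1 / n)"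
      proof -
        have "real (i - 1) / n = real i / n - 1 / n"
          using i by (simp add: of_nat_diff diff_divide_distrib)
        then have "\<bar>real i / n - s\<bar> \<le> 1 / n"
          using s by (auto simp: J_def)
        then show ?thesis by (intro mult_mono) auto
      qed
      finally show "\<bar>f (real i / n) - F s\<bar> \<le> \<bar>B\<bar> / n" by simp
    qed (use i in auto)
    have bad: "\<bar>f (real i / n) - n * (LINT s|lborel. indicator (J i) s * F s)\<bar> \<le> 2 * M"
      if i: "i \<in> {1..n}" for i
    proof (rule bound[OF i])
      fix s
      have "\<bar>f (real i / n)\<bar> \<le> M" using i n by (intro M(2)) (auto simp: field_simps)
      then show "\<bar>f (real i / n) - F s\<bar> \<le> 2 * M" using FM[of s] by linarith
    qed
    have cardBad: "card Bad \<le> 2 * card P"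
    proof -
      \<comment> \<open>The piece that contains the right end of a bad cell misses some point of the
        cell, so its infimum lies in the cell. This determines the cell from the piece.\<close>
      have sub: "Bad \<subseteq> (\<Union>I\<in>P. {nat \<lceil>Inf I * n\<rceil>, nat \<lceil>Inf I * n\<rceil> + 1})"
      proof
        fix i assume i: "i \<in> Bad"
        then have i': "i \<in> {1..n}" by (simp add: Bad_def)
        then have "real i / n \<in> {0..1}" using n by (auto simp: field_simps)
        then obtain K where K: "K \<in> P" "real i / n \<in> K" using P(2) by blast
        then obtain s where s: "s \<in> J i" "s \<notin> K" using i by (auto simp: Bad_def)
        have "K \<subseteq> {0..1}" using K P(2) by blast
        then have bdd: "bdd_below K" by (meson bdd_below_Icc bdd_below_mono)
        have low: "s \<le> z" if "z \<in> K" for z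
        proof (rule ccontr)
          assume "\<not> s \<le> z"
          moreover have "s \<le> real i / n" using s by (simp add: J_def)
          ultimately have "s \<in> K"
            using I[OF K(1)] that K(2) unfolding is_interval_1 by (meson less_imp_le not_le)
          then show False using s by simp
        qed
        have 1: "s \<le> Inf K" using K low by (intro cInf_greatest) auto
        have 2: "Inf K \<le> real i / n" using bdd K by (intro cInf_lower)
        have "(real i - 1) / n < s"
          using s i' by (simp add: J_def of_nat_diff)
        then have "(real i - 1) / n < Inf K" using 1 by linarith
        then have "real i - 1 < Inf K * n" "Inf K * n \<le> i"
          using 2 n by (simp_all add: pos_divide_less_eq pos_le_divide_eq)
        then have "i = nat \<lceil>Inf K * n\<rceil>" by linarith
        then show "i \<in> (\<Union>I\<in>P. {nat \<lceil>Inf I * n\<rceil>, nat \<lceil>Inf I * n\<rceil> + 1})" using K by auto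
      qed
      have "card Bad \<le> card (\<Union>I\<in>P. {nat \<lceil>Inf I * n\<rceil>, nat \<lceil>Inf I * n\<rceil> + 1})"
        using P(1) by (intro card_mono sub) auto
      also have "\<dots> \<le> (\<Sum>I\<in>P. card {nat \<lceil>Inf I * n\<rceil>, nat \<lceil>Inf I * n\<rceil> + 1})"
        by (rule card_UN_le[OF P(1)])
      also have "\<dots> \<le> (\<Sum>I\<in>P. 2)"
        by (intro sum_mono) (simp add: card_insert_if)
      finally show ?thesis by simp
    qed
    have "(\<Sum>i=1..n. f (real i / n)) - n * (LINT s|lborel. F s)
       = (\<Sum>i=1..n. f (real i / n) - n * (LINT s|lborel. indicator (J i) s * F s))"
      by (simp add: split sum_subtractf sum_distrib_left)
    also have "\<bar>\<dots>\<bar> \<le> (\<Sum>i=1..n. \<bar>f (real i / n) - n * (LINT s|lborel. indicator (J i) s * F s)\<bar>)"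
      by (rule sum_abs)
    also have "\<dots> \<le> (\<Sum>i=1..n. \<bar>B\<bar> / n + (if i \<in> Bad then 2 * M else 0))"
    proof (rule sum_mono)
      fix i assume i: "i \<in> {1..n}"
      show "\<bar>f (real i / n) - n * (LINT s|lborel. indicator (J i) s * F s)\<bar> \<le> \<bar>B\<bar> / n + (if i \<in> Bad then 2 * M else 0)"
        using good[of i] bad[OF i] i n by (cases "i \<in> Bad") (auto intro: add_increasing)
    qed
    also have "\<dots> = \<bar>B\<bar> + 2 * M * card Bad"
    proof -
      have fin: "finite {1..n}" by simp
      have sub: "Bad \<subseteq> {1..n}" unfolding Bad_def by (rule Collect_restrict)
      have "(\<Sum>i=1..n. if i \<in> Bad then 2 * M else 0) = (\<Sum>i\<in>Bad. 2 * M)"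
        by (rule sum.mono_neutral_cong_right[OF fin sub]) simp_all
      then have s2: "(\<Sum>i=1..n. if i \<in> Bad then 2 * M else 0) = 2 * M * card Bad"
        by (simp only: sum_constant mult.commute)
      have s1: "(\<Sum>i=1..n. \<bar>B\<bar> / n) = \<bar>B\<bar>"
        using n by simp
      show ?thesis
        by (simp only: sum.distrib s1 s2)
    qed
    also have "\<dots> \<le> C"
      unfolding C_def using M(1) cardBad by (intro add_left_mono mult_left_mono) auto
    finally show ?thesis by (simp add: F_def)
  qed
  then show ?thesis by (rule that)
qed

subsection \<open>The critical support condition\<close>

lemma set_integrable_bounded:
  fixes h :: "real \<Rightarrow> 'a::euclidean_space"
  assumes "(\<lambda>s. indicator {0..1} s *\<^sub>R h s) \<in> borel_measurable borel"
    and "\<And>s. s \<in> {0..1} \<Longrightarrow> norm (h s) \<le> C"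
  shows "set_integrable lborel {0..1} h"
  unfolding set_integrable_def
proof (rule Bochner_Integration.integrable_bound)
  show "integrable lborel (\<lambda>s. indicator {0..1::real} s * C)"
    by (intro integrable_mult_left integrable_real_indicator) auto
  show "AE s in lborel. norm (indicator {0..1} s *\<^sub>R h s) \<le> norm (indicator {0..1} s * C)"
    using order_trans[OF assms(2) abs_ge_self] by (intro AE_I2) (auto simp: indicator_def)
qed (use assms(1) in simp)

text \<open>Outside {0..1} the function f is arbitrary; it is cut off before the composition, and
  the outer indicator hides the difference.\<close>

lemma measurable_on_unit:
  fixes f :: "real \<Rightarrow> real"
  assumes "(\<lambda>s. indicator {0..1} s * f s) \<in> borel_measurable borel" "\<phi> \<in> borel_measurable borel"
  shows "(\<lambda>s. indicator {0..1} s *\<^sub>R (\<phi> (f s) :: 'a::euclidean_space)) \<in> borel_measurable borel"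
proof -
  have "(\<lambda>s. indicator {0..1} s *\<^sub>R \<phi> (indicator {0..1} s * f s)) \<in> borel_measurable borel"
    using measurable_compose[OF assms] by (intro borel_measurable_scaleR borel_measurable_indicator) auto
  moreover have "(\<lambda>s. indicator {0..1} s *\<^sub>R \<phi> (indicator {0..1} s * f s)) = (\<lambda>s. indicator {0..1} s *\<^sub>R \<phi> (f s))"
    by (auto simp: indicator_def)
  ultimately show ?thesis by simp
qed

lemma set_integrable_Im: "set_integrable M A h \<Longrightarrow> set_integrable M A (\<lambda>s. Im (h s))"
  and set_integrable_Re: "set_integrable M A h \<Longrightarrow> set_integrable M A (\<lambda>s. Re (h s))"
  and Im_set_integral: "set_integrable M A h \<Longrightarrow> Im (LINT s:A|M. h s) = (LINT s:A|M. Im (h s))"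
  and Re_set_integral: "set_integrable M A h \<Longrightarrow> Re (LINT s:A|M. h s) = (LINT s:A|M. Re (h s))"
proof -
  have 1: "(\<lambda>s. indicator A s *\<^sub>R Im (h s)) = (\<lambda>s. Im (indicator A s *\<^sub>R h s))"
    and 2: "(\<lambda>s. indicator A s *\<^sub>R Re (h s)) = (\<lambda>s. Re (indicator A s *\<^sub>R h s))"
    by (simp_all add: fun_eq_iff)
  show "set_integrable M A h \<Longrightarrow> set_integrable M A (\<lambda>s. Im (h s))"
    "set_integrable M A h \<Longrightarrow> set_integrable M A (\<lambda>s. Re (h s))"
    "set_integrable M A h \<Longrightarrow> Im (LINT s:A|M. h s) = (LINT s:A|M. Im (h s))"
    "set_integrable M A h \<Longrightarrow> Re (LINT s:A|M. h s) = (LINT s:A|M. Re (h s))"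
    unfolding set_integrable_def set_lebesgue_integral_def 1 2
    by (simp_all only: integrable_Im integrable_Re integral_Im integral_Re)
qed

lemma norm_diff_Im_ge: "\<bar>Im z\<bar> \<le> norm (of_real a + z)" "\<bar>Im z\<bar> \<le> norm (of_real a - z)"
  using abs_Im_le_cmod[of "of_real a + z"] abs_Im_le_cmod[of "of_real a - z"] by simp_all

text \<open>The imaginary part of the equation, divided by Im z, is the balance of the f- and
  g-integrals. Subtracting Re z / Im z times the imaginary part from the real part removes the terms
  linear in z; what remains of c - t is |z|^2 times a sum of nonnegative integrals.\<close>

lemma root_identities:
  fixes f g :: "real \<Rightarrow> real"
  assumes f: "(\<lambda>s. indicator {0..1} s * f s) \<in> borel_measurable borel" "\<And>s. s \<in> {0..1} \<Longrightarrow> 0 < f s"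
    and g: "(\<lambda>s. indicator {0..1} s * g s) \<in> borel_measurable borel" "\<And>s. s \<in> {0..1} \<Longrightarrow> 0 \<le> g s"
      "\<And>s. s \<in> {0..1} \<Longrightarrow> g s \<le> G"
    and root: "is_root f g c t z" and z: "Im z \<noteq> 0"
  shows "set_integrable lborel {0..1} (\<lambda>s. f s / (norm (1 - of_real (f s) * z))\<^sup>2)"
    and "set_integrable lborel {0..1} (\<lambda>s. g s / (norm (z + of_real (g s)))\<^sup>2)"
    and "set_integrable lborel {0..1} (\<lambda>s. (f s)\<^sup>2 / (norm (1 - of_real (f s) * z))\<^sup>2)"
    and "set_integrable lborel {0..1} (\<lambda>s. 1 / (norm (z + of_real (g s)))\<^sup>2)"
    and "(LINT s:{0..1}|lborel. f s / (norm (1 - of_real (f s) * z))\<^sup>2)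
      = c * (LINT s:{0..1}|lborel. g s / (norm (z + of_real (g s)))\<^sup>2)"
    and "c - t = (norm z)\<^sup>2 * ((LINT s:{0..1}|lborel. (f s)\<^sup>2 / (norm (1 - of_real (f s) * z))\<^sup>2)
      + c * (LINT s:{0..1}|lborel. 1 / (norm (z + of_real (g s)))\<^sup>2))"
proof -
  define y where "y = Im z"
  have y: "y \<noteq> 0" using z by (simp add: y_def)
  have nf: "f s * \<bar>y\<bar> \<le> norm (1 - of_real (f s) * z)" if "s \<in> {0..1}" for s
    using abs_Im_le_cmod[of "1 - of_real (f s) * z"] f(2)[OF that] by (simp add: abs_mult y_def)
  have ng: "\<bar>y\<bar> \<le> norm (z + of_real (g s))" for s
    using norm_diff_Im_ge(1)[of z "g s"] by (simp add: y_def add.commute)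
  have nf0: "0 < norm (1 - of_real (f s) * z)" if "s \<in> {0..1}" for s
  proof -
    have "0 < f s * \<bar>y\<bar>" using f(2)[OF that] y by simp
    then show ?thesis using nf[OF that] by linarith
  qed
  have ng0: "0 < norm (z + of_real (g s))" for s
    using ng[of s] y by linarith
  define A where "A = (\<lambda>s. of_real (f s) * z / (1 - of_real (f s) * z))"
  define Bg where "Bg = (\<lambda>s. of_real (g s) / (z + of_real (g s)))"
  have iA: "set_integrable lborel {0..1} A"
  proof (rule set_integrable_bounded)
    show "(\<lambda>s. indicator {0..1} s *\<^sub>R A s) \<in> borel_measurable borel"
      unfolding A_def by (rule measurable_on_unit[OF f(1), of "\<lambda>u. of_real u * z / (1 - of_real u * z)"]) measurable
    fix s :: real assume s: "s \<in> {0..1}"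
    have "norm (A s) = f s * norm z / norm (1 - of_real (f s) * z)"
      using f(2)[OF s] by (simp add: A_def norm_divide norm_mult)
    also have "\<dots> \<le> f s * norm z / (f s * \<bar>y\<bar>)"
      using nf[OF s] f(2)[OF s] y by (intro frac_le) auto
    also have "\<dots> = norm z / \<bar>y\<bar>"
      using f(2)[OF s] by simp
    finally show "norm (A s) \<le> norm z / \<bar>y\<bar>" .
  qed
  have iB: "set_integrable lborel {0..1} Bg"
  proof (rule set_integrable_bounded)
    show "(\<lambda>s. indicator {0..1} s *\<^sub>R Bg s) \<in> borel_measurable borel"
      unfolding Bg_def by (rule measurable_on_unit[OF g(1), of "\<lambda>u. of_real u / (z + of_real u)"]) measurable
    fix s :: real assume s: "s \<in> {0..1}"
    have "norm (Bg s) = g s / norm (z + of_real (g s))"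
      using g(2)[OF s] by (simp add: Bg_def norm_divide)
    also have "\<dots> \<le> G / \<bar>y\<bar>"
      using ng[of s] g(2,3)[OF s] y by (intro frac_le) auto
    finally show "norm (Bg s) \<le> G / \<bar>y\<bar>" .
  qed
  show i3: "set_integrable lborel {0..1} (\<lambda>s. (f s)\<^sup>2 / (norm (1 - of_real (f s) * z))\<^sup>2)"
  proof (rule set_integrable_bounded)
    show "(\<lambda>s. indicator {0..1} s *\<^sub>R ((f s)\<^sup>2 / (norm (1 - of_real (f s) * z))\<^sup>2)) \<in> borel_measurable borel"
      by (rule measurable_on_unit[OF f(1), of "\<lambda>u. u\<^sup>2 / (norm (1 - of_real u * z))\<^sup>2"]) measurable
    fix s :: real assume s: "s \<in> {0..1}"
    have "(f s)\<^sup>2 / (norm (1 - of_real (f s) * z))\<^sup>2 \<le> (f s)\<^sup>2 / (f s * \<bar>y\<bar>)\<^sup>2"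
      using nf[OF s] f(2)[OF s] y by (intro frac_le power_mono) auto
    also have "\<dots> = 1 / y\<^sup>2"
      using f(2)[OF s] by (simp add: power_mult_distrib)
    finally show "norm ((f s)\<^sup>2 / (norm (1 - of_real (f s) * z))\<^sup>2) \<le> 1 / y\<^sup>2" by simp
  qed
  show i4: "set_integrable lborel {0..1} (\<lambda>s. 1 / (norm (z + of_real (g s)))\<^sup>2)"
  proof (rule set_integrable_bounded)
    show "(\<lambda>s. indicator {0..1} s *\<^sub>R (1 / (norm (z + of_real (g s)))\<^sup>2)) \<in> borel_measurable borel"
      by (rule measurable_on_unit[OF g(1), of "\<lambda>u. 1 / (norm (z + of_real u))\<^sup>2"]) measurable
    fix s :: real
    have "1 / (norm (z + of_real (g s)))\<^sup>2 \<le> 1 / \<bar>y\<bar>\<^sup>2"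
      using ng[of s] y by (intro frac_le power_mono) auto
    then show "norm (1 / (norm (z + of_real (g s)))\<^sup>2) \<le> 1 / \<bar>y\<bar>\<^sup>2" by simp
  qed
  have ImA: "Im (A s) = y * (f s / (norm (1 - of_real (f s) * z))\<^sup>2)"
    and ReA: "Re (A s) - Re z / y * Im (A s) = - ((norm z)\<^sup>2 * ((f s)\<^sup>2 / (norm (1 - of_real (f s) * z))\<^sup>2))"
    if s: "s \<in> {0..1}" for s
  proof -
    let ?D = "(norm (1 - of_real (f s) * z))\<^sup>2"
    have D: "?D \<noteq> 0" using nf0[OF s] by simp
    have D_eq: "(Re (1 - of_real (f s) * z))\<^sup>2 + (Im (1 - of_real (f s) * z))\<^sup>2 = ?D"
      by (simp add: cmod_power2)
    have "Im (A s) = (Im (of_real (f s) * z) * Re (1 - of_real (f s) * z) - Re (of_real (f s) * z) * Im (1 - of_real (f s) * z)) / ?D"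
      unfolding A_def Im_divide D_eq ..
    also have "Im (of_real (f s) * z) * Re (1 - of_real (f s) * z) - Re (of_real (f s) * z) * Im (1 - of_real (f s) * z) = y * f s"
      by (simp add: y_def algebra_simps)
    finally show Im: "Im (A s) = y * (f s / ?D)" by simp
    have "Re (A s) = (Re (of_real (f s) * z) * Re (1 - of_real (f s) * z) + Im (of_real (f s) * z) * Im (1 - of_real (f s) * z)) / ?D"
      unfolding A_def Re_divide D_eq ..
    also have "Re (of_real (f s) * z) * Re (1 - of_real (f s) * z) + Im (of_real (f s) * z) * Im (1 - of_real (f s) * z)
        = f s * Re z - (norm z)\<^sup>2 * (f s)\<^sup>2"
      by (simp only: cmod_power2) (simp add: power2_eq_square algebra_simps)
    finally have "Re (A s) = (f s * Re z - (norm z)\<^sup>2 * (f s)\<^sup>2) / ?D" .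
    then show "Re (A s) - Re z / y * Im (A s) = - ((norm z)\<^sup>2 * ((f s)\<^sup>2 / ?D))"
      unfolding Im using y by (simp add: diff_divide_distrib)
  qed
  have ImB: "Im (Bg s) = - y * (g s / (norm (z + of_real (g s)))\<^sup>2)"
    and ReB: "Re (Bg s) - Re z / y * Im (Bg s) = 1 - (norm z)\<^sup>2 * (1 / (norm (z + of_real (g s)))\<^sup>2)" for s
  proof -
    let ?D = "(norm (z + of_real (g s)))\<^sup>2"
    have D: "?D \<noteq> 0" using ng0[of s] by simp
    have D_eq: "(Re (z + of_real (g s)))\<^sup>2 + (Im (z + of_real (g s)))\<^sup>2 = ?D"
      by (simp add: cmod_power2)
    have "Im (Bg s) = (Im (of_real (g s)) * Re (z + of_real (g s)) - Re (of_real (g s)) * Im (z + of_real (g s))) / ?D"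
      unfolding Bg_def Im_divide D_eq ..
    then show Im: "Im (Bg s) = - y * (g s / ?D)" by (simp add: y_def mult.commute)
    have "Re (Bg s) = (Re (of_real (g s)) * Re (z + of_real (g s)) + Im (of_real (g s)) * Im (z + of_real (g s))) / ?D"
      unfolding Bg_def Re_divide D_eq ..
    then have Re: "Re (Bg s) = g s * (Re z + g s) / ?D" by simp
    have "Re (Bg s) - Re z / y * Im (Bg s) = (g s * (Re z + g s) + Re z * g s) / ?D"
      unfolding Re Im using y by (simp add: add_divide_distrib)
    also have "g s * (Re z + g s) + Re z * g s = ?D - (norm z)\<^sup>2"
      by (simp only: cmod_power2) (simp add: power2_eq_square algebra_simps)
    also have "(?D - (norm z)\<^sup>2) / ?D = 1 - (norm z)\<^sup>2 * (1 / ?D)"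
      using D by (simp add: diff_divide_distrib)
    finally show "Re (Bg s) - Re z / y * Im (Bg s) = 1 - (norm z)\<^sup>2 * (1 / ?D)" .
  qed
  have iImA: "set_integrable lborel {0..1} (\<lambda>s. Im (A s))" and iReA: "set_integrable lborel {0..1} (\<lambda>s. Re (A s))"
    and iImB: "set_integrable lborel {0..1} (\<lambda>s. Im (Bg s))" and iReB: "set_integrable lborel {0..1} (\<lambda>s. Re (Bg s))"
    using iA iB by (simp_all only: set_integrable_Im set_integrable_Re)
  have "set_integrable lborel {0..1} (\<lambda>s. (1 / y) * Im (A s))"
    using iImA by (rule set_integrable_mult_right)
  then show i1: "set_integrable lborel {0..1} (\<lambda>s. f s / (norm (1 - of_real (f s) * z))\<^sup>2)"
    by (rule set_integrable_cong[THEN iffD1, rotated -1]) (use y ImA in auto)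
  have "set_integrable lborel {0..1} (\<lambda>s. (- 1 / y) * Im (Bg s))"
    using iImB by (rule set_integrable_mult_right)
  then show i2: "set_integrable lborel {0..1} (\<lambda>s. g s / (norm (z + of_real (g s)))\<^sup>2)"
    by (rule set_integrable_cong[THEN iffD1, rotated -1]) (use y ImB in auto)
  have E: "(LINT s:{0..1}|lborel. A s) + of_real c * (LINT s:{0..1}|lborel. Bg s) = of_real t"
    using root set_borel_integral_eq_integral(2)[OF iA] set_borel_integral_eq_integral(2)[OF iB]
    unfolding is_root_def A_def Bg_def by simp
  have ImLA: "Im (LINT s:{0..1}|lborel. A s) = (LINT s:{0..1}|lborel. Im (A s))"
    and ReLA: "Re (LINT s:{0..1}|lborel. A s) = (LINT s:{0..1}|lborel. Re (A s))"
    and ImLB: "Im (LINT s:{0..1}|lborel. Bg s) = (LINT s:{0..1}|lborel. Im (Bg s))"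
    and ReLB: "Re (LINT s:{0..1}|lborel. Bg s) = (LINT s:{0..1}|lborel. Re (Bg s))"
    by (simp_all only: Im_set_integral[OF iA] Re_set_integral[OF iA] Im_set_integral[OF iB] Re_set_integral[OF iB])
  have "(LINT s:{0..1}|lborel. Im (A s)) + c * (LINT s:{0..1}|lborel. Im (Bg s)) = 0"
    using arg_cong[OF E, of Im] by (simp add: ImLA ImLB)
  moreover have "(LINT s:{0..1}|lborel. Im (A s)) = y * (LINT s:{0..1}|lborel. f s / (norm (1 - of_real (f s) * z))\<^sup>2)"
    by (subst set_integral_mult_right[symmetric], rule set_lebesgue_integral_cong) (auto simp: ImA)
  moreover have "(LINT s:{0..1}|lborel. Im (Bg s)) = - y * (LINT s:{0..1}|lborel. g s / (norm (z + of_real (g s)))\<^sup>2)"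
    by (subst set_integral_mult_right[symmetric], rule set_lebesgue_integral_cong) (auto simp: ImB)
  ultimately have I0: "y * ((LINT s:{0..1}|lborel. f s / (norm (1 - of_real (f s) * z))\<^sup>2)
      - c * (LINT s:{0..1}|lborel. g s / (norm (z + of_real (g s)))\<^sup>2)) = 0"
    by (simp add: algebra_simps)
  then show "(LINT s:{0..1}|lborel. f s / (norm (1 - of_real (f s) * z))\<^sup>2)
      = c * (LINT s:{0..1}|lborel. g s / (norm (z + of_real (g s)))\<^sup>2)"
    using y by simp
  have "t = Re (of_real t) - Re z / y * Im (of_real t)" by simp
  also have "\<dots> = ((LINT s:{0..1}|lborel. Re (A s)) - Re z / y * (LINT s:{0..1}|lborel. Im (A s)))
      + c * ((LINT s:{0..1}|lborel. Re (Bg s)) - Re z / y * (LINT s:{0..1}|lborel. Im (Bg s)))"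
    unfolding E[symmetric] by (simp add: ImLA ReLA ImLB ReLB algebra_simps)
  also have "(LINT s:{0..1}|lborel. Re (A s)) - Re z / y * (LINT s:{0..1}|lborel. Im (A s))
      = (LINT s:{0..1}|lborel. - (norm z)\<^sup>2 * ((f s)\<^sup>2 / (norm (1 - of_real (f s) * z))\<^sup>2))"
  proof -
    have "(LINT s:{0..1}|lborel. Re (A s)) - Re z / y * (LINT s:{0..1}|lborel. Im (A s))
        = (LINT s:{0..1}|lborel. Re (A s) - Re z / y * Im (A s))"
      by (simp only: set_integral_diff(2)[OF iReA set_integrable_mult_right[OF iImA]] set_integral_mult_right)
    also have "\<dots> = (LINT s:{0..1}|lborel. - (norm z)\<^sup>2 * ((f s)\<^sup>2 / (norm (1 - of_real (f s) * z))\<^sup>2))"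
      by (rule set_lebesgue_integral_cong, simp, intro allI impI, simp only: ReA mult_minus_left)
    finally show ?thesis .
  qed
  also have "\<dots> = - (norm z)\<^sup>2 * (LINT s:{0..1}|lborel. (f s)\<^sup>2 / (norm (1 - of_real (f s) * z))\<^sup>2)"
    by (rule set_integral_mult_right)
  also have "(LINT s:{0..1}|lborel. Re (Bg s)) - Re z / y * (LINT s:{0..1}|lborel. Im (Bg s))
      = (LINT s:{0..1}|lborel. 1 - (norm z)\<^sup>2 * (1 / (norm (z + of_real (g s)))\<^sup>2))"
  proof -
    have "(LINT s:{0..1}|lborel. Re (Bg s)) - Re z / y * (LINT s:{0..1}|lborel. Im (Bg s))
        = (LINT s:{0..1}|lborel. Re (Bg s) - Re z / y * Im (Bg s))"
      by (simp only: set_integral_diff(2)[OF iReB set_integrable_mult_right[OF iImB]] set_integral_mult_right)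
    also have "\<dots> = (LINT s:{0..1}|lborel. 1 - (norm z)\<^sup>2 * (1 / (norm (z + of_real (g s)))\<^sup>2))"
      by (rule set_lebesgue_integral_cong, simp, intro allI impI, simp only: ReB mult_minus_left)
    finally show ?thesis .
  qed
  also have "\<dots> = 1 - (norm z)\<^sup>2 * (LINT s:{0..1}|lborel. 1 / (norm (z + of_real (g s)))\<^sup>2)"
  proof -
    have one: "set_integrable lborel {0..1::real} (\<lambda>s. 1 :: real)"
      by (rule set_integrable_bounded[of _ 1]) auto
    have "(LINT s:{0..1::real}|lborel. 1) = (1::real)"
      by (simp add: set_lebesgue_integral_def)
    then show ?thesis
      using set_integral_diff(2)[OF one set_integrable_mult_right[OF i4, of "(norm z)\<^sup>2"]]
      by (simp only: set_integral_mult_right)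
  qed
  finally show "c - t = (norm z)\<^sup>2 * ((LINT s:{0..1}|lborel. (f s)\<^sup>2 / (norm (1 - of_real (f s) * z))\<^sup>2)
      + c * (LINT s:{0..1}|lborel. 1 / (norm (z + of_real (g s)))\<^sup>2))"
    by (simp add: algebra_simps)
qed

text \<open>Logarithmic divergence: an affine map takes the segment to (0,1), and the part beyond
  \<kappa> already contributes - ln \<kappa> / B.\<close>

lemma nn_integral_inverse_infinite:
  fixes a p :: real
  assumes "a \<noteq> p" "0 < B" "open_segment a p \<subseteq> I"
  shows "(\<integral>\<^sup>+ s. indicator I s * ennreal (1 / (B * \<bar>s - a\<bar>)) \<partial>lborel) = \<infinity>"
proof (rule ccontr)
  let ?X = "\<integral>\<^sup>+ s. indicator I s * ennreal (1 / (B * \<bar>s - a\<bar>)) \<partial>lborel"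
  assume "?X \<noteq> \<infinity>"
  then obtain r where r: "?X = ennreal r" "0 \<le> r"
    by (cases ?X) auto
  define L where "L = \<bar>p - a\<bar>"
  have L: "0 < L" using assms(1) by (simp add: L_def)
  have bound: "- ln \<kappa> / B \<le> r" if \<kappa>: "0 < \<kappa>" "\<kappa> < 1" for \<kappa>
  proof -
    let ?h = "\<lambda>s. indicator (open_segment a p) s * ennreal (1 / (B * \<bar>s - a\<bar>))"
    have "ennreal (- ln \<kappa> / B) = (\<integral>\<^sup>+ u. ennreal (1 / (B * u)) * indicator {\<kappa>..1} u \<partial>lborel)"
    proof -
      have "(\<integral>\<^sup>+ u. ennreal (1 / (B * u)) * indicator {\<kappa>..1} u \<partial>lborel) = ennreal (ln 1 / B - ln \<kappa> / B)"
      proof (rule nn_integral_FTC_Icc)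
        fix u assume "u \<in> {\<kappa>..1}"
        then have "0 < u" using \<kappa> by simp
        then show "((\<lambda>u. ln u / B) has_real_derivative 1 / (B * u)) (at u)"
          using assms(2) by (auto intro!: derivative_eq_intros simp: field_simps)
        show "0 \<le> 1 / (B * u)" using \<open>0 < u\<close> assms(2) by simp
      qed (use \<kappa> in auto)
      then show ?thesis by simp
    qed
    also have "\<dots> = (\<integral>\<^sup>+ u. ennreal (1 / (B * u)) * indicator {\<kappa>..<1} u \<partial>lborel)"
      using AE_lborel_singleton[of 1] by (intro nn_integral_cong_AE) (auto simp: indicator_def elim!: eventually_mono)
    also have "\<dots> \<le> (\<integral>\<^sup>+ u. ennreal L * ?h (a + (p - a) * u) \<partial>lborel)"
    proof (rule nn_integral_mono)
      fix u
      show "ennreal (1 / (B * u)) * indicator {\<kappa>..<1} u \<le> ennreal L * ?h (a + (p - a) * u)"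
      proof (cases "u \<in> {\<kappa>..<1}")
        case True
        then have u: "0 < u" "u < 1" using \<kappa> by auto
        have "a + (p - a) * u \<in> open_segment a p"
          using u assms(1) unfolding in_segment by (auto intro!: exI[of _ u] simp: algebra_simps)
        moreover have "L * (1 / (B * \<bar>a + (p - a) * u - a\<bar>)) = 1 / (B * u)"
          using u L by (simp add: abs_mult L_def)
        ultimately show ?thesis
          using L True u assms(2) by (simp add: ennreal_mult[symmetric])
      qed simp
    qed
    also have "\<dots> = ennreal L * (\<integral>\<^sup>+ u. ?h (a + (p - a) * u) \<partial>lborel)"
      by (rule nn_integral_cmult) (auto intro!: borel_measurable_times_ennreal borel_measurable_indicator simp: open_segment_eq_real_ivl)
    also have "\<dots> = (\<integral>\<^sup>+ s. ?h s \<partial>lborel)"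
      unfolding L_def using assms(1)
      by (subst nn_integral_real_affine[of ?h "p - a" a]) (auto simp: open_segment_eq_real_ivl)
    also have "\<dots> \<le> ?X"
      using assms(3) by (intro nn_integral_mono mult_right_mono) (auto simp: indicator_def)
    finally show ?thesis
      using r by simp
  qed
  \<comment> \<open>The \<kappa> for which the lower bound equals r + 1.\<close>
  have "- ln (exp (- (B * (r + 1)))) / B \<le> r"
    using assms(2) r(2) by (intro bound) auto
  then show False using assms(2) by simp
qed

text \<open>The extension of g to the closure of a piece attains its minimum at some a. If the
  minimum were 0, the Lipschitz bound would give g \<le> B' |s - a| on the piece, and 1 / g would
  not be integrable there.\<close>

lemma integral_inverse_finite_imp_positive:
  assumes g: "piecewise_C1 g" and nonneg: "\<And>s. s \<in> {0..1} \<Longrightarrow> 0 \<le> g s"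
    and fin: "(\<integral>\<^sup>+ s. indicator {0..1} s * inverse (ennreal (g s)) \<partial>lborel) < \<infinity>"
  shows "\<exists>\<delta>>0. \<forall>s\<in>{0..1}. \<delta> \<le> g s"
proof -
  obtain P B where P: "finite P" "\<Union>P = {0..1}"
    and h: "\<forall>I\<in>P. is_interval I \<and> interior I \<noteq> {} \<and> bounded I \<and>
      (\<exists>h. (\<forall>s\<in>closure I. \<forall>t\<in>closure I. \<bar>h s - h t\<bar> \<le> B * \<bar>s - t\<bar>) \<and> (\<forall>s\<in>I. g s = h s))"
    using piecewise_C1_pieces[OF g] by (elim exE conjE)
  have piece: "\<exists>\<delta>>0. \<forall>s\<in>I. \<delta> \<le> g s" if I: "I \<in> P" for I
  proof -
    have int: "is_interval I" "interior I \<noteq> {}" "bounded I"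
      using h I by simp_all
    obtain h where lip: "\<And>s t. s \<in> closure I \<Longrightarrow> t \<in> closure I \<Longrightarrow> \<bar>h s - h t\<bar> \<le> B * \<bar>s - t\<bar>"
      and eq: "\<And>s. s \<in> I \<Longrightarrow> g s = h s"
      using h I by metis
    define B' where "B' = \<bar>B\<bar> + 1"
    have lip': "\<bar>h s - h t\<bar> \<le> B' * \<bar>s - t\<bar>" if "s \<in> closure I" "t \<in> closure I" for s t
      using lip[OF that] by (rule order_trans) (auto simp: B'_def intro!: mult_right_mono)
    have B': "0 < B'" by (simp add: B'_def add_nonneg_pos)
    have "B'-lipschitz_on (closure I) h"
      using lip' B' by (intro lipschitz_onI) (auto simp: dist_real_def)
    then have cont: "continuous_on (closure I) h"
      by (rule lipschitz_on_continuous_on)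
    have ne: "closure I \<noteq> {}" using int(2) interior_subset closure_subset by fastforce
    obtain a where a: "a \<in> closure I" "\<And>s. s \<in> closure I \<Longrightarrow> h a \<le> h s"
      using continuous_attains_inf[OF _ ne cont] int(3) by (auto simp: compact_closure)
    have I01: "I \<subseteq> {0..1}" using P(2) I by blast
    have "0 \<le> h a"
    proof -
      have "h ` closure I \<subseteq> closure {0..}"
      proof (rule image_closure_subset[OF cont])
        show "h ` I \<subseteq> closure {0..}"
          using nonneg eq I01 by (auto intro!: subsetD[OF closure_subset]) (metis atLeastAtMost_iff subsetD)
      qed simp
      then show ?thesis using a(1) by auto
    qed
    moreover have "h a \<noteq> 0"
    proof
      assume ha: "h a = 0"
      \<comment> \<open>The point a may lie outside the piece; the open segment from a to an
        interior point lies inside all the same.\<close>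
      obtain p where p: "p \<in> interior I" "p \<noteq> a"
      proof -
        have "infinite (interior I)"
          using int(2) open_interior by (metis finite_imp_not_open)
        then show ?thesis using that by (metis finite.emptyI finite_insert finite_subset insertI1 subsetI singletonD empty_iff insert_iff)
      qed
      have "open_segment a p \<subseteq> interior I"
        using in_interior_closure_convex_segment[of I p a] p(1) a(1) int(1)
        by (simp add: is_interval_convex open_segment_commute)
      then have seg: "open_segment a p \<subseteq> I" using interior_subset by blast
      have "\<infinity> = (\<integral>\<^sup>+ s. indicator I s * ennreal (1 / (B' * \<bar>s - a\<bar>)) \<partial>lborel)"
        using nn_integral_inverse_infinite[OF _ B' seg] p(2) by auto
      also have "\<dots> \<le> (\<integral>\<^sup>+ s. indicator {0..1} s * inverse (ennreal (g s)) \<partial>lborel)"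
      proof (rule nn_integral_mono)
        fix s
        show "indicator I s * ennreal (1 / (B' * \<bar>s - a\<bar>)) \<le> indicator {0..1} s * inverse (ennreal (g s))"
        proof (cases "s \<in> I")
          case True
          have le: "g s \<le> B' * \<bar>s - a\<bar>"
            using lip'[of s a] True a(1) closure_subset[of I] ha eq[OF True] by auto
          have "ennreal (1 / (B' * \<bar>s - a\<bar>)) \<le> inverse (ennreal (g s))"
          proof (cases "g s = 0")
            case False
            then have "0 < g s" using nonneg[of s] True I01 by (simp add: subset_iff order_less_le)
            then show ?thesis
              using le by (simp add: inverse_ennreal inverse_eq_divide ennreal_leI frac_le)
          qed simp
          then show ?thesis using True I01 by (auto simp: subset_iff)
        qed simp
      qed
      finally show False using fin by simp
    qed
    ultimately have "0 < h a" by simp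
    then show ?thesis
      using a(2) eq closure_subset by (intro exI[of _ "h a"]) auto
  qed
  then obtain \<delta> where \<delta>: "\<And>I. I \<in> P \<Longrightarrow> 0 < \<delta> I" "\<And>I s. I \<in> P \<Longrightarrow> s \<in> I \<Longrightarrow> \<delta> I \<le> g s"
    by metis
  have ne: "P \<noteq> {}" using P(2) by auto
  have "\<forall>s\<in>{0..1}. Min (\<delta> ` P) \<le> g s"
  proof
    fix s :: real assume "s \<in> {0..1}"
    then obtain I where "I \<in> P" "s \<in> I" using P(2) by blast
    then show "Min (\<delta> ` P) \<le> g s"
      using \<delta>(2) P(1) by (meson Min_le finite_imageI image_eqI order_trans)
  qed
  moreover have "0 < Min (\<delta> ` P)"
    using \<delta>(1) P(1) ne by (subst Min_gr_iff) auto
  ultimately show ?thesis by blast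
qed

text \<open>\<open>root_identities\<close> is applied to roots for t tending to c. The formula for c
  - t drives the roots to 0; in the balance of the imaginary part the integrands then tend to f and
  1 / g.\<close>

lemma critical_support:
  assumes f: "piecewise_C1 f" and g: "piecewise_C1 g"
    and fpos: "\<forall>s\<in>{0..1}. f s > 0" and gnn: "\<forall>s\<in>{0..1}. g s \<ge> 0"
    and c: "0 \<le> c" and supp: "is_support_interval f g c t_minus c"
  shows "0 < c" and "\<exists>\<delta>>0. \<forall>s\<in>{0..1}. \<delta> \<le> g s"
    and "(LINT s|lborel. indicator {0..1} s * f s) = c * (LINT s|lborel. indicator {0..1} s * (1 / g s))"
proof -
  have mf: "(\<lambda>s. indicator {0..1} s * f s) \<in> borel_measurable borel"
    and mg: "(\<lambda>s. indicator {0..1} s * g s) \<in> borel_measurable borel"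
    using f g by (simp_all add: piecewise_lipschitz_measurable piecewise_C1_imp_lipschitz)
  obtain M where M: "0 < M" "\<And>s. s \<in> {0..1} \<Longrightarrow> \<bar>f s\<bar> \<le> M"
    using piecewise_lipschitz_bounded[OF piecewise_C1_imp_lipschitz[OF f]] by metis
  obtain G where G: "0 < G" "\<And>s. s \<in> {0..1} \<Longrightarrow> \<bar>g s\<bar> \<le> G"
    using piecewise_lipschitz_bounded[OF piecewise_C1_imp_lipschitz[OF g]] by metis
  have t: "t_minus < c" and tt: "\<And>t. t_minus < t \<Longrightarrow> t < c \<Longrightarrow> two_conjugate_roots f g c t"
    using supp unfolding is_support_interval_def by auto
  have root: "\<exists>z. Im z \<noteq> 0 \<and> is_root f g c t z" if "t_minus < t" "t < c" for t
    using tt[OF that] unfolding two_conjugate_roots_def by blast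
  \<comment> \<open>The shift by 2 keeps c - \<epsilon> inside the support interval already at j =
    0.\<close>
  define \<epsilon> where "\<epsilon> = (\<lambda>j::nat. (c - t_minus) / (real j + 2))"
  have \<epsilon>0: "0 < \<epsilon> j" for j using t by (simp add: \<epsilon>_def)
  have \<epsilon>1: "\<epsilon> j < c - t_minus" for j using t by (simp add: \<epsilon>_def divide_less_eq)
  have \<epsilon>lim: "\<epsilon> \<longlonglongrightarrow> 0" unfolding \<epsilon>_def by real_asymp
  have "\<exists>z. Im z \<noteq> 0 \<and> is_root f g c (c - \<epsilon> j) z" for j
    using \<epsilon>0[of j] \<epsilon>1[of j] by (intro root) auto
  then obtain z where z: "\<And>j. Im (z j) \<noteq> 0" "\<And>j. is_root f g c (c - \<epsilon> j) (z j)"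
    by metis
  define r where "r = (\<lambda>j. norm (z j))"
  have r0: "0 < r j" for j using z(1)[of j] by (auto simp: r_def)
  have fpos': "\<And>s. s \<in> {0..1} \<Longrightarrow> 0 < f s" and gnn': "\<And>s. s \<in> {0..1} \<Longrightarrow> 0 \<le> g s"
    and gG: "\<And>s. s \<in> {0..1} \<Longrightarrow> g s \<le> G"
    using fpos gnn G(2) by (auto dest: abs_le_D1)
  note ids = root_identities[OF mf fpos' mg gnn' gG z(2) z(1)]
  let ?a = "\<lambda>j s. f s / (norm (1 - of_real (f s) * z j))\<^sup>2"
  let ?b = "\<lambda>j s. g s / (norm (z j + of_real (g s)))\<^sup>2"
  let ?d = "\<lambda>j s. 1 / (norm (z j + of_real (g s)))\<^sup>2"
  have one: "(LINT s:{0..1::real}|lborel. 1) = (1::real)" "set_integrable lborel {0..1::real} (\<lambda>s. 1 :: real)"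
    by (simp add: set_lebesgue_integral_def, rule set_integrable_bounded[of _ 1], auto)
  \<comment> \<open>For c = 0 the imaginary part would make the integral of a strictly positive
    function vanish.\<close>
  show c0: "0 < c"
  proof (rule ccontr)
    assume "\<not> 0 < c"
    then have "c = 0" using c by simp
    then have zero: "(LINT s:{0..1}|lborel. ?a 0 s) = 0" using ids(5)[of 0] by simp
    have int: "integrable lborel (\<lambda>s. indicator {0..1} s *\<^sub>R ?a 0 s)"
      using ids(1)[of 0] by (simp only: set_integrable_def)
    have "AE s in lborel. indicator {0..1} s *\<^sub>R ?a 0 s = 0"
      using zero fpos' unfolding set_lebesgue_integral_def
      by (subst integral_nonneg_eq_0_iff_AE[OF int, symmetric]) (auto simp: indicator_def less_imp_le)
    moreover have "?a 0 s \<noteq> 0" if s: "s \<in> {0..1}" for s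
    proof -
      have "1 - of_real (f s) * z 0 \<noteq> 0"
      proof
        assume "1 - of_real (f s) * z 0 = 0"
        from arg_cong[OF this, of Im] show False using z(1)[of 0] fpos'[OF s] by simp
      qed
      then show ?thesis using fpos'[OF s] by simp
    qed
    ultimately have "AE s in lborel. s \<notin> {0..1::real}"
      by (auto elim!: eventually_mono)
    then have "emeasure lborel {0..1::real} = 0"
      by (subst (asm) AE_iff_measurable[of "{0..1}"]) auto
    then show False by simp
  qed
  \<comment> \<open>The formula for c - t with its nonnegative f-part dropped.\<close>
  have dbound: "c * (r j)\<^sup>2 * (LINT s:{0..1}|lborel. ?d j s) \<le> \<epsilon> j" for j
  proof -
    have "0 \<le> (LINT s:{0..1}|lborel. (f s)\<^sup>2 / (norm (1 - of_real (f s) * z j))\<^sup>2)"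
      unfolding set_lebesgue_integral_def by (intro Bochner_Integration.integral_nonneg) simp
    then have "0 \<le> (r j)\<^sup>2 * (LINT s:{0..1}|lborel. (f s)\<^sup>2 / (norm (1 - of_real (f s) * z j))\<^sup>2)"
      by simp
    then show ?thesis
      using ids(6)[of j] unfolding r_def by (simp add: algebra_simps)
  qed
  \<comment> \<open>The g-integral is at least 1 / (r + G)^2, so c (r / (r + G))^2 is at most
    \<epsilon>. As r / (r + G) increases with r, large r are excluded.\<close>
  have rlim: "r \<longlonglongrightarrow> 0"
  proof (rule tendstoI)
    fix e :: real assume e: "0 < e"
    have "\<forall>\<^sub>F j in sequentially. \<epsilon> j < c * (e / (e + G))\<^sup>2"
      using \<epsilon>lim c0 e G(1) by (intro order_tendstoD(2)[of _ 0]) auto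
    then show "\<forall>\<^sub>F j in sequentially. dist (r j) 0 < e"
    proof eventually_elim
      case (elim j)
      have "r j < e"
      proof (rule ccontr)
        assume ge: "\<not> r j < e"
        have "1 / (r j + G)\<^sup>2 = (LINT s:{0..1::real}|lborel. 1 / (r j + G)\<^sup>2)"
          using one(1) by (simp add: set_lebesgue_integral_def)
        also have "\<dots> \<le> (LINT s:{0..1}|lborel. ?d j s)"
        proof (rule set_integral_mono)
          show "set_integrable lborel {0..1::real} (\<lambda>s. 1 / (r j + G)\<^sup>2)"
            by (rule set_integrable_bounded[of _ "1 / (r j + G)\<^sup>2"]) auto
          show "set_integrable lborel {0..1} (?d j)" by (rule ids(4))
          fix s :: real assume s: "s \<in> {0..1}"
          have "norm (z j + of_real (g s)) \<le> r j + G"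
            using norm_triangle_ineq[of "z j" "of_real (g s)"] G(2)[OF s] by (simp add: r_def)
          moreover have "0 < norm (z j + of_real (g s))"
          proof -
            have "0 < \<bar>Im (z j)\<bar>" using z(1)[of j] by simp
            then show ?thesis using norm_diff_Im_ge(1)[of "z j" "g s"] unfolding add.commute[of "complex_of_real (g s)"] by linarith
          qed
          ultimately show "1 / (r j + G)\<^sup>2 \<le> ?d j s"
            by (intro frac_le power_mono) auto
        qed
        finally have "c * (r j)\<^sup>2 * (1 / (r j + G)\<^sup>2) \<le> c * (r j)\<^sup>2 * (LINT s:{0..1}|lborel. ?d j s)"
          using c0 by (intro mult_left_mono) auto
        then have "c * (r j / (r j + G))\<^sup>2 \<le> \<epsilon> j"
          using dbound[of j] by (simp add: power_divide)
        moreover have "e / (e + G) \<le> r j / (r j + G)"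
          using ge e G(1) r0[of j] by (simp add: field_simps)
        then have "c * (e / (e + G))\<^sup>2 \<le> c * (r j / (r j + G))\<^sup>2"
          using e G(1) c0 by (intro mult_left_mono power_mono) auto
        ultimately show False using elim by simp
      qed
      then show ?case using r0[of j] by simp
    qed
  qed
  have zlim: "z \<longlonglongrightarrow> 0"
    using rlim unfolding r_def by (rule tendsto_norm_zero_cancel)
  have smallf: "\<forall>\<^sub>F j in sequentially. \<forall>s\<in>{0..1}. 1 / 2 \<le> norm (1 - of_real (f s) * z j)"
  proof -
    have "\<forall>\<^sub>F j in sequentially. r j < 1 / (2 * M)"
      using rlim M(1) by (intro order_tendstoD(2)[of _ 0]) auto
    then show ?thesis
    proof eventually_elim
      case (elim j)
      show ?case
      proof
        fix s :: real assume s: "s \<in> {0..1}"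
        have "norm (of_real (f s) * z j) = \<bar>f s\<bar> * r j"
          by (simp add: norm_mult r_def)
        also have "\<dots> \<le> M * (1 / (2 * M))"
          using elim M(1) M(2)[OF s] r0[of j] by (intro mult_mono) auto
        also have "\<dots> = 1 / 2" using M(1) by simp
        finally show "1 / 2 \<le> norm (1 - of_real (f s) * z j)"
          using norm_triangle_ineq2[of 1 "of_real (f s) * z j"] by simp
      qed
    qed
  qed
  have abound: "\<forall>\<^sub>F j in sequentially. \<forall>s\<in>{0..1}. ?a j s \<le> 4 * M"
    using smallf
  proof eventually_elim
    case (elim j)
    show ?case
    proof
      fix s :: real assume s: "s \<in> {0..1}"
      have "?a j s \<le> M / (1 / 2)\<^sup>2"
        using elim[rule_format, OF s] M(2)[OF s] fpos'[OF s] M(1) by (intro frac_le power_mono) auto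
      then show "?a j s \<le> 4 * M" by (simp add: power2_eq_square)
    qed
  qed
  obtain N where N: "\<And>j s. N \<le> j \<Longrightarrow> s \<in> {0..1} \<Longrightarrow> ?a j s \<le> 4 * M"
    using abound unfolding eventually_sequentially by blast
  have bint: "(LINT s:{0..1}|lborel. ?b j s) \<le> 4 * M / c" if "N \<le> j" for j
  proof -
    have "c * (LINT s:{0..1}|lborel. ?b j s) = (LINT s:{0..1}|lborel. ?a j s)"
      using ids(5)[of j] by simp
    also have "\<dots> \<le> (LINT s:{0..1::real}|lborel. 4 * M)"
      using N[OF that] by (intro set_integral_mono ids(1) set_integrable_bounded[of _ "4 * M"]) (use M(1) in auto)
    also have "\<dots> = 4 * M" by (simp add: set_lebesgue_integral_def)
    finally show ?thesis using c0 by (simp add: field_simps)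
  qed
  text \<open>The weight \<open>(r j)\<^sup>2 / \<epsilon> j\<close> is bounded in the mean, but on
    \<open>{g = 0}\<close> the second summand equals \<open>1 / \<epsilon> j \<longrightarrow> \<infinity>\<close>; so Fatou controls both
    \<open>1 / g\<close> and the zero set of \<open>g\<close> at once.\<close>
  define w where "w = (\<lambda>j s. ?b j s + (r j)\<^sup>2 / \<epsilon> j * ?d j s)"
  have wnn: "0 \<le> w j s" if "s \<in> {0..1}" for j s
    using gnn'[OF that] \<epsilon>0[of j] by (simp add: w_def)
  have wint: "set_integrable lborel {0..1} (w j)" for j
    unfolding w_def by (intro set_integral_add(1) ids(2) set_integrable_mult_right ids(4))
  have wle: "(LINT s:{0..1}|lborel. w j s) \<le> 4 * M / c + 1 / c" if "N \<le> j" for j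
  proof -
    have "(LINT s:{0..1}|lborel. w j s) = (LINT s:{0..1}|lborel. ?b j s) + (r j)\<^sup>2 / \<epsilon> j * (LINT s:{0..1}|lborel. ?d j s)"
      unfolding w_def by (simp only: set_integral_add(2)[OF ids(2) set_integrable_mult_right[OF ids(4)]] set_integral_mult_right)
    moreover have "(r j)\<^sup>2 / \<epsilon> j * (LINT s:{0..1}|lborel. ?d j s) \<le> 1 / c"
      using dbound[of j] \<epsilon>0[of j] c0 by (simp add: field_simps)
    ultimately show ?thesis using bint[OF that] by simp
  qed
  have wn: "(\<integral>\<^sup>+ s. indicator {0..1} s * ennreal (w j s) \<partial>lborel) \<le> ennreal (4 * M / c + 1 / c)" if "N \<le> j" for j
  proof -
    have "(\<integral>\<^sup>+ s. indicator {0..1} s * ennreal (w j s) \<partial>lborel) = (\<integral>\<^sup>+ s. ennreal (indicator {0..1} s *\<^sub>R w j s) \<partial>lborel)"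
      by (intro nn_integral_cong) (auto simp: indicator_def)
    also have "\<dots> = ennreal (LINT s:{0..1}|lborel. w j s)"
      unfolding set_lebesgue_integral_def using wint[of j] wnn
      by (intro nn_integral_eq_integral) (auto simp: set_integrable_def indicator_def)
    also have "\<dots> \<le> ennreal (4 * M / c + 1 / c)"
      using wle[OF that] by (rule ennreal_leI)
    finally show ?thesis .
  qed
  have liminf_w: "indicator {0..1} s * inverse (ennreal (g s)) \<le> liminf (\<lambda>j. indicator {0..1} s * ennreal (w j s))" for s :: real
  proof (cases "s \<in> {0..1}")
    case s: True
    show ?thesis
    proof (cases "g s = 0")
      case True
      have "w j s = 1 / \<epsilon> j" for j
        using True r0[of j] by (simp add: w_def r_def)
      moreover have "filterlim (\<lambda>j. 1 / \<epsilon> j) at_top sequentially"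
        unfolding \<epsilon>_def using t by real_asymp
      then have "(\<lambda>j. ennreal (1 / \<epsilon> j)) \<longlonglongrightarrow> \<infinity>"
        by (simp add: ennreal_tendsto_top_eq_at_top)
      ultimately have "liminf (\<lambda>j. ennreal (w j s)) = \<infinity>"
        by (simp add: lim_imp_Liminf)
      then show ?thesis using s by simp
    next
      case False
      then have gs: "0 < g s" using gnn'[OF s] by simp
      have "(\<lambda>j. ?b j s) \<longlonglongrightarrow> g s / (norm (0 + of_real (g s) :: complex))\<^sup>2"
        using gs by (intro tendsto_intros zlim) auto
      also have "g s / (norm (0 + of_real (g s) :: complex))\<^sup>2 = 1 / g s"
        using gs by (simp add: power2_eq_square)
      finally have "(\<lambda>j. ennreal (?b j s)) \<longlonglongrightarrow> ennreal (1 / g s)"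
        by (rule tendsto_ennrealI)
      then have "ennreal (1 / g s) = liminf (\<lambda>j. ennreal (?b j s))"
        by (simp add: lim_imp_Liminf)
      also have "\<dots> \<le> liminf (\<lambda>j. ennreal (w j s))"
        using \<epsilon>0 by (intro Liminf_mono always_eventually allI ennreal_leI) (simp add: w_def less_imp_le)
      finally show ?thesis using s gs by (simp add: inverse_ennreal inverse_eq_divide)
    qed
  qed simp
  have "(\<integral>\<^sup>+ s. indicator {0..1} s * inverse (ennreal (g s)) \<partial>lborel)
      \<le> (\<integral>\<^sup>+ s. liminf (\<lambda>j. indicator {0..1} s * ennreal (w j s)) \<partial>lborel)"
    by (intro nn_integral_mono liminf_w)
  also have "\<dots> \<le> liminf (\<lambda>j. \<integral>\<^sup>+ s. indicator {0..1} s * ennreal (w j s) \<partial>lborel)"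
  proof (rule nn_integral_liminf)
    fix j
    have "(\<lambda>s. ennreal (indicator {0..1} s *\<^sub>R w j s)) \<in> borel_measurable lborel"
      using wint[of j] unfolding set_integrable_def by auto
    moreover have "(\<lambda>s. ennreal (indicator {0..1} s *\<^sub>R w j s)) = (\<lambda>s. indicator {0..1} s * ennreal (w j s))"
      by (auto simp: indicator_def fun_eq_iff)
    ultimately show "(\<lambda>s. indicator {0..1} s * ennreal (w j s)) \<in> borel_measurable lborel" by simp
  qed
  also have "\<dots> \<le> ennreal (4 * M / c + 1 / c)"
    using wn by (intro Liminf_le) (auto simp: eventually_sequentially)
  finally have fin: "(\<integral>\<^sup>+ s. indicator {0..1} s * inverse (ennreal (g s)) \<partial>lborel) < \<infinity>"
    by (rule le_less_trans) simp
  show ex: "\<exists>\<delta>>0. \<forall>s\<in>{0..1}. \<delta> \<le> g s"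
    by (rule integral_inverse_finite_imp_positive[OF g gnn' fin])
  then obtain \<delta> where \<delta>: "0 < \<delta>" "\<And>s. s \<in> {0..1} \<Longrightarrow> \<delta> \<le> g s" by blast
  have "\<forall>\<^sub>F j in sequentially. r j < \<delta> / 2"
    using rlim \<delta>(1) by (intro order_tendstoD(2)[of _ 0]) auto
  then obtain N' where N': "\<And>j. N' \<le> j \<Longrightarrow> r j < \<delta> / 2"
    unfolding eventually_sequentially by blast
  have b_le: "?b j s \<le> G / (\<delta> / 2)\<^sup>2" if "N' \<le> j" "s \<in> {0..1}" for j s
  proof -
    have "\<delta> / 2 \<le> norm (z j + of_real (g s))"
      using norm_diff_ineq[of "of_real (g s)" "z j"] N'[OF that(1)] \<delta>(2)[OF that(2)] gnn'[OF that(2)]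
      by (simp add: r_def add.commute)
    then show ?thesis
      using G(1) gG[OF that(2)] gnn'[OF that(2)] \<delta>(1) by (intro frac_le power_mono) auto
  qed
  \<comment> \<open>Both sides of the imaginary-part balance now have bounded integrands: near z = 0
    the f-side is bounded by 4 M, the g-side by means of \<delta>.\<close>
  have la: "(\<lambda>j. LINT s:{0..1}|lborel. ?a (j + N) s) \<longlonglongrightarrow> (LINT s:{0..1}|lborel. f s)"
    unfolding set_lebesgue_integral_def
  proof (rule integral_dominated_convergence)
    show "integrable lborel (\<lambda>s. indicator {0..1::real} s * (4 * M))"
      by (intro integrable_mult_left integrable_real_indicator) auto
    show "(\<lambda>s. indicator {0..1} s *\<^sub>R f s) \<in> borel_measurable lborel"
      using mf by simp
    show "(\<lambda>s. indicator {0..1} s *\<^sub>R ?a (j + N) s) \<in> borel_measurable lborel" for j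
      using ids(1)[of "j + N"] unfolding set_integrable_def by (rule borel_measurable_integrable)
    show "AE s in lborel. (\<lambda>j. indicator {0..1} s *\<^sub>R ?a (j + N) s) \<longlonglongrightarrow> indicator {0..1} s *\<^sub>R f s"
    proof (rule AE_I2)
      fix s :: real
      have "(\<lambda>j. ?a (j + N) s) \<longlonglongrightarrow> f s / (norm (1 - of_real (f s) * 0 :: complex))\<^sup>2"
        by (intro tendsto_intros LIMSEQ_ignore_initial_segment[OF zlim]) auto
      then show "(\<lambda>j. indicator {0..1} s *\<^sub>R ?a (j + N) s) \<longlonglongrightarrow> indicator {0..1} s *\<^sub>R f s"
        by (intro tendsto_intros) simp
    qed
    show "AE s in lborel. norm (indicator {0..1} s *\<^sub>R ?a (j + N) s) \<le> indicator {0..1} s * (4 * M)" for j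
      using N[of "j + N"] fpos' by (intro AE_I2) (auto simp: indicator_def less_imp_le)
  qed
  have lb: "(\<lambda>j. LINT s:{0..1}|lborel. ?b (j + N') s) \<longlonglongrightarrow> (LINT s:{0..1}|lborel. 1 / g s)"
    unfolding set_lebesgue_integral_def
  proof (rule integral_dominated_convergence)
    show "integrable lborel (\<lambda>s. indicator {0..1::real} s * (G / (\<delta> / 2)\<^sup>2))"
      by (intro integrable_mult_left integrable_real_indicator) auto
    show "(\<lambda>s. indicator {0..1} s *\<^sub>R (1 / g s)) \<in> borel_measurable lborel"
      using measurable_on_unit[OF mg, of "\<lambda>u. 1 / u"] by simp
    show "(\<lambda>s. indicator {0..1} s *\<^sub>R ?b (j + N') s) \<in> borel_measurable lborel" for j
      using ids(2)[of "j + N'"] unfolding set_integrable_def by (rule borel_measurable_integrable)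
    show "AE s in lborel. (\<lambda>j. indicator {0..1} s *\<^sub>R ?b (j + N') s) \<longlonglongrightarrow> indicator {0..1} s *\<^sub>R (1 / g s)"
    proof (rule AE_I2)
      fix s :: real
      show "(\<lambda>j. indicator {0..1} s *\<^sub>R ?b (j + N') s) \<longlonglongrightarrow> indicator {0..1} s *\<^sub>R (1 / g s)"
      proof (cases "s \<in> {0..1}")
        case True
        then have gs: "0 < g s" using \<delta>(2)[OF True] \<delta>(1) by linarith
        have "(\<lambda>j. ?b (j + N') s) \<longlonglongrightarrow> g s / (norm (0 + of_real (g s) :: complex))\<^sup>2"
          using gs by (intro tendsto_intros LIMSEQ_ignore_initial_segment[OF zlim]) auto
        also have "g s / (norm (0 + of_real (g s) :: complex))\<^sup>2 = 1 / g s"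
          using gs by (simp add: power2_eq_square)
        finally show ?thesis by (intro tendsto_scaleR tendsto_const)
      qed simp
    qed
    show "AE s in lborel. norm (indicator {0..1} s *\<^sub>R ?b (j + N') s) \<le> indicator {0..1} s * (G / (\<delta> / 2)\<^sup>2)" for j
      using b_le[of "j + N'"] gnn' by (intro AE_I2) (auto simp: indicator_def)
  qed
  have "(\<lambda>j. LINT s:{0..1}|lborel. ?a j s) \<longlonglongrightarrow> (LINT s:{0..1}|lborel. f s)"
    using la by (rule LIMSEQ_offset)
  moreover have "(\<lambda>j. LINT s:{0..1}|lborel. ?a j s) \<longlonglongrightarrow> c * (LINT s:{0..1}|lborel. 1 / g s)"
  proof -
    have "(\<lambda>j. LINT s:{0..1}|lborel. ?a j s) = (\<lambda>j. c * (LINT s:{0..1}|lborel. ?b j s))"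
      using ids(5) by (intro ext)
    then show ?thesis using tendsto_mult_left[OF LIMSEQ_offset[OF lb], of c] by (simp only:)
  qed
  ultimately have "(LINT s:{0..1}|lborel. f s) = c * (LINT s:{0..1}|lborel. 1 / g s)"
    by (rule LIMSEQ_unique)
  then show "(LINT s|lborel. indicator {0..1} s * f s) = c * (LINT s|lborel. indicator {0..1} s * (1 / g s))"
    by (simp add: set_lebesgue_integral_def)
qed

subsection \<open>The law of the first row\<close>

lemma schur_scale:
  "schur n lam (\<lambda>i. t * x i) = t ^ card (cells lam) * schur n lam x"
  by (simp add: schur_def prod.distrib sum_distrib_left)

lemma card_cells_conjugate:
  assumes "lam \<in> partitions n"
  shows "card (cells (conjugate lam)) = card (cells lam)"
  unfolding cells_conjugate[OF assms] by (intro card_image) simp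

lemma schur_nonneg:
  assumes "\<And>i. i \<in> {1..n} \<Longrightarrow> 0 \<le> x i"
  shows "0 \<le> schur n lam x"
  unfolding schur_def
proof (intro sum_nonneg prod_nonneg)
  fix T u assume "T \<in> ssyt n lam" "u \<in> cells lam"
  then have "T u \<in> {1..n}" by (auto simp: ssyt_def)
  then show "0 \<le> x (T u)" by (rule assms)
qed

lemma diagrams_in_box_partitions: "lam \<in> diagrams_in_box n k \<Longrightarrow> lam \<in> partitions n"
  unfolding diagrams_in_box_def partitions_def by auto

lemma measure_point_measure_eq_sum:
  assumes "finite A" "\<And>a. a \<in> A \<Longrightarrow> 0 \<le> p a" "S \<subseteq> A"
  shows "measure (point_measure A (\<lambda>a. ennreal (p a))) S = sum p S"
proof -
  have "emeasure (point_measure A (\<lambda>a. ennreal (p a))) S = (\<Sum>a\<in>S. ennreal (p a))"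
    by (rule emeasure_point_measure_finite[OF assms(1,3)])
  also have "\<dots> = ennreal (sum p S)"
    using assms(2,3) by (intro sum_ennreal) auto
  finally show ?thesis
    using assms(2,3) by (simp add: measure_def sum_nonneg subset_iff)
qed

lemma mu_nonneg:
  assumes "\<forall>s\<in>{0..1}. 0 \<le> f s" "\<forall>s\<in>{0..1}. 0 \<le> g s"
  shows "0 \<le> mu f g n k lam"
proof -
  have x: "0 \<le> f (real i / real n)" if "i \<in> {1..n}" for i
    using assms(1) that by auto
  have y: "0 \<le> g (real j / real k)" if "j \<in> {1..k}" for j
    using assms(2) that by auto
  show ?thesis
    unfolding mu_def Let_def
    by (intro divide_nonneg_nonneg mult_nonneg_nonneg schur_nonneg prod_nonneg add_nonneg_nonneg)
      (use x y in auto)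
qed

lemma measure_diagram_law:
  assumes "\<forall>s\<in>{0..1}. 0 \<le> f s" "\<forall>s\<in>{0..1}. 0 \<le> g s"
  shows "measure (diagram_law f g n k) {lam \<in> diagrams_in_box n k. Q lam}
    = (\<Sum>lam\<in>{lam \<in> diagrams_in_box n k. Q lam}. mu f g n k lam)"
  unfolding diagram_law_def
  by (intro measure_point_measure_eq_sum mu_nonneg[OF assms] finite_diagrams_in_box Collect_restrict)

lemma of_real_in_half_ball:
  assumes "0 < x" "x < 1"
  shows "complex_of_real x \<in> ball (1/2) (1/2)"
proof -
  have "1 / 2 - complex_of_real x = of_real (1 / 2 - x)" by simp
  then have "dist (1/2) (complex_of_real x) = \<bar>1 / 2 - x\<bar>"
    by (simp only: dist_norm norm_of_real)
  moreover have "\<bar>1 / 2 - x\<bar> < 1 / 2" using assms by linarith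
  ultimately show ?thesis by (simp only: mem_ball)
qed

lemma one_plus_mult_half_disc_neq_0:
  assumes "0 < y" "w \<in> half_disc"
  shows "1 + complex_of_real y * w \<noteq> 0"
proof
  assume "1 + complex_of_real y * w = 0"
  then have "Re (1 + complex_of_real y * w) = 0" by simp
  then have e: "1 + y * Re w = 0" by simp
  have "norm (1/2 - w) \<le> 1/2" using assms(2) by (simp add: dist_norm)
  then have "Re (1/2 - w) \<le> 1/2" using complex_Re_le_cmod[of "1/2 - w"] by linarith
  then have "0 \<le> Re w" by simp
  then have "0 \<le> y * Re w" using assms(1) by simp
  then show False using e by linarith
qed

text \<open>The two Schur polynomials are homogeneous of the same degree, so the factors S cancel
  while the nodes move into the disc. The denominator of the measure is the product split off by
  \<open>ldet_gap\<close>.\<close>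

lemma sum_mu_eq_ldet:
  fixes f g :: "real \<Rightarrow> real" and n k d :: nat and S :: real
  defines "X \<equiv> \<lambda>i. f (real (n - i) / real n) / S"
    and "Y \<equiv> \<lambda>j. g (real j / real k) * S"
  assumes n: "0 < n" and d: "d \<le> n" "d \<le> k" and S: "0 < S"
    and x0: "\<And>i. i < n \<Longrightarrow> 0 < X i" and x1: "\<And>i. i < n \<Longrightarrow> X i < 1"
    and y: "\<And>j. j \<in> {1..k} \<Longrightarrow> 0 < Y j"
  shows "of_real (\<Sum>lam\<in>{lam \<in> diagrams_in_box n k. lam 0 \<le> k - d}. mu f g n k lam)
    = ldet d (\<lambda>r s. (if r = s then 1 else 0)
        - gap_kernel (\<lambda>i. of_real (X i)) (\<lambda>j. of_real (Y j)) n k d r s)"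
proof -
  define x where "x = (\<lambda>i. f (real i / real n) / S)"
  let ?B = "{lam \<in> diagrams_in_box n k. lam 0 \<le> k - d}"
  define Z where "Z = (\<Prod>i=1..n. \<Prod>j=1..k. 1 + f (real i / real n) * g (real j / real k))"
  have "mu f g n k lam * Z = schur n lam x * schur k (conjugate lam) Y"
    if "lam \<in> ?B" and "Z \<noteq> 0" for lam
  proof -
    have p: "lam \<in> partitions n" using that by (auto intro: diagrams_in_box_partitions)
    have "schur n lam x = (1 / S) ^ card (cells lam) * schur n lam (\<lambda>i. f (real i / real n))"
      unfolding x_def using schur_scale[of n lam "1 / S" "\<lambda>i. f (real i / real n)"] by simp
    moreover have "schur k (conjugate lam) Y = S ^ card (cells lam) * schur k (conjugate lam) (\<lambda>j. g (real j / real k))"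
      unfolding Y_def using schur_scale[of k "conjugate lam" S "\<lambda>j. g (real j / real k)"]
      by (simp add: card_cells_conjugate[OF p] mult.commute)
    ultimately show ?thesis
      using S that(2) unfolding mu_def Let_def Z_def[symmetric] by (simp add: power_one_over)
  qed
  note muZ = this
  have Zeq: "Z = (\<Prod>i<n. \<Prod>j=1..k. 1 + Y j * X i)"
    unfolding Z_def
    by (rule prod.reindex_bij_witness[where i = "\<lambda>i. n - i" and j = "\<lambda>i. n - i"])
      (use S in \<open>auto simp: X_def Y_def mult.commute intro!: prod.cong\<close>)
  have Zpos: "0 < Z"
    unfolding Zeq
  proof (intro prod_pos ballI)
    fix i j assume "i \<in> {..<n}" "j \<in> {1..k}"
    then show "0 < 1 + Y j * X i"
      using y[of j] x0[of i] by (intro add_pos_pos mult_pos_pos) auto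
  qed
  have xX: "(\<lambda>i. x (n - i)) = X" unfolding x_def X_def ..
  have "(\<Sum>lam\<in>?B. mu f g n k lam) * Z = (\<Sum>lam\<in>?B. schur n lam x * schur k (conjugate lam) Y)"
    unfolding sum_distrib_right using muZ Zpos by (intro sum.cong) auto
  also have "\<dots> = ldet n (\<lambda>i j. shift_factors Y k (\<lambda>p. if p < n + (k - d) then divdiff X i p else 0) j)"
    unfolding sum_schur_schur[OF n] xX ..
  finally have "of_real ((\<Sum>lam\<in>?B. mu f g n k lam) * Z)
      = ldet n (\<lambda>i j. complex_of_real (shift_factors Y k (\<lambda>p. if p < n + (k - d) then divdiff X i p else 0) j))"
    by (simp only: of_real_ldet)
  also have "\<dots> = ldet n (\<lambda>i j. shift_factors (\<lambda>j. of_real (Y j)) k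
      (\<lambda>p. if p < n + (k - d) then divdiff (\<lambda>i. complex_of_real (X i)) i p else 0) j)"
    unfolding of_real_shift_factors
    by (simp only: of_real_divdiff[symmetric] if_distrib[of complex_of_real] of_real_0)
  also have "\<dots> = of_real Z * ldet d (\<lambda>r s. (if r = s then 1 else 0)
        - gap_kernel (\<lambda>i. of_real (X i)) (\<lambda>j. of_real (Y j)) n k d r s)"
    using ldet_gap[of n "\<lambda>i. of_real (X i)" k "\<lambda>j. of_real (Y j)" d, OF of_real_in_half_ball one_plus_mult_half_disc_neq_0 d, OF x0 x1 y]
    unfolding Zeq by (simp only: of_real_prod of_real_add of_real_mult of_real_1)
  finally show ?thesis using Zpos by (simp add: mult.commute)
qed

section \<open>Identification of the limiting kernel\<close>

lemma rGamma_reflection_real: "rGamma (x::real) * rGamma (1 - x) = sin (pi * x) / pi"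
proof -
  have "complex_of_real (rGamma x * rGamma (1 - x)) = of_real (sin (pi * x) / pi)"
    using rGamma_reflection_complex[of "of_real x"]
    by (simp flip: rGamma_complex_of_real sin_of_real)
  then show ?thesis by (simp only: of_real_eq_iff)
qed

text \<open>The origin of the two branches of \<open>K_crit\<close>: reflection turns 1 / \<Gamma>(1
  - a) into sin (pi a) \<Gamma>(a) / pi. At a pole of \<Gamma>(a) that product makes no sense, but
  there 1 - a is a positive integer and \<Gamma>(1 - a) a factorial.\<close>

lemma rGamma_half_eq:
  fixes l r s :: nat
  defines "a \<equiv> real l + (real r - real s) / 2"
  shows "(-1) ^ l / fact l * (rGamma (1 - a) / 2) = (if a \<in> \<int>\<^sub>\<le>\<^sub>0
        then 1 / 2 * ((-1) ^ l / (fact l * fact ((s - r) div 2 - l)))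
        else 1 / (2 * pi) * (1 / fact l) * sin (pi * (real r - real s) / 2) * Gamma a)"
proof (cases "a \<in> \<int>\<^sub>\<le>\<^sub>0")
  case True
  then obtain p where p: "a = - real p" by (elim nonpos_Ints_cases')
  \<comment> \<open>The equation a = - p forces s - r = 2 l + 2 p, so the division and the
    subtraction of natural numbers in \<open>K_crit\<close> are exact.\<close>
  then have "real l + (real r - real s) / 2 = - real p" unfolding a_def .
  then have "real s = real r + 2 * real l + 2 * real p" by (simp add: field_simps)
  then have "real s = real (r + 2 * l + 2 * p)" by simp
  then have "s = r + 2 * l + 2 * p" by (simp only: of_nat_eq_iff)
  then have "(s - r) div 2 - l = p" by simp
  moreover have "rGamma (1 - a) = 1 / fact p"
    using Gamma_fact[of p, where 'a = real] by (simp add: p rGamma_inverse_Gamma inverse_eq_divide)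
  ultimately show ?thesis using True by simp
next
  case False
  then have G: "rGamma a \<noteq> 0" by (simp add: rGamma_eq_zero_iff)
  have "pi * a = pi * (real r - real s) / 2 + real l * pi"
    by (simp add: a_def algebra_simps)
  then have "sin (pi * a) = (-1) ^ l * sin (pi * (real r - real s) / 2)"
    by (simp only: sin_add sin_npi cos_npi) simp
  moreover have "rGamma (1 - a) = sin (pi * a) / pi * Gamma a"
    using rGamma_reflection_real[of a] G unfolding Gamma_def by (simp add: field_simps)
  ultimately have "rGamma (1 - a) = (-1) ^ l * sin (pi * (real r - real s) / 2) / pi * Gamma a"
    by simp
  moreover have "(-1::real) ^ l * (-1) ^ l = 1"
    by (simp flip: power_mult_distrib)
  ultimately show ?thesis using False by (simp add: mult.assoc[symmetric])
qed

lemma sum_even_terms: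
  fixes F :: "nat \<Rightarrow> 'a::comm_monoid_add"
  shows "(\<Sum>l\<le>N. if even l then F l else 0) = (\<Sum>l=0..N div 2. F (2 * l))"
proof -
  have "(\<Sum>l\<le>N. if even l then F l else 0) = (\<Sum>l\<in>{l \<in> {..N}. even l}. F l)"
    by (rule sum.inter_filter[symmetric]) simp
  also have "\<dots> = (\<Sum>l=0..N div 2. F (2 * l))"
    by (rule sum.reindex_bij_witness[where i = "\<lambda>l. 2 * l" and j = "\<lambda>l. l div 2"]) auto
  finally show ?thesis .
qed

text \<open>Odd coefficients of exp (- z^2) vanish, and the index 2 l of an even one turns the
  argument 1 - m/2 of \<open>hankel_eq\<close> into 1 - a. The row r of the gap kernel limits the
  sum, as the column j does in \<open>K_crit\<close>; hence the transposed arguments.\<close>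

lemma K_crit_eq_hankel:
  "complex_of_real (K_crit \<Delta> s r)
    = (\<Sum>l\<le>\<Delta> - 1 - r. of_real (if even l then (-1) ^ (l div 2) / fact (l div 2) else 0)
        * hankel (int l + int r - int s))"
proof -
  have "(\<Sum>l\<le>\<Delta> - 1 - r. of_real (if even l then (-1) ^ (l div 2) / fact (l div 2) else 0)
        * hankel (int l + int r - int s))
    = (\<Sum>l\<le>\<Delta> - 1 - r. if even l then of_real ((-1) ^ (l div 2) / fact (l div 2))
        * hankel (int l + int r - int s) else 0)"
    by (intro sum.cong) auto
  also have "\<dots> = (\<Sum>l=0..(\<Delta> - 1 - r) div 2. of_real ((-1) ^ l / fact l)
        * hankel (int (2 * l) + int r - int s))"
    unfolding sum_even_terms by simp
  also have "\<dots> = of_real (\<Sum>l=0..(\<Delta> - 1 - r) div 2. (-1) ^ l / fact l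
        * (rGamma (1 - (real l + (real r - real s) / 2)) / 2))"
  proof -
    have "1 - real_of_int (int (2 * l) + int r - int s) / 2 = 1 - (real l + (real r - real s) / 2)" for l
      by (simp add: field_simps)
    then show ?thesis
      unfolding hankel_eq of_real_mult[symmetric] of_real_sum[symmetric] by (simp only:)
  qed
  also have "\<dots> = of_real (K_crit \<Delta> s r)"
    unfolding K_crit_def rGamma_half_eq by (simp only: diff_commute)
  finally show ?thesis ..
qed

lemma tendsto_ldet:
  fixes A :: "'b \<Rightarrow> nat \<Rightarrow> nat \<Rightarrow> complex"
  assumes "\<And>i j. i < d \<Longrightarrow> j < d \<Longrightarrow> ((\<lambda>n. A n i j) \<longlongrightarrow> L i j) F"
  shows "((\<lambda>n. ldet d (A n)) \<longlongrightarrow> ldet d L) F"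
  unfolding ldet_leibniz
  by (intro tendsto_sum tendsto_mult tendsto_const tendsto_prod assms) (auto dest: permutes_lt)

lemma crit_det_eq_ldet:
  "complex_of_real (crit_det \<Delta>) = ldet \<Delta> (\<lambda>r s. (if r = s then 1 else 0) - of_real (K_crit \<Delta> s r))"
proof -
  have "crit_det \<Delta> = ldet \<Delta> (\<lambda>i j. (if i = j then 1 else 0) - K_crit \<Delta> i j)"
    by (simp add: crit_det_def ldet_def)
  also have "\<dots> = ldet \<Delta> (\<lambda>r s. (if r = s then 1 else 0) - K_crit \<Delta> s r)"
    by (subst ldet_transpose) (intro ldet_cong, auto)
  finally show ?thesis
    unfolding of_real_ldet[symmetric]
    by (simp add: of_real_ldet if_distrib[of complex_of_real] cong: if_cong)
qed

lemma piecewise_lipschitz_inverse: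
  assumes g: "piecewise_lipschitz g" and \<delta>: "0 < \<delta>" "\<forall>s\<in>{0..1}. \<delta> \<le> g s"
  shows "piecewise_lipschitz (\<lambda>s. 1 / g s)"
proof -
  obtain P B where P: "finite P" "\<Union>P = {0..1}"
    and I: "\<forall>I\<in>P. is_interval I \<and> interior I \<noteq> {} \<and>
        (\<forall>s\<in>I. \<forall>t\<in>I. \<bar>g s - g t\<bar> \<le> B * \<bar>s - t\<bar>)"
    using g unfolding piecewise_lipschitz_def by (elim exE conjE)
  have "\<bar>1 / g s - 1 / g t\<bar> \<le> B / \<delta>\<^sup>2 * \<bar>s - t\<bar>" if "I \<in> P" "s \<in> I" "t \<in> I" for I s t
  proof -
    have s: "\<delta> \<le> g s" and t: "\<delta> \<le> g t"
      using \<delta>(2) P(2) that by blast+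
    have "\<bar>1 / g s - 1 / g t\<bar> = \<bar>g s - g t\<bar> / (g s * g t)"
      using s t \<delta>(1) by (simp add: diff_divide_distrib[symmetric] divide_simps abs_mult abs_minus_commute)
    also have "\<dots> \<le> B * \<bar>s - t\<bar> / \<delta>\<^sup>2"
    proof (rule frac_le)
      show num: "\<bar>g s - g t\<bar> \<le> B * \<bar>s - t\<bar>" using I that by blast
      show "0 \<le> B * \<bar>s - t\<bar>" by (rule order_trans[OF abs_ge_zero num])
      show "\<delta>\<^sup>2 \<le> g s * g t" unfolding power2_eq_square using s t \<delta>(1) by (intro mult_mono) auto
    qed (use \<delta>(1) in simp)
    finally show ?thesis by simp
  qed
  then show ?thesis
    unfolding piecewise_lipschitz_def using P I
    by (intro exI[of _ P] exI[of _ "B / \<delta>\<^sup>2"]) blast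
qed

text \<open>The factors of the generating polynomial form one family of small numbers with vanishing
  sum and squares adding up to 2, so coefficients and line integrals converge, and with them the
  determinant of fixed size.\<close>

lemma first_row_gap_limit:
  fixes f g :: "real \<Rightarrow> real" and k :: "nat \<Rightarrow> nat" and c :: real and \<Delta> :: nat
  assumes f: "piecewise_lipschitz f" and g: "piecewise_lipschitz g"
    and fpos: "\<forall>s\<in>{0..1}. 0 < f s" and \<delta>: "0 < \<delta>" "\<forall>s\<in>{0..1}. \<delta> \<le> g s"
    and balance: "(LINT s|lborel. indicator {0..1} s * f s)
      = c * (LINT s|lborel. indicator {0..1} s * (1 / g s))"
    and c: "0 < c" and kinf: "filterlim k at_top sequentially"
    and kc: "(\<lambda>n. real (k n) / real n) \<longlonglongrightarrow> c"
    and kn: "(\<lambda>n. (real (k n) - real n * c) / sqrt (real n)) \<longlonglongrightarrow> 0"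
  shows "(\<lambda>n. \<Sum>lam\<in>{lam \<in> diagrams_in_box n (k n). lam 0 \<le> k n - \<Delta>}. mu f g n (k n) lam) \<longlonglongrightarrow> crit_det \<Delta>"
proof -
  obtain M where M: "0 < M" "\<And>s. s \<in> {0..1} \<Longrightarrow> \<bar>f s\<bar> \<le> M"
    using piecewise_lipschitz_bounded[OF f] by metis
  obtain G where G: "0 < G" "\<And>s. s \<in> {0..1} \<Longrightarrow> \<bar>g s\<bar> \<le> G"
    using piecewise_lipschitz_bounded[OF g] by metis
  define I where "I = (LINT s|lborel. indicator {0..1} s * f s)"
  define J where "J = (LINT s|lborel. indicator {0..1} s * (1 / g s))"
  have IJ: "I = c * J" using balance by (simp add: I_def J_def)
  obtain C1 where C1: "\<And>n. 0 < n \<Longrightarrow> \<bar>(\<Sum>i=1..n. f (real i / real n)) - real n * I\<bar> \<le> C1"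
    using riemann_sum_error[OF f] unfolding I_def by blast
  obtain C2 where C2: "\<And>n. 0 < n \<Longrightarrow> \<bar>(\<Sum>j=1..n. 1 / g (real j / real n)) - real n * J\<bar> \<le> C2"
    using riemann_sum_error[OF piecewise_lipschitz_inverse[OF g \<delta>]] unfolding J_def by blast
  text \<open>The measure is invariant under \<open>x \<mapsto> x / S\<close>, \<open>y \<mapsto> y * S\<close>; this \<open>S\<close> normalizes the quadratic
    power sum to \<open>2\<close>, which makes the generating polynomial tend to \<open>exp (- z\<^sup>2)\<close>.\<close>
  define x where "x = (\<lambda>n i. f (real (n - i) / real n))"
  define y where "y = (\<lambda>n j. g (real j / real (k n)))"
  define S where "S = (\<lambda>n. sqrt (((\<Sum>i<n. (x n i)\<^sup>2) + (\<Sum>j=1..k n. (1 / y n j)\<^sup>2)) / 2))"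
  \<comment> \<open>One index set for both kinds of linear factors of the reflected polynomial: 1 +
    \<eta> / (y S) and 1 - x \<eta> / S.\<close>
  define B where "B = (\<lambda>n. {1..k n} <+> {..<n})"
  define \<beta> where "\<beta> = (\<lambda>n. case_sum (\<lambda>j. 1 / (y n j * S n)) (\<lambda>i. - (x n i / S n)))"
  have x: "0 < x n i" "x n i \<le> M" if "i < n" for n i
    using fpos M(2)[of "real (n - i) / real n"] that by (auto simp: x_def abs_le_iff)
  have y: "\<delta> \<le> y n j" "y n j \<le> G" if "j \<in> {1..k n}" for n j
    using \<delta>(2) G(2)[of "real j / real (k n)"] that by (auto simp: y_def abs_le_iff)
  have y0: "0 < y n j" if "j \<in> {1..k n}" for n j
    using y(1)[OF that] \<delta>(1) by linarith
  have S2: "(S n)\<^sup>2 = ((\<Sum>i<n. (x n i)\<^sup>2) + (\<Sum>j=1..k n. (1 / y n j)\<^sup>2)) / 2" for n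
    unfolding S_def by (intro real_sqrt_pow2 divide_nonneg_pos add_nonneg_nonneg sum_nonneg) auto
  \<comment> \<open>A lower bound for S of order sqrt k, from y \<le> G in each of the k summands 1
    / y^2.\<close>
  define q where "q = (\<lambda>n. sqrt (real (k n)) / (sqrt 2 * G))"
  have Sq: "q n \<le> S n" for n
  proof -
    have "real (k n) * (1 / G)\<^sup>2 = (\<Sum>j=1..k n. (1 / G)\<^sup>2)" by simp
    also have "\<dots> \<le> (\<Sum>j=1..k n. (1 / y n j)\<^sup>2)"
      using G(1) y y0 by (intro sum_mono power_mono frac_le) auto
    also have "\<dots> \<le> (\<Sum>i<n. (x n i)\<^sup>2) + (\<Sum>j=1..k n. (1 / y n j)\<^sup>2)"
      by (simp add: sum_nonneg)
    finally have "real (k n) * (1 / G)\<^sup>2 \<le> 2 * (S n)\<^sup>2" unfolding S2 by simp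
    then have "(q n)\<^sup>2 \<le> (S n)\<^sup>2"
      unfolding q_def by (simp add: power_divide power_mult_distrib)
    moreover have "0 \<le> S n" unfolding S_def
      by (intro real_sqrt_ge_zero divide_nonneg_pos add_nonneg_nonneg sum_nonneg) auto
    ultimately show ?thesis by (rule power2_le_imp_le)
  qed
  have kinf': "filterlim (\<lambda>n. real (k n)) at_top sequentially"
    by (rule filterlim_compose[OF filterlim_real_sequentially kinf])
  have qinf: "filterlim q at_top sequentially"
    unfolding q_def divide_inverse
    by (rule filterlim_at_top_mult_tendsto_pos[OF tendsto_const _ filterlim_compose[OF sqrt_at_top kinf']])
      (use G(1) in simp)
  have Sinf: "filterlim S at_top sequentially"
    by (rule filterlim_at_top_mono[OF qinf always_eventually[OF allI[OF Sq]]])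
  have ev_S: "\<forall>\<^sub>F n in sequentially. L < S n" for L
    using Sinf unfolding filterlim_at_top_dense by blast
  have ev_n: "\<forall>\<^sub>F n in sequentially. L < n" for L :: nat
    by (rule eventually_gt_at_top)
  have ev_k: "\<forall>\<^sub>F n in sequentially. L < k n" for L :: nat
    by (rule eventually_compose_filterlim[OF eventually_gt_at_top kinf])
  have sumB: "(\<Sum>b\<in>B n. h b) = (\<Sum>j=1..k n. h (Inl j)) + (\<Sum>i<n. h (Inr i))" for n and h :: "nat + nat \<Rightarrow> real"
    unfolding B_def by (simp add: sum.Plus)
  have finB: "finite (B n)" for n by (simp add: B_def)
  have sum2: "\<forall>\<^sub>F n in sequentially. (\<Sum>b\<in>B n. (\<beta> n b)\<^sup>2) = 2"
    using ev_S[of 0]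
  proof eventually_elim
    case (elim n)
    have "(\<Sum>b\<in>B n. (\<beta> n b)\<^sup>2) = ((\<Sum>i<n. (x n i)\<^sup>2) + (\<Sum>j=1..k n. (1 / y n j)\<^sup>2)) / (S n)\<^sup>2"
      unfolding sumB \<beta>_def
      by (simp add: power_divide power_mult_distrib sum_divide_distrib add_divide_distrib)
    also have "\<dots> = (2 * (S n)\<^sup>2) / (S n)\<^sup>2"
      by (rule arg_cong[where f = "\<lambda>u. u / (S n)\<^sup>2"]) (simp add: S2)
    finally show ?case using elim by simp
  qed
  have small: "\<forall>\<^sub>F n in sequentially. \<forall>b\<in>B n. \<bar>\<beta> n b\<bar> \<le> e" if e: "0 < e" for e
    using ev_S[of "(M + 1 / \<delta>) / e"] ev_S[of 0]
  proof eventually_elim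
    case (elim n)
    have "(M + 1 / \<delta>) / S n \<le> e" using elim e by (simp add: field_simps)
    then have MS: "M / S n + 1 / \<delta> / S n \<le> e" by (simp add: add_divide_distrib)
    have nn: "0 \<le> M / S n" "0 \<le> 1 / \<delta> / S n" using elim M(1) \<delta>(1) by auto
    have "1 / (y n j * S n) \<le> 1 / \<delta> / S n" if "j \<in> {1..k n}" for j
      unfolding divide_divide_eq_left using y(1)[OF that] \<delta>(1) elim by (intro frac_le mult_right_mono mult_pos_pos) auto
    moreover have "0 \<le> 1 / (y n j * S n)" if "j \<in> {1..k n}" for j
      using y0[OF that] elim by simp
    ultimately have "\<bar>1 / (y n j * S n)\<bar> \<le> e" if "j \<in> {1..k n}" for j
      using nn MS unfolding abs_of_nonneg[OF \<open>\<And>j. j \<in> {1..k n} \<Longrightarrow> 0 \<le> 1 / (y n j * S n)\<close>[OF that]]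
      by (meson add_increasing order_trans that)
    moreover have "\<bar>- (x n i / S n)\<bar> \<le> e" if "i < n" for i
    proof -
      have "x n i / S n \<le> M / S n" using x(2)[OF that] elim by (intro divide_right_mono) auto
      moreover have "0 \<le> x n i / S n" using x(1)[OF that] elim by simp
      ultimately show ?thesis using nn MS unfolding abs_minus_cancel by linarith
    qed
    ultimately show ?case by (auto simp: B_def \<beta>_def)
  qed
  \<comment> \<open>The Riemann sums and the balance I = c J leave a bounded error plus |J| |k - n
    c|. Divided by S, which is at least of order sqrt n, both vanish, the second by
    \<open>kn\<close>.\<close>
  have sum1: "(\<lambda>n. \<Sum>b\<in>B n. \<beta> n b) \<longlonglongrightarrow> 0"
  proof (rule Lim_null_comparison)
    let ?R = "\<lambda>n. (C1 + C2) / q n + \<bar>J\<bar> * (\<bar>(real (k n) - real n * c) / sqrt (real n)\<bar> * (sqrt 2 * G / sqrt (real (k n) / real n)))"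
    show "?R \<longlonglongrightarrow> 0"
    proof -
      have "?R \<longlonglongrightarrow> 0 + \<bar>J\<bar> * (\<bar>0\<bar> * (sqrt 2 * G / sqrt c))"
        using c by (intro tendsto_intros kc kn tendsto_divide_0[OF tendsto_const filterlim_at_top_imp_at_infinity[OF qinf]]) auto
      then show ?thesis by simp
    qed
    show "\<forall>\<^sub>F n in sequentially. norm (\<Sum>b\<in>B n. \<beta> n b) \<le> ?R n"
      using ev_k[of 0] ev_n[of 0]
    proof eventually_elim
      case (elim n)
      have q0: "0 < q n" using elim G(1) by (simp add: q_def)
      have "(\<Sum>i<n. x n i) = (\<Sum>i=1..n. f (real i / real n))"
        unfolding x_def by (rule sum.reindex_bij_witness[where i = "\<lambda>i. n - i" and j = "\<lambda>i. n - i"]) auto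
      then have a1: "\<bar>(\<Sum>i<n. x n i) - real n * I\<bar> \<le> C1" using C1[of n] elim by simp
      have a2: "\<bar>(\<Sum>j=1..k n. 1 / y n j) - real (k n) * J\<bar> \<le> C2"
        using C2[of "k n"] elim by (simp only: y_def)
      have "(\<Sum>b\<in>B n. \<beta> n b) = ((\<Sum>j=1..k n. 1 / y n j) - (\<Sum>i<n. x n i)) / S n"
        unfolding sumB \<beta>_def by (simp add: sum_divide_distrib sum_negf diff_divide_distrib)
      then have "norm (\<Sum>b\<in>B n. \<beta> n b) = \<bar>(\<Sum>j=1..k n. 1 / y n j) - (\<Sum>i<n. x n i)\<bar> / S n"
        using q0 Sq[of n] by simp
      also have "\<dots> \<le> (C1 + C2 + \<bar>J\<bar> * \<bar>real (k n) - real n * c\<bar>) / q n"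
      proof (rule frac_le)
        have "real (k n) * J - real n * I = J * (real (k n) - real n * c)"
          unfolding IJ by (simp add: algebra_simps)
        then have "\<bar>real (k n) * J - real n * I\<bar> = \<bar>J\<bar> * \<bar>real (k n) - real n * c\<bar>"
          by (simp only: abs_mult)
        then show "\<bar>(\<Sum>j=1..k n. 1 / y n j) - (\<Sum>i<n. x n i)\<bar> \<le> C1 + C2 + \<bar>J\<bar> * \<bar>real (k n) - real n * c\<bar>"
          using a1 a2 by linarith
        show "0 \<le> C1 + C2 + \<bar>J\<bar> * \<bar>real (k n) - real n * c\<bar>"
          using a1 a2 by (intro add_nonneg_nonneg mult_nonneg_nonneg) auto
      qed (use q0 Sq in auto)
      also have "\<dots> = ?R n"
      proof -
        have gen: "D / (b / e) = D / a * (e / (b / a))" if "0 < a" for a b e D :: real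
          using that by simp
        have a: "0 < sqrt (real n)" using elim by simp
        have "\<bar>real (k n) - real n * c\<bar> / q n
            = \<bar>(real (k n) - real n * c) / sqrt (real n)\<bar> * (sqrt 2 * G / sqrt (real (k n) / real n))"
          unfolding q_def real_sqrt_divide abs_divide abs_of_pos[OF a] by (rule gen[OF a])
        then show ?thesis by (simp only: add_divide_distrib times_divide_eq_right[symmetric])
      qed
      finally show ?case .
    qed
  qed
  define X where "X = (\<lambda>n i. complex_of_real (x n i / S n))"
  define Y where "Y = (\<lambda>n j. complex_of_real (y n j * S n))"
  have poly_eq: "factor_poly (\<lambda>j. 1 / Y n j) (k n) * (\<Prod>i<n. [:1, - X n i:]) = beta_poly B \<beta> n" for n
    unfolding B_def by (simp add: prod.Plus \<beta>_def X_def Y_def)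
  \<comment> \<open>S > M places all rescaled nodes in (0,1), hence inside the circle.\<close>
  have ev: "\<forall>\<^sub>F n in sequentially. 0 < n \<and> \<Delta> \<le> n \<and> \<Delta> \<le> k n \<and> M < S n"
    using ev_n[of 0] ev_n[of \<Delta>] ev_k[of \<Delta>] ev_S[of M] by eventually_elim auto
  have pos: "0 < S n" "\<And>i. i < n \<Longrightarrow> 0 < x n i / S n" "\<And>i. i < n \<Longrightarrow> x n i / S n < 1"
    "\<And>j. j \<in> {1..k n} \<Longrightarrow> 0 < y n j * S n" if "M < S n" for n
  proof -
    show S0: "0 < S n" using that M(1) by linarith
    show "0 < x n i / S n" "x n i / S n < 1" if "i < n" for i
      using x[OF that] S0 \<open>M < S n\<close> by auto
    show "0 < y n j * S n" if "j \<in> {1..k n}" for j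
      using y0[OF that] S0 by simp
  qed
  have Xball: "X n i \<in> ball (1/2) (1/2)" if "M < S n" "i < n" for n i
    unfolding X_def using pos(2,3)[OF that] by (rule of_real_in_half_ball)
  have Yne: "1 + Y n j * w \<noteq> 0" if "M < S n" "j \<in> {1..k n}" "w \<in> half_disc" for n j w
    unfolding Y_def using pos(4)[OF that(1,2)] that(3) by (rule one_plus_mult_half_disc_neq_0)
  have "(\<lambda>n. gap_kernel (X n) (Y n) n (k n) \<Delta> r s) \<longlonglongrightarrow> of_real (K_crit \<Delta> s r)"
    if rs: "r < \<Delta>" "s < \<Delta>" for r s
  proof -
    have "(\<lambda>n. \<Sum>l\<le>\<Delta> - 1 - r. coeff (beta_poly B \<beta> n) l * line_int (beta_poly B \<beta> n) (int l + int r - int s))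
      \<longlonglongrightarrow> of_real (K_crit \<Delta> s r)"
      unfolding K_crit_eq_hankel
      by (intro tendsto_sum tendsto_mult coeff_beta_poly_limit line_int_limit finB sum1 sum2 small)
    moreover have "\<forall>\<^sub>F n in sequentially. (\<Sum>l\<le>\<Delta> - 1 - r. coeff (beta_poly B \<beta> n) l * line_int (beta_poly B \<beta> n) (int l + int r - int s))
        = gap_kernel (X n) (Y n) n (k n) \<Delta> r s"
      using ev
    proof eventually_elim
      case (elim n)
      have S: "M < S n" and d: "\<Delta> \<le> n" "\<Delta> \<le> k n" using elim by auto
      have Y0: "Y n j \<noteq> 0" if "j \<in> {1..k n}" for j
        using pos(4)[OF S that] unfolding Y_def of_real_eq_0_iff by linarith
      show ?case
        using gap_kernel_line[of n "X n" "k n" "Y n" \<Delta> r s, OF Xball[OF S] Yne[OF S] Y0 d rs]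
        unfolding poly_eq by simp
    qed
    ultimately show ?thesis by (rule Lim_transform_eventually)
  qed
  then have "(\<lambda>n. ldet \<Delta> (\<lambda>r s. (if r = s then 1 else 0) - gap_kernel (X n) (Y n) n (k n) \<Delta> r s))
      \<longlonglongrightarrow> of_real (crit_det \<Delta>)"
    unfolding crit_det_eq_ldet by (intro tendsto_ldet tendsto_diff tendsto_const)
  moreover have "\<forall>\<^sub>F n in sequentially.
      ldet \<Delta> (\<lambda>r s. (if r = s then 1 else 0) - gap_kernel (X n) (Y n) n (k n) \<Delta> r s)
      = of_real (\<Sum>lam\<in>{lam \<in> diagrams_in_box n (k n). lam 0 \<le> k n - \<Delta>}. mu f g n (k n) lam)"
    using ev
  proof eventually_elim
    case (elim n)
    have n: "0 < n" and S: "M < S n" and d: "\<Delta> \<le> n" "\<Delta> \<le> k n" using elim by auto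
    show ?case
      using sum_mu_eq_ldet[OF n d pos(1)[OF S], of f g] pos(2-4)[OF S]
      unfolding X_def Y_def x_def y_def by simp
  qed
  ultimately have "(\<lambda>n. complex_of_real (\<Sum>lam\<in>{lam \<in> diagrams_in_box n (k n). lam 0 \<le> k n - \<Delta>}. mu f g n (k n) lam))
      \<longlonglongrightarrow> of_real (crit_det \<Delta>)"
    by (rule Lim_transform_eventually)
  then show ?thesis by (simp only: tendsto_of_real_iff)
qed

text \<open>There are two readings of the centring. The linear term compares k with n c on the scale
  sqrt n, which k / n \<longlonglongrightarrow> c alone does not control. For k = floor (n c) the
  event can be centred at n c itself; for k - n c = o(sqrt n) it is centred at the right corner k of
  the rectangle.\<close>

theorem theorem1p9:
  fixes f g :: "real \<Rightarrow> real" and k :: "nat \<Rightarrow> nat"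
    and c t_minus t_plus :: real and \<Delta> :: nat
  assumes "piecewise_C1 f" and "piecewise_C1 g"
    and "\<forall>s\<in>{0..1}. f s > 0" and "\<forall>s\<in>{0..1}. g s \<ge> 0"
    and "filterlim k at_top sequentially"
    and "(\<lambda>n. real (k n) / real n) \<longlonglongrightarrow> c"
    and "is_support_interval f g c t_minus t_plus"
    and "t_plus = c"
  shows
    "((\<forall>\<^sub>F n in sequentially. int (k n) = \<lfloor>real n * c\<rfloor>) \<longrightarrow>
        (\<lambda>n. measure (diagram_law f g n (k n))
               {lam \<in> diagrams_in_box n (k n). real (lam 0) - real n * c \<le> - real \<Delta>})
          \<longlonglongrightarrow> crit_det \<Delta>) \<and>
     ((\<lambda>n. (real (k n) - real n * c) / sqrt (real n)) \<longlonglongrightarrow> 0 \<longrightarrow>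
        (\<lambda>n. measure (diagram_law f g n (k n))
               {lam \<in> diagrams_in_box n (k n). real (lam 0) - real (k n) \<le> - real \<Delta>})
          \<longlonglongrightarrow> crit_det \<Delta>)"
proof -
  have c0: "0 \<le> c"
    by (rule LIMSEQ_le_const[OF assms(6)]) simp
  have supp: "is_support_interval f g c t_minus c" using assms(7,8) by simp
  note cs = critical_support[OF assms(1-4) c0 supp]
  obtain \<delta> where \<delta>: "0 < \<delta>" "\<forall>s\<in>{0..1}. \<delta> \<le> g s" using cs(2) by blast
  have nonneg: "\<forall>s\<in>{0..1}. 0 \<le> f s" using assms(3) by (simp add: less_imp_le)
  have lim: "(\<lambda>n. measure (diagram_law f g n (k n)) {lam \<in> diagrams_in_box n (k n). lam 0 \<le> k n - \<Delta>}) \<longlonglongrightarrow> crit_det \<Delta>"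
    if kn: "(\<lambda>n. (real (k n) - real n * c) / sqrt (real n)) \<longlonglongrightarrow> 0"
    unfolding measure_diagram_law[OF nonneg assms(4)]
    by (rule first_row_gap_limit[OF piecewise_C1_imp_lipschitz[OF assms(1)]
          piecewise_C1_imp_lipschitz[OF assms(2)] assms(3) \<delta> cs(3,1) assms(5,6) kn])
  have k\<Delta>: "\<forall>\<^sub>F n in sequentially. \<Delta> \<le> k n"
    by (rule eventually_compose_filterlim[OF eventually_ge_at_top assms(5)])
  \<comment> \<open>Both events are eventually \<open>lam 0 \<le> k n - \<Delta>\<close>, where the
    subtraction is exact as soon as \<Delta> \<le> \<open>k n\<close>.\<close>
  have transfer: "(\<lambda>n. measure (diagram_law f g n (k n)) {lam \<in> diagrams_in_box n (k n). Q n (lam 0)}) \<longlonglongrightarrow> crit_det \<Delta>"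
    if kn: "(\<lambda>n. (real (k n) - real n * c) / sqrt (real n)) \<longlonglongrightarrow> 0"
      and Q: "\<forall>\<^sub>F n in sequentially. \<forall>m. Q n m \<longleftrightarrow> m \<le> k n - \<Delta>" for Q
    by (rule Lim_transform_eventually[OF lim[OF kn]], use Q in eventually_elim) simp
  show ?thesis
  proof (intro conjI impI)
    assume fl: "\<forall>\<^sub>F n in sequentially. int (k n) = \<lfloor>real n * c\<rfloor>"
    have kfl: "real (k n) \<le> real n * c \<and> real n * c < real (k n) + 1" if "int (k n) = \<lfloor>real n * c\<rfloor>" for n
      using that by linarith
    show "(\<lambda>n. measure (diagram_law f g n (k n))
               {lam \<in> diagrams_in_box n (k n). real (lam 0) - real n * c \<le> - real \<Delta>}) \<longlonglongrightarrow> crit_det \<Delta>"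
    proof (rule transfer)
      show "(\<lambda>n. (real (k n) - real n * c) / sqrt (real n)) \<longlonglongrightarrow> 0"
      proof (rule Lim_null_comparison)
        show "\<forall>\<^sub>F n in sequentially. norm ((real (k n) - real n * c) / sqrt (real n)) \<le> 1 / sqrt (real n)"
          using fl
        proof eventually_elim
          case (elim n)
          have "\<bar>real (k n) - real n * c\<bar> \<le> 1" using kfl[OF elim] by linarith
          then have "\<bar>real (k n) - real n * c\<bar> / sqrt (real n) \<le> 1 / sqrt (real n)"
            by (intro divide_right_mono) simp_all
          then show ?case by (simp add: abs_divide)
        qed
        show "(\<lambda>n. 1 / sqrt (real n)) \<longlonglongrightarrow> 0" by real_asymp
      qed
      show "\<forall>\<^sub>F n in sequentially. \<forall>m. real m - real n * c \<le> - real \<Delta> \<longleftrightarrow> m \<le> k n - \<Delta>"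
        using fl k\<Delta>
      proof eventually_elim
        case (elim n)
        show ?case
        proof
          fix m
          \<comment> \<open>For an integer m + \<Delta>, being at most n c is the same as being at
            most floor (n c) = k.\<close>
          have "real m - real n * c \<le> - real \<Delta> \<longleftrightarrow> m + \<Delta> \<le> k n"
            using kfl[OF elim(1)] by linarith
          then show "real m - real n * c \<le> - real \<Delta> \<longleftrightarrow> m \<le> k n - \<Delta>" using elim(2) by linarith
        qed
      qed
    qed
  next
    assume kn: "(\<lambda>n. (real (k n) - real n * c) / sqrt (real n)) \<longlonglongrightarrow> 0"
    show "(\<lambda>n. measure (diagram_law f g n (k n))
               {lam \<in> diagrams_in_box n (k n). real (lam 0) - real (k n) \<le> - real \<Delta>}) \<longlonglongrightarrow> crit_det \<Delta>"
    proof (rule transfer[OF kn])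
      show "\<forall>\<^sub>F n in sequentially. \<forall>m. real m - real (k n) \<le> - real \<Delta> \<longleftrightarrow> m \<le> k n - \<Delta>"
        using k\<Delta> by eventually_elim auto
    qed
  qed
qed

end
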